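(* Let $p$ be a prime, $X$ a nonempty set, $S$ the free profinite group on $X$, and $n\geq2$. One has $$\dim_{\mathbb{F}_p}H^2(S^{[n,p]},\mathbb{Z}/p)=\dim_{\mathbb{F}_p}(S^{(n,p)}/S^{(n+1,p)})=\sum_{s=1}^n\varphi_s(|X|),$$ where $\varphi_s$ is the necklace map.
   Context: For a profinite group $G$: $G^{(1,p)}=G$, $G^{(n+1,p)}=(G^{(n,p)})^p[G,G^{(n,p)}]$ (closed subgroup generated by all $h^p$ and $[g,h]=g^{-1}h^{-1}gh$, $g\in G$, $h\in G^{(n,p)}$), and $G^{[n,p]}=G/G^{(n,p)}$. Cohomology is profinite cohomology with trivial action on $\mathbb{Z}/p$. The free profinite group $S=S_X$ on basis $X$: $X\subseteq S$ generates $S$ topologically, the inclusion converges to $1$ (every open normal subgroup contains all but finitely many elements of $X$), and every map $X\to G$ to a profinite group converging to $1$ extends uniquely to a continuous homomorphism $S\to G$. The necklace map: for integers $s,m\geq1$, $\varphi_s(m)=\frac1s\sum_{d|s}\mu(d)m^{s/d}$ with $\mu$ the M\"obius function, and $\varphi_s(\infty)=\infty$; here $|X|$ and the dimensions are regarded as elements of $\{0,1,2,\ldots\}\cup\{\infty\}$. *)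

theory Defs
  imports
    "HOL-Analysis.Analysis"
    "HOL-Algebra.Generated_Groups"
    "HOL-Number_Theory.Residues"
    "HOL-Computational_Algebra.Squarefree"
    "Jordan_Normal_Form.Missing_VectorSpace"
begin

section \<open>Profinite groups\<close>

definition totally_disconnected_space :: "'a topology \<Rightarrow> bool" where
  "totally_disconnected_space T \<longleftrightarrow> (\<forall>C. connectedin T C \<longrightarrow> (\<exists>x. C \<subseteq> {x}))"

locale profinite_group = group G
  for G :: "('a, 'm) monoid_scheme" (structure) and T :: "'a topology" +
  assumes topspace_eq: "topspace T = carrier G"
    and continuous_mult: "continuous_map (prod_topology T T) T (\<lambda>(x, y). x \<otimes> y)"
    and continuous_inv: "continuous_map T T (\<lambda>x. inv x)"
    and compact: "compact_space T"
    and Hausdorff: "Hausdorff_space T"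
    and totally_disconnected: "totally_disconnected_space T"

definition closed_generate ::
    "('a, 'm) monoid_scheme \<Rightarrow> 'a topology \<Rightarrow> 'a set \<Rightarrow> 'a set" where
  "closed_generate G T A = T closure_of (generate G A)"

text \<open>\<open>f : X \<rightarrow> G\<close> converges to \<open>1\<close>.\<close>

definition converges_to_one ::
    "('a, 'm) monoid_scheme \<Rightarrow> 'a topology \<Rightarrow> 'x set \<Rightarrow> ('x \<Rightarrow> 'a) \<Rightarrow> bool" where
  "converges_to_one G T X f \<longleftrightarrow>
     (\<forall>N. N \<lhd> G \<and> openin T N \<longrightarrow> finite {x \<in> X. f x \<notin> N})"

text \<open>
  HOL cannot quantify over all types inside a locale assumption, so the universal property ranges
  over the profinite groups whose elements have type \<^typ>\<open>'a set\<close>, where \<^typ>\<open>'a\<close> is the type of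
  the elements of \<open>S\<close>.  This loses nothing when \<open>X\<close> is nonempty.  First, \<^typ>\<open>'a\<close> is infinite:
  if it had \<open>k\<close> elements, a cyclic group of order \<open>2 ^ k > k\<close> would live on \<^typ>\<open>'a set\<close>, and
  mapping one element of \<open>X\<close> to a generator and the others to \<open>1\<close> would extend to a surjection
  from \<open>S\<close>.  So every finite group has a copy on \<^typ>\<open>'a set\<close>, and the universal property for
  finite groups implies it for their inverse limits.
\<close>

locale free_profinite_group = profinite_group S T
  for S :: "('a, 'm) monoid_scheme" (structure) and T :: "'a topology" +
  fixes X :: "'a set"
  assumes basis_subset: "X \<subseteq> carrier S"
    and basis_generates: "closed_generate S T X = carrier S"
    and basis_converges: "converges_to_one S T X (\<lambda>x. x)"
    and universal:
      "\<And>(G :: 'a set monoid) U f.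
         \<lbrakk>profinite_group G U; f \<in> X \<rightarrow> carrier G; converges_to_one G U X f\<rbrakk> \<Longrightarrow>
         \<exists>!h. h \<in> hom S G \<and> h \<in> extensional (carrier S) \<and> continuous_map T U h \<and>
              (\<forall>x\<in>X. h x = f x)"


section \<open>The lower \<open>p\<close>-central filtration\<close>

definition commutator :: "('a, 'm) monoid_scheme \<Rightarrow> 'a \<Rightarrow> 'a \<Rightarrow> 'a" where
  "commutator G g h = inv\<^bsub>G\<^esub> g \<otimes>\<^bsub>G\<^esub> inv\<^bsub>G\<^esub> h \<otimes>\<^bsub>G\<^esub> g \<otimes>\<^bsub>G\<^esub> h"

text \<open>The filtration is indexed from \<open>1\<close>; the value at \<open>0\<close> is a dummy.\<close>

fun lower_p_central ::
    "('a, 'm) monoid_scheme \<Rightarrow> 'a topology \<Rightarrow> nat \<Rightarrow> nat \<Rightarrow> 'a set" where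
  "lower_p_central G T p 0 = carrier G"
| "lower_p_central G T p (Suc 0) = carrier G"
| "lower_p_central G T p (Suc (Suc n)) =
     closed_generate G T
       ({h [^]\<^bsub>G\<^esub> p | h. h \<in> lower_p_central G T p (Suc n)} \<union>
        {commutator G g h | g h. g \<in> carrier G \<and> h \<in> lower_p_central G T p (Suc n)})"

definition quotient_group_topology ::
    "('a, 'm) monoid_scheme \<Rightarrow> 'a topology \<Rightarrow> 'a set \<Rightarrow> 'a set topology" where
  "quotient_group_topology G T N =
     topology (\<lambda>U. U \<subseteq> carrier (G Mod N) \<and> openin T {x \<in> carrier G. N #>\<^bsub>G\<^esub> x \<in> U})"

lemma (in profinite_group) openin_quotient_group_topology:
  "openin (quotient_group_topology G T N) U \<longleftrightarrow>
     U \<subseteq> carrier (G Mod N) \<and> openin T {x \<in> carrier G. N #> x \<in> U}"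
proof -
  have inter: "{x \<in> carrier G. N #> x \<in> U \<inter> V} =
      {x \<in> carrier G. N #> x \<in> U} \<inter> {x \<in> carrier G. N #> x \<in> V}" for U V
    by auto
  have union: "{x \<in> carrier G. N #> x \<in> \<Union>\<K>} = (\<Union>K\<in>\<K>. {x \<in> carrier G. N #> x \<in> K})" for \<K>
    by auto
  have "istopology (\<lambda>U. U \<subseteq> carrier (G Mod N) \<and> openin T {x \<in> carrier G. N #> x \<in> U})"
    unfolding istopology_def union inter by (intro conjI allI impI openin_Int openin_Union) auto
  then show ?thesis
    by (simp add: quotient_group_topology_def)
qed


section \<open>Dimension over the prime field\<close>

text \<open>
  An abelian group \<open>A\<close>, written multiplicatively and killed by \<open>p\<close>, carries a unique structure of
  vector space over \<open>\<int>/p\<close>: the residue \<open>a\<close> acts as the \<open>a\<close>-th power.  The ring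
  multiplication and unit of the module record play no role.
\<close>

definition Fp_space :: "('a, 'm) monoid_scheme \<Rightarrow> (int, 'a) module" where
  "Fp_space A =
     \<lparr>carrier = carrier A, monoid.mult = undefined, one = undefined,
      zero = \<one>\<^bsub>A\<^esub>, add = (\<otimes>\<^bsub>A\<^esub>), smult = (\<lambda>a x. x [^]\<^bsub>A\<^esub> a)\<rparr>"

lemma vectorspace_Fp_space:
  assumes "prime p" "comm_group A" "\<And>x. x \<in> carrier A \<Longrightarrow> x [^]\<^bsub>A\<^esub> p = \<one>\<^bsub>A\<^esub>"
  shows "vectorspace (residue_ring (int p)) (Fp_space A)"
proof -
  interpret A: comm_group A by fact
  interpret R: residues_prime p "residue_ring (int p)"
    by (unfold_locales) (use assms in auto)
  have pow_mod: "x [^]\<^bsub>A\<^esub> (a mod int p) = x [^]\<^bsub>A\<^esub> a" if "x \<in> carrier A" for x and a :: int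
  proof -
    have "x [^]\<^bsub>A\<^esub> a = x [^]\<^bsub>A\<^esub> (int p * (a div int p) + a mod int p)" by simp
    also have "\<dots> = (x [^]\<^bsub>A\<^esub> (int p)) [^]\<^bsub>A\<^esub> (a div int p) \<otimes>\<^bsub>A\<^esub> x [^]\<^bsub>A\<^esub> (a mod int p)"
      using that by (simp only: A.int_pow_mult A.int_pow_pow)
    finally show ?thesis using that assms(3) by (simp add: int_pow_int)
  qed
  have ab: "abelian_group (Fp_space A)"
    by (rule abelian_groupI)
       (auto simp: Fp_space_def A.m_ac intro: bexI[of _ "inv\<^bsub>A\<^esub> x" for x])
  have "module (residue_ring (int p)) (Fp_space A)"
    by (rule moduleI[OF R.cring ab])
       (auto simp: Fp_space_def residue_ring_def pow_mod A.int_pow_mult A.int_pow_pow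
          A.int_pow_distrib mult.commute)
  then show ?thesis
    by (simp add: vectorspace_def R.is_field)
qed

definition Fp_dim :: "nat \<Rightarrow> ('a, 'm) monoid_scheme \<Rightarrow> enat" where
  "Fp_dim p A =
     (if vectorspace.fin_dim (residue_ring (int p)) (Fp_space A)
      then enat (vectorspace.dim (residue_ring (int p)) (Fp_space A)) else \<infinity>)"


section \<open>Second cohomology with trivial coefficients \<open>\<int>/p\<close>\<close>

text \<open>Continuous inhomogeneous cochains, with \<open>\<int>/p\<close> discrete.\<close>

definition cochains1 ::
    "('a, 'm) monoid_scheme \<Rightarrow> 'a topology \<Rightarrow> nat \<Rightarrow> ('a \<Rightarrow> int) set" where
  "cochains1 G T p =
     {c \<in> extensional (carrier G).
        continuous_map T (discrete_topology (carrier (residue_ring (int p)))) c}"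

definition cochains2 ::
    "('a, 'm) monoid_scheme \<Rightarrow> 'a topology \<Rightarrow> nat \<Rightarrow> ('a \<times> 'a \<Rightarrow> int) set" where
  "cochains2 G T p =
     {f \<in> extensional (carrier G \<times> carrier G).
        continuous_map (prod_topology T T)
          (discrete_topology (carrier (residue_ring (int p)))) f}"

definition coboundary ::
    "('a, 'm) monoid_scheme \<Rightarrow> nat \<Rightarrow> ('a \<Rightarrow> int) \<Rightarrow> ('a \<times> 'a \<Rightarrow> int)" where
  "coboundary G p c =
     (let R = residue_ring (int p) in
      restrict (\<lambda>(x, y). c y \<ominus>\<^bsub>R\<^esub> c (x \<otimes>\<^bsub>G\<^esub> y) \<oplus>\<^bsub>R\<^esub> c x)
        (carrier G \<times> carrier G))"

definition cocycles2 ::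
    "('a, 'm) monoid_scheme \<Rightarrow> 'a topology \<Rightarrow> nat \<Rightarrow> ('a \<times> 'a \<Rightarrow> int) set" where
  "cocycles2 G T p =
     (let R = residue_ring (int p) in
      {f \<in> cochains2 G T p. \<forall>x\<in>carrier G. \<forall>y\<in>carrier G. \<forall>z\<in>carrier G.
         f (y, z) \<ominus>\<^bsub>R\<^esub> f (x \<otimes>\<^bsub>G\<^esub> y, z) \<oplus>\<^bsub>R\<^esub> f (x, y \<otimes>\<^bsub>G\<^esub> z) \<ominus>\<^bsub>R\<^esub> f (x, y) = \<zero>\<^bsub>R\<^esub>})"

definition cocycle_group2 ::
    "('a, 'm) monoid_scheme \<Rightarrow> 'a topology \<Rightarrow> nat \<Rightarrow> ('a \<times> 'a \<Rightarrow> int) monoid" where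
  "cocycle_group2 G T p =
     (let R = residue_ring (int p) in
      \<lparr>carrier = cocycles2 G T p,
       mult = (\<lambda>f g. \<lambda>u\<in>carrier G \<times> carrier G. f u \<oplus>\<^bsub>R\<^esub> g u),
       one = (\<lambda>u\<in>carrier G \<times> carrier G. \<zero>\<^bsub>R\<^esub>)\<rparr>)"

definition cohomology2 ::
    "('a, 'm) monoid_scheme \<Rightarrow> 'a topology \<Rightarrow> nat \<Rightarrow> ('a \<times> 'a \<Rightarrow> int) set monoid" where
  "cohomology2 G T p = cocycle_group2 G T p Mod (coboundary G p ` cochains1 G T p)"


section \<open>The necklace map\<close>

definition moebius_mu :: "nat \<Rightarrow> int" where
  "moebius_mu n = (if squarefree n then (-1) ^ card (prime_factors n) else 0)"

text \<open>The values are taken in \<^typ>\<open>ereal\<close>, so that the division by \<open>s\<close> is a genuine one.\<close>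

fun necklace :: "nat \<Rightarrow> enat \<Rightarrow> ereal" where
  "necklace s (enat m) =
     ereal (1 / real s * (\<Sum>d | d dvd s. real_of_int (moebius_mu d) * real m ^ (s div d)))"
| "necklace s \<infinity> = \<infinity>"

definition ecard :: "'a set \<Rightarrow> enat" where
  "ecard A = (if finite A then enat (card A) else \<infinity>)"

end

theory Submission
  imports Defs "HOL-Computational_Algebra.Formal_Power_Series"
begin

text \<open>
  If a group is generated, modulo the \<open>(n + 1)\<close>-st term of a central filtration, by weighted elements,
  and \<open>y\<close> is one of minimal weight, then it is the product of \<open>\<langle>y\<rangle>\<close> and the subgroup generated by the
  iterated commutators \<open>[z, y, \<dots>, y]\<close> of the other generators \<open>z\<close>.  Iterating this,
  \<open>S = \<langle>y\<^sub>1\<rangle> \<dots> \<langle>y\<^sub>N\<rangle> S\<^sup>(\<^sup>n\<^sup>+\<^sup>1\<^sup>)\<close> with \<open>y\<^sub>i\<close> in the term of index \<open>w\<^sub>i\<close>, and the weights satisfy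
  \<open>\<Prod> (1 - z ^ w\<^sub>i) = 1 - |X| z\<close> up to degree \<open>n\<close>.  Taking logarithmic derivatives and inverting,
  exactly \<open>\<phi>\<^sub>s(|X|)\<close> of the weights are equal to \<open>s\<close>.  Since \<open>y\<^sub>i\<close> to the power \<open>p ^ (n + 1 - w\<^sub>i)\<close> lies in
  \<open>S\<^sup>(\<^sup>n\<^sup>+\<^sup>1\<^sup>)\<close>, the index of \<open>S\<^sup>(\<^sup>n\<^sup>+\<^sup>1\<^sup>)\<close> is at most \<open>\<Prod> p ^ (n + 1 - w\<^sub>i)\<close>.

  Equality comes from the Magnus map \<open>x \<mapsto> 1 + x\<close> into the noncommutative power series over the integers
  modulo the \<open>(n + 1)\<close>-st power of the ideal \<open>(p, X)\<close>: the image of \<open>S\<close> spans this finite ring, hence so do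
  the ordered monomials in the \<open>y\<^sub>i - 1\<close>, and by the same product formula there are just enough of them to be
  a basis; so the exponents of the \<open>y\<^sub>i\<close> can be read off.  The dimension of a layer is the difference of two
  consecutive exponents.

  For finite \<open>X\<close>, transgression identifies the characters of \<open>S\<^sup>(\<^sup>n\<^sup>) / S\<^sup>(\<^sup>n\<^sup>+\<^sup>1\<^sup>)\<close> with \<open>H\<^sup>2\<close> of the quotient by
  \<open>S\<^sup>(\<^sup>n\<^sup>)\<close>: it is injective because homomorphisms from \<open>S\<close> to \<open>\<int>/p\<close> vanish on \<open>S\<^sup>(\<^sup>2\<^sup>)\<close>, and surjective because
  \<open>S\<close>, being free, maps to every extension.  For infinite \<open>X\<close> both spaces are infinite, as one sees from
  the homomorphisms to \<open>\<int>/p\<^sup>n\<close> sending one basis element to \<open>1\<close> and the others to \<open>0\<close>.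
\<close>

section \<open>Weights and the necklace map\<close>

text \<open>Elimination bounds the index only from above, since it does not show that the exponents
  of the generators are unique. Uniqueness is a matter of counting: with m = |X| there are m^s words
  of length s, whose coefficients count modulo p^(n+1-s), and equally many monomials of weight s,
  whose coefficients matter modulo the same power, so a spanning family is forced to be a basis. The
  prime belongs to the ideal together with X so that taking the p-th power of 1 + u raises the
  degree, just as a commutator does. A generator of weight w <= n contributes n + 1 - w to the
  exponent of the index of the (n + 1)-st term and one less to that of the n-th, so it counts once
  in the layer; this is why the necklace numbers are summed. On the cohomological side it is enough
  to compare finite orders, as both spaces are vector spaces over the same field. This requires the
  n-th term to be open, which fails for infinite X: the quotient is no longer discrete and a section
  need not be continuous, so that case is settled by exhibiting infinitely many elements.\<close>

definition fps_agree :: "nat \<Rightarrow> int fps \<Rightarrow> int fps \<Rightarrow> bool" where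
  "fps_agree n f g \<longleftrightarrow> (\<forall>i\<le>n. fps_nth f i = fps_nth g i)"

lemma fps_agree_refl [simp]: "fps_agree n f f"
  by (simp add: fps_agree_def)

lemma fps_agree_trans: "fps_agree n f g \<Longrightarrow> fps_agree n g h \<Longrightarrow> fps_agree n f h"
  by (simp add: fps_agree_def)

lemma fps_agree_mult: "fps_agree n f f' \<Longrightarrow> fps_agree n g g' \<Longrightarrow> fps_agree n (f * g) (f' * g')"
  unfolding fps_agree_def fps_mult_nth by (intro allI impI sum.cong refl) simp

definition weight_fps :: "nat list \<Rightarrow> int fps" where
  "weight_fps ws = (\<Prod>w\<leftarrow>ws. 1 - fps_X ^ w)"

lemma weight_fps_Nil [simp]: "weight_fps [] = 1"
  and weight_fps_Cons [simp]: "weight_fps (w # ws) = (1 - fps_X ^ w) * weight_fps ws"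
  by (simp_all add: weight_fps_def)

section \<open>Exponent vectors of ordered monomials, counted by weight\<close>

definition vec_weight :: "nat list \<Rightarrow> nat list \<Rightarrow> nat" where
  "vec_weight ws ks = sum_list (map2 (*) ws ks)"

lemma vec_weight_simps [simp]:
  "vec_weight [] ks = 0" "vec_weight (w # ws) (k # ks) = w * k + vec_weight ws ks"
  by (simp_all add: vec_weight_def)

definition vecs :: "nat list \<Rightarrow> nat \<Rightarrow> nat list set" where
  "vecs ws s = {ks. length ks = length ws \<and> vec_weight ws ks = s}"

lemma vecs_Nil: "vecs [] s = (if s = 0 then {[]} else {})"
  by (auto simp: vecs_def)

lemma vecs_bounded:
  assumes "\<forall>w\<in>set ws. 1 \<le> w" "length ks = length ws"
  shows "set ks \<subseteq> {..vec_weight ws ks}"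
  using assms
proof (induction ws arbitrary: ks)
  case (Cons w ws)
  then obtain k ks' where ks: "ks = k # ks'" "length ks' = length ws"
    by (auto simp: length_Suc_conv)
  have "k \<le> w * k" using Cons.prems by simp
  then have "k \<le> vec_weight (w # ws) ks" unfolding ks(1) vec_weight_simps by linarith
  moreover have "set ks' \<subseteq> {..vec_weight (w # ws) ks}"
    using Cons.IH[of ks'] Cons.prems ks by fastforce
  ultimately show ?case using ks by simp
qed simp

lemma finite_vecs:
  assumes "\<forall>w\<in>set ws. 1 \<le> w" shows "finite (vecs ws s)"
proof (rule finite_subset)
  show "vecs ws s \<subseteq> {ks. set ks \<subseteq> {..s} \<and> length ks = length ws}"
    using vecs_bounded[OF assms] by (auto simp: vecs_def)
qed (simp add: finite_lists_length_eq)

text \<open>Split by whether the first exponent vanishes; if it does not, lowering it by one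
  releases weight \<open>w\<close>. Read on generating series, multiplication by
  \<open>1 - z^w\<close> removes \<open>w\<close> from the list.\<close>

lemma card_vecs_Cons:
  assumes "\<forall>w\<in>set (w # ws). 1 \<le> w"
  shows "card (vecs (w # ws) s) = card (vecs ws s) + (if w \<le> s then card (vecs (w # ws) (s - w)) else 0)"
proof -
  let ?A = "(\<lambda>ks. 0 # ks) ` vecs ws s"
  let ?B = "if w \<le> s then (\<lambda>ks. Suc (hd ks) # tl ks) ` vecs (w # ws) (s - w) else {}"
  have eq: "vecs (w # ws) s = ?A \<union> ?B"
  proof (rule Set.set_eqI, rule iffI)
    fix ks assume "ks \<in> vecs (w # ws) s"
    then obtain k ks' where ks: "ks = k # ks'" "length ks' = length ws" "w * k + vec_weight ws ks' = s"
      by (auto simp: vecs_def length_Suc_conv)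
    show "ks \<in> ?A \<union> ?B"
    proof (cases k)
      case 0
      then show ?thesis using ks by (auto simp: vecs_def)
    next
      case (Suc j)
      then have "w \<le> s" "j # ks' \<in> vecs (w # ws) (s - w)" using ks by (auto simp: vecs_def)
      moreover have "ks = Suc (hd (j # ks')) # tl (j # ks')" using ks Suc by simp
      ultimately show ?thesis by (auto intro!: image_eqI[of _ _ "j # ks'"])
    qed
  next
    fix ks assume "ks \<in> ?A \<union> ?B"
    then show "ks \<in> vecs (w # ws) s"
      by (auto simp: vecs_def length_Suc_conv split: if_splits)
  qed
  have fin: "finite (vecs ws s)" "finite (vecs (w # ws) (s - w))"
    using assms by (simp_all add: finite_vecs del: One_nat_def)
  have inj: "inj_on (\<lambda>ks. Suc (hd ks) # tl ks) (vecs (w # ws) (s - w))"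
    by (rule inj_onI) (auto simp: vecs_def length_Suc_conv)
  have "card ?A = card (vecs ws s)" by (rule card_image) (auto intro: inj_onI)
  moreover have "card ?B = (if w \<le> s then card (vecs (w # ws) (s - w)) else 0)"
    by (simp add: card_image inj)
  moreover have "card (?A \<union> ?B) = card ?A + card ?B"
    by (rule card_Un_disjoint) (use fin in auto)
  ultimately show ?thesis unfolding eq by simp
qed

lemma weight_fps_mult_vecs:
  assumes "\<forall>w\<in>set ws. 1 \<le> w"
  shows "weight_fps ws * Abs_fps (\<lambda>s. int (card (vecs ws s))) = 1"
  using assms
proof (induction ws)
  case Nil
  then show ?case by (auto simp: vecs_Nil fps_eq_iff)
next
  case (Cons w ws)
  have "(1 - fps_X ^ w) * Abs_fps (\<lambda>s. int (card (vecs (w # ws) s))) =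
        Abs_fps (\<lambda>s. int (card (vecs ws s)))"
    using card_vecs_Cons[OF Cons.prems]
    by (auto simp: fps_eq_iff left_diff_distrib fps_X_power_mult_nth)
  then have "weight_fps (w # ws) * Abs_fps (\<lambda>s. int (card (vecs (w # ws) s))) =
      weight_fps ws * Abs_fps (\<lambda>s. int (card (vecs ws s)))"
    by (metis (no_types, lifting) mult.assoc mult.commute weight_fps_Cons)
  then show ?case using Cons by (simp del: weight_fps_Cons)
qed

text \<open>The counting series is inverse to \<^const>\<open>weight_fps\<close>, hence \<open>1 / (1 - m z)\<close> up to degree \<open>n\<close>.\<close>

lemma card_vecs:
  assumes "\<forall>w\<in>set ws. 1 \<le> w" "fps_agree n (weight_fps ws) (1 - fps_const (int m) * fps_X)" "s \<le> n"
  shows "card (vecs ws s) = m ^ s"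
proof -
  let ?N = "Abs_fps (\<lambda>s. int (card (vecs ws s)))"
  have "fps_agree n (weight_fps ws * ?N) ((1 - fps_const (int m) * fps_X) * ?N)"
    by (intro fps_agree_mult assms(2) fps_agree_refl)
  then have eq: "fps_nth ((1 - fps_const (int m) * fps_X) * ?N) i = fps_nth 1 i" if "i \<le> n" for i
    using that unfolding weight_fps_mult_vecs[OF assms(1)] fps_agree_def by simp
  show ?thesis using assms(3)
  proof (induction s)
    case 0
    then show ?case using eq[of 0] by (simp add: left_diff_distrib mult.assoc)
  next
    case (Suc s)
    then have "int (card (vecs ws (Suc s))) = int (m * m ^ s)"
      using eq[of "Suc s"] by (simp add: left_diff_distrib mult.assoc)
    then show ?case by (simp only: of_nat_eq_iff power_Suc)
  qed
qed

text \<open>The coefficient at \<open>z^s\<close> of \<open>-z F'/F\<close> for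
  \<open>F = weight_fps ws\<close>. Position 0 is set by hand, because every \<open>w\<close>
  divides 0 while that series starts in degree 1.\<close>

definition div_weight :: "nat list \<Rightarrow> nat \<Rightarrow> nat" where
  "div_weight ws s = (if s = 0 then 0 else (\<Sum>w\<leftarrow>ws. if w dvd s then w else 0))"

text \<open>Each factor contributes \<open>w z^w / (1 - z^w)\<close>, which is \<open>w\<close>
  times the sum of all positive powers of \<open>z^w\<close>. Multiplying through by
  \<open>weight_fps ws\<close> keeps the equation free of quotients.\<close>

lemma weight_fps_log_deriv:
  assumes "\<forall>w\<in>set ws. 1 \<le> w"
  shows "- (fps_X * fps_deriv (weight_fps ws)) = weight_fps ws * Abs_fps (\<lambda>s. int (div_weight ws s))"
  using assms
proof (induction ws)
  case Nil
  then show ?case by (simp add: div_weight_def fps_eq_iff)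
next
  case (Cons w ws)
  let ?E = "Abs_fps (\<lambda>s. int (if s \<noteq> 0 \<and> w dvd s then w else 0))"
  let ?B = "\<lambda>ws. Abs_fps (\<lambda>s. int (div_weight ws s))"
  have split: "?B (w # ws) = ?E + ?B ws"
    by (simp add: fps_eq_iff div_weight_def)
  have w: "w \<ge> 1" using Cons.prems by simp
  have E: "(1 - fps_X ^ w) * ?E = fps_const (int w) * fps_X ^ w"
  proof (rule fps_ext)
    fix s
    have "w dvd s \<longleftrightarrow> w dvd s - w" if "w \<le> s"
      using that by (simp add: dvd_minus_self)
    then show "fps_nth ((1 - fps_X ^ w) * ?E) s = fps_nth (fps_const (int w) * fps_X ^ w) s"
      using w by (auto simp: left_diff_distrib fps_X_power_mult_nth dest: dvd_imp_le)
  qed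
  have X: "fps_X * fps_deriv (fps_X ^ w :: int fps) = fps_const (int w) * fps_X ^ w"
    using w
  proof (induction w rule: nat_induct_at_least)
    case (Suc w)
    have "fps_X * fps_deriv (fps_X ^ Suc w :: int fps) =
        fps_X ^ Suc w + fps_X * (fps_X * fps_deriv (fps_X ^ w))"
      by (simp add: algebra_simps del: fps_deriv_power)
    then show ?case unfolding Suc by (simp add: algebra_simps flip: fps_const_add)
  qed simp
  have "- (fps_X * fps_deriv (weight_fps (w # ws))) =
      fps_X * fps_deriv (fps_X ^ w) * weight_fps ws
      + (1 - fps_X ^ w) * - (fps_X * fps_deriv (weight_fps ws))"
    by (simp add: algebra_simps)
  also have "\<dots> = (1 - fps_X ^ w) * ?E * weight_fps ws + (1 - fps_X ^ w) * (weight_fps ws * ?B ws)"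
    using Cons by (simp only: X E) simp
  also have "\<dots> = weight_fps (w # ws) * ?B (w # ws)"
    unfolding split by (simp add: algebra_simps)
  finally show ?case .
qed

text \<open>For \<open>1 - m z\<close> the series \<open>-z F'/F\<close> is
  \<open>m z / (1 - m z)\<close>, with coefficients \<open>m^s\<close>. Agreement up to degree
  \<open>n\<close> survives because the factor \<open>z\<close> restores the degree lost by
  differentiating.\<close>

lemma div_weight_eq_power:
  assumes "\<forall>w\<in>set ws. 1 \<le> w" "fps_agree n (weight_fps ws) (1 - fps_const (int m) * fps_X)"
    and "1 \<le> s" "s \<le> n"
  shows "div_weight ws s = m ^ s"
proof -
  let ?B = "Abs_fps (\<lambda>s. int (div_weight ws s))"
  let ?F = "1 - fps_const (int m) * fps_X :: int fps"
  have "fps_agree n (weight_fps ws * ?B) (?F * ?B)"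
    by (intro fps_agree_mult assms(2) fps_agree_refl)
  moreover have "fps_agree n (- (fps_X * fps_deriv (weight_fps ws))) (fps_const (int m) * fps_X)"
    unfolding fps_agree_def
  proof (intro allI impI)
    fix i assume "i \<le> n"
    then show "fps_nth (- (fps_X * fps_deriv (weight_fps ws))) i = fps_nth (fps_const (int m) * fps_X) i"
      using assms(2) by (cases i) (auto simp: fps_agree_def)
  qed
  ultimately have eq: "fps_nth (?F * ?B) i = fps_nth (fps_const (int m) * fps_X) i" if "i \<le> n" for i
    using that weight_fps_log_deriv[OF assms(1)] by (simp add: fps_agree_def)
  show ?thesis using assms(3,4)
  proof (induction s rule: nat_induct_at_least)
    case base
    then show ?case using eq[of 1] by (simp add: left_diff_distrib mult.assoc div_weight_def)
  next
    case (Suc s)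
    then have "int (div_weight ws (Suc s)) = int (m * m ^ s)"
      using eq[of "Suc s"] by (simp add: left_diff_distrib mult.assoc)
    then show ?case by (simp only: of_nat_eq_iff power_Suc)
  qed
qed

lemma div_weight_count:
  assumes "s \<noteq> 0"
  shows "div_weight ws s = (\<Sum>d | d dvd s. d * count_list ws d)"
proof (induction ws)
  case (Cons w ws)
  have "(\<Sum>d | d dvd s. d * count_list (w # ws) d) =
      (\<Sum>d | d dvd s. (if d = w then w else 0) + d * count_list ws d)"
    by (intro sum.cong) auto
  also have "\<dots> = (if w dvd s then w else 0) + div_weight ws s"
    using assms Cons by (simp add: sum.distrib)
  finally show ?case using assms by (simp add: div_weight_def)
qed (use assms in \<open>simp add: div_weight_def\<close>)

section \<open>Moebius inversion over the divisors of a single number\<close>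

lemma moebius_mu_prime_mult:
  assumes "prime q" "\<not> q dvd d" "d \<noteq> 0"
  shows "moebius_mu (q * d) = - moebius_mu d"
proof -
  have cop: "coprime q d" using assms by (simp add: prime_imp_coprime)
  have "prime_factors (q * d) = insert q (prime_factors d)"
    using assms by (auto simp: prime_factors_product prime_prime_factors)
  moreover have "q \<notin> prime_factors d" using assms(2) by auto
  moreover have "squarefree (q * d) \<longleftrightarrow> squarefree d"
    using cop assms(1) squarefree_mult_coprime squarefree_multD(2) squarefree_prime by blast
  ultimately show ?thesis by (simp add: moebius_mu_def)
qed

text \<open>A prime \<open>q\<close> dividing \<open>n\<close> pairs every squarefree divisor
  \<open>d\<close> prime to \<open>q\<close> with \<open>q d\<close>. The two values cancel, and
  divisors that are not squarefree contribute nothing.\<close>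

lemma sum_moebius_mu:
  assumes "n > 0"
  shows "(\<Sum>d | d dvd n. moebius_mu d) = (if n = 1 then 1 else 0)"
proof (cases "n = 1")
  case True
  then show ?thesis by (simp add: moebius_mu_def)
next
  case False
  then obtain q where q: "prime q" "q dvd n" using prime_factor_nat by blast
  let ?sf = "{d. d dvd n \<and> squarefree d}"
  let ?A = "{d \<in> ?sf. \<not> q dvd d}"
  have fin: "finite ?sf" by (rule finite_subset[of _ "{d. d dvd n}"]) (use assms in auto)
  have finA: "finite ?A" by (rule finite_subset[OF _ fin]) auto
  have split: "?sf = ?A \<union> (*) q ` ?A"
  proof (intro equalityI subsetI)
    fix d assume d: "d \<in> ?sf"
    show "d \<in> ?A \<union> (*) q ` ?A"
    proof (cases "q dvd d")
      case True
      then obtain e where e: "d = q * e" by blast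
      have "\<not> q dvd e"
      proof
        assume "q dvd e"
        then have "q ^ 2 dvd d" using e by (simp add: power2_eq_square)
        then show False using d q(1) squarefreeD[of d q] by (auto simp: not_prime_unit)
      qed
      moreover have "squarefree e" using d e squarefree_mono[of e d] by auto
      moreover have "e dvd n" using d e dvd_mult_right by auto
      ultimately show ?thesis using e by blast
    qed (use d in auto)
  next
    fix d assume "d \<in> ?A \<union> (*) q ` ?A"
    moreover have "q * e dvd n" "squarefree (q * e)" if "e \<in> ?A" for e
    proof -
      have "coprime q e" using that q by (simp add: prime_imp_coprime)
      then show "q * e dvd n" "squarefree (q * e)"
        using that q by (auto intro: divides_mult squarefree_mult_coprime squarefree_prime)
    qed
    ultimately show "d \<in> ?sf" by auto
  qed
  have "(\<Sum>d | d dvd n. moebius_mu d) = (\<Sum>d\<in>?sf. moebius_mu d)"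
    by (rule sum.mono_neutral_right) (use assms in \<open>auto simp: moebius_mu_def\<close>)
  also have "\<dots> = (\<Sum>d\<in>?A. moebius_mu d) + (\<Sum>d\<in>(*) q ` ?A. moebius_mu d)"
    using finA by (subst split, intro sum.union_disjoint finite_imageI) auto
  also have "(\<Sum>d\<in>(*) q ` ?A. moebius_mu d) = (\<Sum>d\<in>?A. moebius_mu (q * d))"
    using q(1) by (subst sum.reindex) (auto intro!: inj_onI simp: prime_gt_0_nat)
  also have "\<dots> = (\<Sum>d\<in>?A. - moebius_mu d)"
    using q(1) assms by (intro sum.cong moebius_mu_prime_mult) (auto intro!: Nat.gr0I)
  finally show ?thesis using False by (simp add: sum_negf)
qed

text \<open>The relation is asked for at divisors of \<open>s\<close> alone, since the weight counts
  obey it only up to degree \<open>n\<close>.\<close>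

lemma moebius_inversion:
  fixes b :: "nat \<Rightarrow> int"
  assumes "\<And>t. t dvd s \<Longrightarrow> f t = (\<Sum>d | d dvd t. b d)" "s > 0"
  shows "(\<Sum>d | d dvd s. moebius_mu d * f (s div d)) = b s"
proof -
  have fin: "finite {d. d dvd s}" using assms(2) by simp
  have "(\<Sum>d | d dvd s. moebius_mu d * f (s div d)) =
      (\<Sum>d | d dvd s. \<Sum>e | e dvd s \<and> d * e dvd s. moebius_mu d * b e)"
  proof (rule sum.cong[OF refl])
    fix d assume "d \<in> {d. d dvd s}"
    then obtain c where c: "s = d * c" by blast
    then have "{e. e dvd c} = {e. e dvd s \<and> d * e dvd s}" using assms(2) by auto
    then show "moebius_mu d * f (s div d) = (\<Sum>e | e dvd s \<and> d * e dvd s. moebius_mu d * b e)"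
      using c assms(2) assms(1)[of c] by (simp add: sum_distrib_left)
  qed
  also have "\<dots> = (\<Sum>e | e dvd s. \<Sum>d | d dvd s \<and> d * e dvd s. moebius_mu d * b e)"
    using sum.swap_restrict[OF fin fin, of "\<lambda>d e. moebius_mu d * b e" "\<lambda>d e. d * e dvd s"]
    by simp
  also have "\<dots> = (\<Sum>e | e dvd s. if e = s then b e else 0)"
  proof (rule sum.cong[OF refl])
    fix e assume "e \<in> {e. e dvd s}"
    then obtain c where c: "s = c * e" by (metis dvdE mem_Collect_eq mult.commute)
    then have "{d. d dvd s \<and> d * e dvd s} = {d. d dvd c}" using assms(2) by auto
    then have "(\<Sum>d | d dvd s \<and> d * e dvd s. moebius_mu d * b e) = (if c = 1 then 1 else 0) * b e"
      using c assms(2) sum_moebius_mu[of c] by (simp flip: sum_distrib_right)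
    then show "(\<Sum>d | d dvd s \<and> d * e dvd s. moebius_mu d * b e) = (if e = s then b e else 0)"
      using c assms(2) by auto
  qed
  also have "\<dots> = b s" using fin by simp
  finally show ?thesis .
qed

text \<open>With \<open>c_d\<close> the multiplicity of \<open>d\<close> among the weights, the
  power \<open>m^t\<close> is the sum of \<open>d c_d\<close> over the divisors \<open>d\<close> of
  \<open>t\<close>; inversion isolates \<open>s c_s\<close>.\<close>

lemma count_list_eq_necklace:
  assumes "\<forall>w\<in>set ws. 1 \<le> w" "fps_agree n (weight_fps ws) (1 - fps_const (int m) * fps_X)"
    and "1 \<le> s" "s \<le> n"
  shows "ereal (real (count_list ws s)) = necklace s (enat m)"
proof -
  have "int (m ^ t) = (\<Sum>d | d dvd t. int (d * count_list ws d))" if "t dvd s" for t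
  proof -
    have t: "1 \<le> t" "t \<le> n" using that assms(3,4) by (auto dest: dvd_imp_le intro: Suc_leI dvd_pos_nat)
    have "div_weight ws t = m ^ t" by (rule div_weight_eq_power) (use assms t in auto)
    then have "m ^ t = (\<Sum>d | d dvd t. d * count_list ws d)" using div_weight_count[of t ws] t by simp
    then show ?thesis by (simp only: of_nat_sum)
  qed
  then have "(\<Sum>d | d dvd s. moebius_mu d * int (m ^ (s div d))) = int (s * count_list ws s)"
    using assms(3) by (intro moebius_inversion) auto
  then have "(\<Sum>d | d dvd s. real_of_int (moebius_mu d) * real m ^ (s div d)) = real s * real (count_list ws s)"
    by (metis (no_types, lifting) of_int_mult of_int_of_nat_eq of_int_sum of_nat_mult of_nat_power sum.cong)
  then show ?thesis using assms(3) by simp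
qed

section \<open>Elimination in filtered groups\<close>

fun powprod :: "('a, 'm) monoid_scheme \<Rightarrow> 'a list \<Rightarrow> nat list \<Rightarrow> 'a" where
  "powprod G (y # ys) (a # as) = y [^]\<^bsub>G\<^esub> a \<otimes>\<^bsub>G\<^esub> powprod G ys as"
| "powprod G _ _ = \<one>\<^bsub>G\<^esub>"

lemma (in group) powprod_closed [simp]:
  "set ys \<subseteq> carrier G \<Longrightarrow> powprod G ys as \<in> carrier G"
  by (induction G\<equiv>G ys as rule: powprod.induct) auto

lemma (in group) commutator_closed [simp]:
  "x \<in> carrier G \<Longrightarrow> y \<in> carrier G \<Longrightarrow> commutator G x y \<in> carrier G"
  by (simp add: commutator_def)

lemma (in group) conj_eq_commutator:
  "x \<in> carrier G \<Longrightarrow> y \<in> carrier G \<Longrightarrow> inv y \<otimes> x \<otimes> y = x \<otimes> commutator G x y"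
  by (simp add: commutator_def m_assoc[symmetric])

definition exponents :: "nat \<Rightarrow> nat \<Rightarrow> nat list \<Rightarrow> nat list set" where
  "exponents p n ws = {as. list_all2 (\<lambda>a w. a < p ^ (Suc n - w)) as ws}"

lemma exponents_Nil [simp]: "exponents p n [] = {[]}"
  and exponents_Cons: "exponents p n (w # ws) = {a # as | a as. a < p ^ (Suc n - w) \<and> as \<in> exponents p n ws}"
  by (simp_all add: exponents_def list_all2_Cons2)

definition sum_fps :: "('a \<times> nat) list \<Rightarrow> int fps" where
  "sum_fps Z = (\<Sum>(z, v)\<leftarrow>Z. fps_X ^ v)"

lemma sum_fps_simps [simp]:
  "sum_fps [] = 0" "sum_fps ((z, v) # Z) = fps_X ^ v + sum_fps Z"
  "sum_fps (Z @ Z') = sum_fps Z + sum_fps Z'"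
  by (simp_all add: sum_fps_def)

definition ad :: "('a, 'm) monoid_scheme \<Rightarrow> 'a \<Rightarrow> nat \<Rightarrow> 'a \<Rightarrow> 'a" where
  "ad G y k z = ((\<lambda>c. commutator G c y) ^^ k) z"

text \<open>The generators that replace the others when \<open>y\<close> is eliminated. Stopping at
  \<open>k = n\<close> loses nothing: for positive \<open>w\<close>, later commutators have weight
  beyond \<open>n\<close>.\<close>

definition elim_list :: "('a, 'm) monoid_scheme \<Rightarrow> nat \<Rightarrow> 'a \<Rightarrow> nat \<Rightarrow> ('a \<times> nat) list \<Rightarrow> ('a \<times> nat) list"
  where "elim_list G n y w Z = concat (map (\<lambda>(z, v). map (\<lambda>k. (ad G y k z, v + k * w)) [0..<Suc n]) Z)"

lemma set_elim_list:
  "set (elim_list G n y w Z) = {(ad G y k z, v + k * w) | z v k. (z, v) \<in> set Z \<and> k \<le> n}"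
proof -
  have "set [0..<Suc n] = {..n}" by auto
  then show ?thesis unfolding elim_list_def by (auto simp del: upt_Suc)
qed

text \<open>A truncated geometric series: \<open>z^v\<close> becomes
  \<open>z^v (1 + z^w + ... + z^(n w))\<close>, and the error term \<open>z^(v + w (n + 1))\<close>
  lies beyond degree \<open>n\<close>.\<close>

lemma sum_fps_elim_list:
  assumes "1 \<le> w"
  shows "fps_agree n ((1 - fps_X ^ w) * sum_fps (elim_list G n y w Z)) (sum_fps Z)"
proof (induction Z)
  case (Cons zv Z)
  obtain z v where zv: "zv = (z, v)" by force
  let ?g = "map (\<lambda>k. (ad G y k z, v + k * w)) [0..<Suc n]"
  have "sum_fps ?g = (\<Sum>k<Suc n. fps_X ^ (v + k * w))"
    by (simp add: sum_fps_def o_def atLeast0LessThan interv_sum_list_conv_sum_set_nat)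
  also have "\<dots> = fps_X ^ v * (\<Sum>k<Suc n. (fps_X ^ w) ^ k)"
    by (simp add: sum_distrib_left distrib_left power_add power_mult[symmetric] mult.commute)
  finally have "(1 - fps_X ^ w) * sum_fps ?g = fps_X ^ v * ((1 - fps_X ^ w) * (\<Sum>k<Suc n. (fps_X ^ w) ^ k))"
    by (simp only: mult.left_commute)
  also have "\<dots> = fps_X ^ v - fps_X ^ (v + w * Suc n)"
    by (simp only: one_diff_power_eq[symmetric] right_diff_distrib mult_1_right power_mult power_add)
  finally have g: "(1 - fps_X ^ w) * sum_fps ?g = fps_X ^ v - fps_X ^ (v + w * Suc n)" .
  have "i < v + w * Suc n" if "i \<le> n" for i
  proof -
    have "Suc n \<le> w * Suc n" using mult_le_mono1[OF assms, of "Suc n"] by (simp only: mult_1)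
    also have "\<dots> \<le> v + w * Suc n" by (rule le_add2)
    finally show ?thesis using that by (simp only: less_eq_Suc_le[symmetric] le_less_trans)
  qed
  then have "fps_agree n ((1 - fps_X ^ w) * sum_fps ?g) (fps_X ^ v)"
    unfolding g by (auto simp: fps_agree_def)
  moreover have "elim_list G n y w (zv # Z) = ?g @ elim_list G n y w Z"
    by (simp add: elim_list_def zv)
  ultimately show ?case
    using Cons by (simp add: zv fps_agree_def distrib_left del: upt_Suc)
qed (simp add: elim_list_def)

text \<open>Only entries with \<open>k = 0\<close> can keep the minimal weight \<open>w\<close>. So
  elimination creates no new generators of that weight, and the inner induction in
  \<open>elimination\<close> terminates.\<close>

lemma count_elim_list:
  assumes "1 \<le> w" "\<forall>(z, v)\<in>set Z. w \<le> v"
  shows "length (filter (\<lambda>(z, v). v = w) (elim_list G n y w Z)) = length (filter (\<lambda>(z, v). v = w) Z)"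
  using assms(2)
proof (induction Z)
  case (Cons zv Z)
  obtain z v where zv: "zv = (z, v)" by force
  have v: "w \<le> v" using Cons.prems zv by auto
  have "[0..<Suc n] = 0 # [1..<Suc n]" by (simp add: upt_conv_Cons)
  moreover have "filter (\<lambda>k. v + k * w = w) [1..<Suc n] = []"
  proof -
    have "v + k * w \<noteq> w" if "1 \<le> k" for k
    proof -
      have "w \<le> k * w" using mult_le_mono1[OF that, of w] by (simp only: mult_1)
      then show ?thesis using v assms(1) by linarith
    qed
    then show ?thesis by (auto simp: filter_empty_conv simp del: upt_Suc)
  qed
  ultimately have "length (filter (\<lambda>k. v + k * w = w) [0..<Suc n]) = (if v = w then 1 else 0)"
    by (simp only: filter.simps) (simp del: upt_Suc)
  then show ?case
    using Cons by (auto simp: zv elim_list_def filter_map o_def simp del: upt_Suc)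
qed (simp add: elim_list_def)

text \<open>The algebraic facts about the lower \<open>p\<close>-central series on which elimination
  rests; no topology is involved at this stage.\<close>

locale central_filtration = group G for G (structure) +
  fixes P :: "nat \<Rightarrow> 'a set" and p :: nat
  assumes p_pos: "0 < p"
    and P_subgroup: "subgroup (P k) G"
    and P_antimono: "j \<le> k \<Longrightarrow> P k \<subseteq> P j"
    and P_one: "P 1 = carrier G"
    and P_commutator: "\<lbrakk>1 \<le> a; 1 \<le> b; x \<in> P a; y \<in> P b\<rbrakk> \<Longrightarrow> commutator G x y \<in> P (a + b)"
    and P_power: "\<lbrakk>1 \<le> k; x \<in> P k\<rbrakk> \<Longrightarrow> x [^] p \<in> P (Suc k)"
begin

lemma P_closed: "x \<in> P k \<Longrightarrow> x \<in> carrier G"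
  using P_subgroup subgroup.mem_carrier by metis

lemma P_power_iter: "1 \<le> k \<Longrightarrow> x \<in> P k \<Longrightarrow> x [^] (p ^ e) \<in> P (k + e)"
proof (induction e)
  case (Suc e)
  then have "(x [^] (p ^ e)) [^] p \<in> P (Suc (k + e))" by (intro P_power) auto
  then show ?case using Suc.prems P_closed by (simp add: nat_pow_pow mult.commute)
qed (simp add: P_closed)

lemma P_conj:
  assumes "1 \<le> k" "x \<in> P k" "g \<in> carrier G"
  shows "inv g \<otimes> x \<otimes> g \<in> P k"
proof -
  have "commutator G x g \<in> P (k + 1)"
    using assms P_one by (intro P_commutator) auto
  then have "commutator G x g \<in> P k" using P_antimono[of k "k + 1"] by auto
  then show ?thesis
    using assms P_closed P_subgroup by (simp add: conj_eq_commutator subgroup.m_closed)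
qed

lemma ad_in_P:
  assumes "1 \<le> w" "1 \<le> v" "y \<in> P w" "z \<in> P v"
  shows "ad G y k z \<in> P (v + k * w)"
proof (induction k)
  case (Suc k)
  have "commutator G (ad G y k z) y \<in> P (v + k * w + w)"
    by (rule P_commutator) (use assms Suc in auto)
  then show ?case by (simp add: ad_def add.commute add.left_commute)
qed (simp add: ad_def assms)

text \<open>Conjugation by \<open>y\<close> sends \<open>u\<close> to \<open>u [u, y]\<close>, so it
  maps the subgroup \<open>H\<close> generated by the iterated commutators and
  \<open>P (Suc n)\<close> into itself. Hence the powers of \<open>y\<close> times \<open>H\<close>
  form a group containing all generators, and the finite order of \<open>y\<close> modulo
  \<open>H\<close> bounds the exponent.\<close>

lemma elimination_step:
  assumes w: "1 \<le> w" and y: "y \<in> P w" and Z: "\<forall>(z, v)\<in>set Z. z \<in> P v \<and> 1 \<le> v"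
    and g: "g \<in> generate G (insert y (fst ` set Z) \<union> P (Suc n))"
  shows "\<exists>a<p ^ (Suc n - w). \<exists>h\<in>generate G (fst ` set (elim_list G n y w Z) \<union> P (Suc n)). g = y [^] a \<otimes> h"
proof -
  let ?N = "P (Suc n)"
  let ?q = "p ^ (Suc n - w)"
  define Y where "Y = fst ` set (elim_list G n y w Z) \<union> ?N"
  define H where "H = generate G Y"
  have yG: "y \<in> carrier G" using y P_closed by blast
  have ZG: "z \<in> carrier G" if "(z, v) \<in> set Z" for z v using Z that P_closed by blast
  have adP: "ad G y k z \<in> P (v + k * w)" if "(z, v) \<in> set Z" for k z v
    using ad_in_P w y Z that by blast
  have Yad: "ad G y k z \<in> Y" if "(z, v) \<in> set Z" for k z v
  proof (cases "k \<le> n")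
    case True
    then have "(ad G y k z, v + k * w) \<in> set (elim_list G n y w Z)"
      using that unfolding elim_list_def by (fastforce simp del: upt_Suc)
    then show ?thesis unfolding Y_def by force
  next
    \<comment> \<open>Past \<open>k = n\<close> the commutator already lies in
      \<open>P (Suc n)\<close>, so \<open>Y\<close> contains every iterate of \<open>z\<close>
      although the list is finite.\<close>
    case False
    have "Suc n * 1 \<le> k * w" using False w by (intro mult_mono) auto
    then have "Suc n \<le> v + k * w" by simp
    then show ?thesis using adP[OF that] P_antimono unfolding Y_def by blast
  qed
  have "ad G y k z \<in> carrier G" if "(z, v) \<in> set Z" for k z v using adP[OF that] P_closed by blast
  then have YG: "Y \<subseteq> carrier G"
    unfolding Y_def elim_list_def using P_closed by (auto simp del: upt_Suc)
  have H: "subgroup H G" unfolding H_def using YG by (rule generate_is_subgroup)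
  have NH: "?N \<subseteq> H" unfolding H_def Y_def by (auto intro: generate.incl)
  have HG: "h \<in> carrier G" if "h \<in> H" for h using H that subgroup.mem_carrier by metis
  have Yconj: "inv y \<otimes> u \<otimes> y \<in> H" if u: "u \<in> Y" for u
  proof -
    consider "u \<in> ?N" | z v k where "(z, v) \<in> set Z" "u = ad G y k z"
      using u unfolding Y_def elim_list_def by (auto simp del: upt_Suc)
    then show ?thesis
    proof cases
      case 1
      then show ?thesis using P_conj[of "Suc n"] yG NH by auto
    next
      case 2
      then have "u \<in> H" "ad G y (Suc k) z \<in> H"
        using Yad unfolding H_def by (auto intro: generate.incl)
      moreover have "ad G y (Suc k) z = commutator G u y" by (simp add: ad_def 2)
      ultimately show ?thesis
        using yG HG H by (simp add: conj_eq_commutator subgroup.m_closed)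
    qed
  qed
  have conj1: "inv y \<otimes> h \<otimes> y \<in> H" if "h \<in> H" for h
    using that unfolding H_def
  proof (induction h rule: generate.induct)
    case one
    then show ?case using yG by (simp add: generate.one)
  next
    case (incl h)
    then show ?case using Yconj H_def by simp
  next
    case (inv h)
    then have "h \<in> carrier G" using YG by auto
    moreover have "inv (inv y \<otimes> h \<otimes> y) \<in> H" using Yconj[OF inv] H subgroup.m_inv_closed by metis
    ultimately show ?case using yG by (simp add: inv_mult_group m_assoc H_def)
  next
    case (eng a b)
    have ab: "a \<in> carrier G" "b \<in> carrier G"
      using eng(1,2) HG H_def by auto
    have "(inv y \<otimes> a \<otimes> y) \<otimes> (inv y \<otimes> b \<otimes> y) = inv y \<otimes> (a \<otimes> b) \<otimes> y"
      using ab yG by (simp add: m_assoc[symmetric]) (simp add: m_assoc)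
    then show ?case using eng(3,4) H H_def subgroup.m_closed by metis
  qed
  have conj: "inv (y [^] b) \<otimes> h \<otimes> y [^] b \<in> H" if "h \<in> H" for h and b :: nat
  proof (induction b)
    case (Suc b)
    have "inv (y [^] Suc b) \<otimes> h \<otimes> y [^] Suc b = inv y \<otimes> (inv (y [^] b) \<otimes> h \<otimes> y [^] b) \<otimes> y"
      using yG HG[OF that] by (simp add: inv_mult_group m_assoc)
    then show ?case using conj1[OF Suc] by simp
  qed (simp add: that HG)
  have yq: "y [^] (?q * c) \<in> H" for c :: nat
  proof -
    have "y [^] ?q \<in> P (w + (Suc n - w))" using w y by (rule P_power_iter)
    moreover have "Suc n \<le> w + (Suc n - w)" by arith
    ultimately have "y [^] ?q \<in> H" using P_antimono NH by blast
    then have "(y [^] ?q) [^] c \<in> H" using H by (induction c) (auto simp: subgroup.one_closed subgroup.m_closed)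
    then show ?thesis using yG by (simp add: nat_pow_pow)
  qed
  define B where "B = {y [^] a \<otimes> h | (a::nat) h. h \<in> H}"
  have "subgroup B G"
  proof (rule subgroupI)
    show "B \<subseteq> carrier G" unfolding B_def using yG HG by auto
    show "B \<noteq> {}" unfolding B_def using NH P_subgroup[of "Suc n"] subgroup.one_closed by blast
  next
    fix u assume "u \<in> B"
    then obtain a h where u: "u = y [^] (a::nat) \<otimes> h" "h \<in> H" unfolding B_def by blast
    \<comment> \<open>\<open>y\<close> has finite order modulo \<open>H\<close>, so \<open>y\<^sup>-\<^sup>a\<close> is a natural power of \<open>y\<close> up to \<open>H\<close>.\<close>
    define b where "b = ?q * (a + 1) - a"
    have q: "?q \<ge> 1" using p_pos by (simp add: Suc_leI)
    have "a \<le> ?q * (a + 1)" using mult_right_mono[OF q, of "a + 1"] by auto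
    then have ab: "a + b = ?q * (a + 1)" unfolding b_def by simp
    have yab: "y [^] a \<otimes> y [^] b = y [^] (?q * (a + 1))" unfolding ab[symmetric] using yG by (simp add: nat_pow_mult)
    have hG: "h \<in> carrier G" using u HG by blast
    let ?h' = "inv (y [^] b) \<otimes> inv h \<otimes> y [^] b"
    have "inv u = y [^] b \<otimes> (?h' \<otimes> inv (y [^] (?q * (a + 1))))"
      unfolding u(1) yab[symmetric] using yG hG
      by (simp add: inv_mult_group m_assoc) (simp add: m_assoc[symmetric])
    moreover have "?h' \<otimes> inv (y [^] (?q * (a + 1))) \<in> H"
      using conj[of "inv h" b] yq[of "a + 1"] u H by (simp add: subgroup.m_closed subgroup.m_inv_closed)
    ultimately show "inv u \<in> B" unfolding B_def by blast
  next
    fix u v assume "u \<in> B" "v \<in> B"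
    then obtain a h b k where uv: "u = y [^] (a::nat) \<otimes> h" "h \<in> H" "v = y [^] (b::nat) \<otimes> k" "k \<in> H"
      unfolding B_def by blast
    have hk: "h \<in> carrier G" "k \<in> carrier G" using uv HG by auto
    have "u \<otimes> v = y [^] (a + b) \<otimes> ((inv (y [^] b) \<otimes> h \<otimes> y [^] b) \<otimes> k)"
      unfolding uv using yG hk
      by (simp add: m_assoc nat_pow_mult[symmetric]) (simp add: m_assoc[symmetric])
    moreover have "(inv (y [^] b) \<otimes> h \<otimes> y [^] b) \<otimes> k \<in> H"
      using conj uv H by (simp add: subgroup.m_closed)
    ultimately show "u \<otimes> v \<in> B" unfolding B_def by blast
  qed
  moreover have "insert y (fst ` set Z) \<union> ?N \<subseteq> B"
  proof -
    have "h \<in> B" if "h \<in> H" for h unfolding B_def using that HG by (force intro: exI[of _ 0])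
    moreover have "fst ` set Z \<subseteq> H"
      using Yad[of _ _ 0] unfolding H_def ad_def by (auto intro: generate.incl)
    moreover have "y \<in> B" unfolding B_def using yG H subgroup.one_closed by (force intro: exI[of _ 1])
    ultimately show ?thesis using NH by blast
  qed
  ultimately have "g \<in> B" using g generate_subgroup_incl by blast
  then obtain a h where g': "g = y [^] (a::nat) \<otimes> h" "h \<in> H" unfolding B_def by blast
  have "y [^] a = y [^] (a mod ?q) \<otimes> y [^] (?q * (a div ?q))"
    using yG by (simp add: nat_pow_mult)
  then have "g = y [^] (a mod ?q) \<otimes> (y [^] (?q * (a div ?q)) \<otimes> h)"
    using g' yG HG by (simp add: m_assoc)
  moreover have "y [^] (?q * (a div ?q)) \<otimes> h \<in> H" using yq g' H by (simp add: subgroup.m_closed)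
  moreover have "a mod ?q < ?q" using p_pos by simp
  ultimately show ?thesis unfolding H_def Y_def by blast
qed

text \<open>
  Eliminating \<open>y\<close> of weight \<open>w\<close> from the generators turns their weight series \<open>Z\<close> into
  \<open>(Z - z\<^sup>w) / (1 - z\<^sup>w)\<close>, that is, divides \<open>1 - Z\<close> by \<open>1 - z\<^sup>w\<close>.  Choosing \<open>w\<close> minimal, the process
  stops once all weights exceed \<open>n\<close>.
\<close>

lemma elimination:
  assumes "\<forall>(z, v)\<in>set Z. z \<in> P v \<and> 1 \<le> v"
  shows "\<exists>ys ws. list_all2 (\<lambda>y w. y \<in> P w) ys ws \<and> (\<forall>w\<in>set ws. 1 \<le> w \<and> w \<le> n) \<and>
    fps_agree n (weight_fps ws) (1 - sum_fps Z) \<and>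
    (\<forall>g\<in>generate G (fst ` set Z \<union> P (Suc n)).
      \<exists>as\<in>exponents p n ws. \<exists>\<nu>\<in>P (Suc n). g = powprod G ys as \<otimes> \<nu>)" (is "?concl Z")
proof -
  let ?N = "P (Suc n)"
  \<comment> \<open>Downward induction on a lower bound \<open>j\<close> for the weights. It starts
    at \<open>Suc n\<close>, where all generators lie in \<open>P (Suc n)\<close>; an inner
    induction counts the generators of weight exactly \<open>j\<close>.\<close>
  have "\<forall>Z. (\<forall>(z, v)\<in>set Z. z \<in> P v \<and> 1 \<le> v) \<longrightarrow> (\<forall>(z, v)\<in>set Z. j \<le> v) \<longrightarrow> ?concl Z"
    if "1 \<le> j" "j \<le> Suc n" for j
    using that(2,1)
  proof (induction rule: inc_induct)
    case base
    show ?case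
    proof (intro allI impI)
      fix Z :: "('a \<times> nat) list"
      assume Z: "\<forall>(z, v)\<in>set Z. z \<in> P v \<and> 1 \<le> v" "\<forall>(z, v)\<in>set Z. Suc n \<le> v"
      then have "fst ` set Z \<union> ?N \<subseteq> ?N" using P_antimono by fastforce
      then have "generate G (fst ` set Z \<union> ?N) \<subseteq> ?N"
        using P_subgroup by (rule generate_subgroup_incl)
      then have "\<forall>g\<in>generate G (fst ` set Z \<union> ?N). g \<in> ?N \<and> g = \<one> \<otimes> g"
        using P_closed by auto
      moreover have "fps_agree n (sum_fps Z) 0"
        using Z(2) by (induction Z) (auto simp: fps_agree_def)
      ultimately show "?concl Z"
        by (intro exI[of _ "[]"]) (auto simp: box_def fps_agree_def)
    qed
  next
    case (step j)
    have "?concl Z" if "\<forall>(z, v)\<in>set Z. z \<in> P v \<and> 1 \<le> v" "\<forall>(z, v)\<in>set Z. j \<le> v"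
      "length (filter (\<lambda>(z, v). v = j) Z) = c" for Z c
      using that
    proof (induction c arbitrary: Z)
      case 0
      \<comment> \<open>Nothing of weight \<open>j\<close> remains, so the lower bound rises and the
        outer hypothesis applies.\<close>
      then have "\<forall>(z, v)\<in>set Z. Suc j \<le> v" by (fastforce simp: filter_empty_conv)
      show ?case by (rule step.IH[rule_format]) (use 0 \<open>\<forall>(z, v)\<in>set Z. Suc j \<le> v\<close> in auto)
    next
      case (Suc c)
      then have "filter (\<lambda>(z, v). v = j) Z \<noteq> []" by auto
      then obtain y where "(y, j) \<in> set Z" by (auto simp: filter_empty_conv)
      then obtain Z1 Z2 where Z: "Z = Z1 @ (y, j) # Z2" by (meson split_list)
      let ?Z = "Z1 @ Z2"
      let ?E = "elim_list G n y j ?Z"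
      have y: "y \<in> P j" "1 \<le> j" using Suc.prems(1) Z by auto
      have Z': "\<forall>(z, v)\<in>set ?Z. z \<in> P v \<and> 1 \<le> v" "\<forall>(z, v)\<in>set ?Z. j \<le> v"
        using Suc.prems(1,2) Z by auto
      have E1: "\<forall>(z, v)\<in>set ?E. z \<in> P v \<and> 1 \<le> v"
      proof -
        have "ad G y k z \<in> P (v + k * j) \<and> 1 \<le> v + k * j" if "(z, v) \<in> set ?Z" for z v k
          using ad_in_P[OF y(2) _ y(1), of v z k] Z'(1) that by fastforce
        then show ?thesis unfolding set_elim_list by blast
      qed
      have E2: "\<forall>(z, v)\<in>set ?E. j \<le> v"
        using Z'(2) unfolding set_elim_list by (auto intro: trans_le_add1)
      have "length (filter (\<lambda>(z, v). v = j) ?E) = c"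
        unfolding count_elim_list[OF y(2) Z'(2)] using Suc.prems(3) Z by simp
      then obtain ys ws where IH: "list_all2 (\<lambda>y w. y \<in> P w) ys ws" "\<forall>w\<in>set ws. 1 \<le> w \<and> w \<le> n"
        "fps_agree n (weight_fps ws) (1 - sum_fps ?E)"
        "\<And>g. g \<in> generate G (fst ` set ?E \<union> ?N) \<Longrightarrow>
          \<exists>as\<in>exponents p n ws. \<exists>\<nu>\<in>?N. g = powprod G ys as \<otimes> \<nu>"
        using Suc.IH[OF E1 E2] by blast
      have "fps_agree n (weight_fps (j # ws)) (1 - sum_fps Z)"
      proof -
        have "fps_agree n (weight_fps (j # ws)) ((1 - fps_X ^ j) * (1 - sum_fps ?E))"
          using IH(3) by (auto intro: fps_agree_mult)
        moreover have "fps_agree n ((1 - fps_X ^ j) * (1 - sum_fps ?E)) (1 - fps_X ^ j - sum_fps ?Z)"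
          using sum_fps_elim_list[OF y(2), of n G y ?Z]
          by (simp add: fps_agree_def right_diff_distrib)
        moreover have "1 - fps_X ^ j - sum_fps ?Z = 1 - sum_fps Z"
          unfolding Z by (simp add: algebra_simps)
        ultimately show ?thesis using fps_agree_trans by metis
      qed
      moreover have "list_all2 (\<lambda>y w. y \<in> P w) (y # ys) (j # ws)" using IH(1) y by simp
      moreover have "\<forall>w\<in>set (j # ws). 1 \<le> w \<and> w \<le> n" using IH(2) y step.hyps by auto
      moreover have "\<exists>as\<in>exponents p n (j # ws). \<exists>\<nu>\<in>?N. g = powprod G (y # ys) as \<otimes> \<nu>"
        if "g \<in> generate G (fst ` set Z \<union> ?N)" for g
      proof -
        have "fst ` set Z \<union> ?N = insert y (fst ` set ?Z) \<union> ?N" unfolding Z by auto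
        then obtain a h where a: "a < p ^ (Suc n - j)" "h \<in> generate G (fst ` set ?E \<union> ?N)" "g = y [^] a \<otimes> h"
          using elimination_step[OF y(2,1) Z'(1)] \<open>g \<in> _\<close> by metis
        then obtain as \<nu> where as: "as \<in> exponents p n ws" "\<nu> \<in> ?N" "h = powprod G ys as \<otimes> \<nu>"
          using IH(4) by blast
        have "set ys \<subseteq> carrier G" using IH(1)
          by (induction rule: list_all2_induct) (auto intro: P_closed)
        then have "g = powprod G (y # ys) (a # as) \<otimes> \<nu>"
          using a as y(1) P_closed by (simp add: m_assoc)
        moreover have "a # as \<in> exponents p n (j # ws)" using a as by (simp add: exponents_def)
        ultimately show ?thesis using as(2) by blast
      qed
      ultimately show ?case by blast
    qed
    then show ?case by blast
  qed
  from this[of 1] assms show ?thesis by auto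
qed

end

section \<open>The Magnus ring\<close>

text \<open>A separate type, so that the ring instance can multiply by convolution. Series run over
  all letters of the type; the basis \<open>X\<close> enters only through the filtration.\<close>

typedef 'a ncps = "UNIV :: ('a list \<Rightarrow> int) set"
  morphisms ncoeff Abs_ncps by simp

setup_lifting type_definition_ncps

lemma ncps_eqI: "(\<And>w. ncoeff f w = ncoeff g w) \<Longrightarrow> f = g"
  by (simp add: ncoeff_inject[symmetric] ext)

text \<open>The Cauchy product: the sum of \<open>f u * g v\<close> over all factorizations
  \<open>w = u v\<close>, organized by whether \<open>u\<close> is empty or takes the first
  letter.\<close>

fun conv :: "('a list \<Rightarrow> int) \<Rightarrow> ('a list \<Rightarrow> int) \<Rightarrow> 'a list \<Rightarrow> int" where
  "conv f g [] = f [] * g []"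
| "conv f g (x # w) = f [] * g (x # w) + conv (\<lambda>v. f (x # v)) g w"

lemma conv_add_left: "conv (\<lambda>v. f v + f' v) g w = conv f g w + conv f' g w"
  by (induction w arbitrary: f f') (simp_all add: algebra_simps)

lemma conv_add_right: "conv f (\<lambda>v. g v + g' v) w = conv f g w + conv f g' w"
  by (induction w arbitrary: f) (simp_all add: algebra_simps)

lemma conv_scale_left: "conv (\<lambda>v. c * f v) g w = c * conv f g w"
  by (induction w arbitrary: f) (simp_all add: algebra_simps)

lemma conv_zero_left: "conv (\<lambda>v. 0) g w = 0"
  by (induction w) simp_all

lemma conv_assoc: "conv (conv f g) h w = conv f (conv g h) w"
  by (induction w arbitrary: f) (simp_all add: conv_add_left conv_scale_left algebra_simps)

lemma conv_one_left: "conv (\<lambda>v. if v = [] then 1 else 0) g w = g w"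
  by (cases w) (simp_all add: conv_zero_left)

lemma conv_one_right: "conv f (\<lambda>v. if v = [] then 1 else 0) w = f w"
  by (induction w arbitrary: f) simp_all

instantiation ncps :: (type) ring_1
begin
lift_definition zero_ncps :: "'a ncps" is "\<lambda>w. 0" .
lift_definition one_ncps :: "'a ncps" is "\<lambda>w. if w = [] then 1 else 0" .
lift_definition plus_ncps :: "'a ncps \<Rightarrow> 'a ncps \<Rightarrow> 'a ncps" is "\<lambda>f g w. f w + g w" .
lift_definition minus_ncps :: "'a ncps \<Rightarrow> 'a ncps \<Rightarrow> 'a ncps" is "\<lambda>f g w. f w - g w" .
lift_definition uminus_ncps :: "'a ncps \<Rightarrow> 'a ncps" is "\<lambda>f w. - f w" .
lift_definition times_ncps :: "'a ncps \<Rightarrow> 'a ncps \<Rightarrow> 'a ncps" is conv .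
instance
  by standard
    (transfer; auto simp: fun_eq_iff conv_assoc conv_one_left conv_one_right conv_add_left conv_add_right)+
end

lemma ncoeff_simps [simp]:
  "ncoeff 0 w = 0" "ncoeff 1 w = (if w = [] then 1 else 0)"
  "ncoeff (f + g) w = ncoeff f w + ncoeff g w" "ncoeff (f - g) w = ncoeff f w - ncoeff g w"
  "ncoeff (- f) w = - ncoeff f w"
  by (transfer; simp)+

lemma ncoeff_mult: "ncoeff (f * g) = conv (ncoeff f) (ncoeff g)"
  by (transfer; simp)

lemma ncoeff_sum [simp]: "ncoeff (sum f A) w = (\<Sum>a\<in>A. ncoeff (f a) w)"
  by (induction A rule: infinite_finite_induct) simp_all

lemma ncoeff_of_nat_mult [simp]: "ncoeff (of_nat k * f) w = int k * ncoeff f w"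
  by (induction k) (simp_all add: algebra_simps)

lemma ncoeff_of_int_mult [simp]: "ncoeff (of_int k * f) w = k * ncoeff f w"
proof (cases "0 \<le> k")
  case True
  then show ?thesis using ncoeff_of_nat_mult[of "nat k" f w] by simp
next
  case False
  then have "of_int k = - (of_nat (nat (- k)) :: 'a ncps)" by simp
  then show ?thesis using False by (simp only: mult_minus_left ncoeff_simps ncoeff_of_nat_mult) simp
qed

lift_definition nc_word :: "'a list \<Rightarrow> 'a ncps" is "\<lambda>w v. if v = w then 1 else 0" .

lemma ncoeff_nc_word [simp]: "ncoeff (nc_word w) v = (if v = w then 1 else 0)"
  by transfer simp

lemma nc_word_Nil [simp]: "nc_word [] = 1"
  by (rule ncps_eqI) simp

lemma nc_word_Cons: "nc_word (x # w) = nc_word [x] * nc_word w"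
proof (rule ncps_eqI)
  fix v :: "'a list"
  show "ncoeff (nc_word (x # w)) v = ncoeff (nc_word [x] * nc_word w) v"
  proof (cases v)
    case (Cons y v)
    have "conv (\<lambda>v. if y = x \<and> v = [] then 1 else 0) g v = (if y = x then g v else 0)" for g
      by (cases "y = x") (simp_all add: conv_zero_left conv_one_left)
    then show ?thesis using Cons by (simp add: ncoeff_mult)
  qed (simp add: ncoeff_mult)
qed

text \<open>The \<open>k\<close>-th power of the ideal generated by \<open>p\<close> and \<open>X\<close> (words outside \<open>X\<close> are disregarded).\<close>

definition nc_filt :: "nat \<Rightarrow> 'a set \<Rightarrow> nat \<Rightarrow> 'a ncps set" where
  "nc_filt p X k = {f. \<forall>w\<in>lists X. int p ^ (k - length w) dvd ncoeff f w}"

lemma nc_filt_0 [simp]: "nc_filt p X 0 = UNIV"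
  by (simp add: nc_filt_def)

lemma nc_filt_closed [intro]:
  "0 \<in> nc_filt p X k"
  "f \<in> nc_filt p X k \<Longrightarrow> g \<in> nc_filt p X k \<Longrightarrow> f + g \<in> nc_filt p X k"
  "f \<in> nc_filt p X k \<Longrightarrow> g \<in> nc_filt p X k \<Longrightarrow> f - g \<in> nc_filt p X k"
  "f \<in> nc_filt p X k \<Longrightarrow> - f \<in> nc_filt p X k"
  by (simp_all add: nc_filt_def)

lemma nc_filt_sum: "(\<And>a. a \<in> A \<Longrightarrow> f a \<in> nc_filt p X k) \<Longrightarrow> sum f A \<in> nc_filt p X k"
  by (induction A rule: infinite_finite_induct) auto

lemma nc_filt_antimono: "j \<le> k \<Longrightarrow> nc_filt p X k \<subseteq> nc_filt p X j"
  unfolding nc_filt_def by (blast intro: dvd_trans le_imp_power_dvd diff_le_mono)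

text \<open>When \<open>w = u v\<close>, the exponents \<open>a - |u|\<close> and
  \<open>b - |v|\<close> add up to at least \<open>a + b - |w|\<close>, even with truncated
  subtraction. In the induction \<open>a\<close> varies, because shifting \<open>f\<close> by a
  letter lowers its degree by one.\<close>

lemma nc_filt_mult:
  assumes "f \<in> nc_filt p X a" "g \<in> nc_filt p X b"
  shows "f * g \<in> nc_filt p X (a + b)"
proof -
  have "int p ^ (a + b - length w) dvd conv f g w"
    if "w \<in> lists X" "\<forall>v\<in>lists X. int p ^ (a - length v) dvd f v"
      "\<forall>v\<in>lists X. int p ^ (b - length v) dvd g v" for f g w
    using that
  proof (induction w arbitrary: f a rule: list.induct)
    case Nil
    then have "int p ^ (a - length ([] :: 'a list)) dvd f []" "int p ^ (b - length ([] :: 'a list)) dvd g []"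
      by blast+
    then have "int p ^ a * int p ^ b dvd f [] * g []" by (intro mult_dvd_mono) simp_all
    then show ?case by (simp add: power_add)
  next
    case (Cons x w)
    have "int p ^ (a + b - length (x # w)) dvd int p ^ a * int p ^ (b - length (x # w))"
      unfolding power_add[symmetric] by (rule le_imp_power_dvd) simp
    also have "\<dots> dvd f [] * g (x # w)"
    proof (rule mult_dvd_mono)
      have "int p ^ (a - length ([] :: 'a list)) dvd f []" using Cons.prems by blast
      then show "int p ^ a dvd f []" by simp
      show "int p ^ (b - length (x # w)) dvd g (x # w)" by (rule Cons.prems(3)[rule_format, OF Cons.prems(1)])
    qed
    finally have 1: "int p ^ (a + b - length (x # w)) dvd f [] * g (x # w)" .
    have "int p ^ (a + b - length (x # w)) dvd int p ^ (a - 1 + b - length w)"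
      by (rule le_imp_power_dvd) simp
    also have "\<dots> dvd conv (\<lambda>v. f (x # v)) g w"
    proof (rule Cons.IH)
      show "\<forall>v\<in>lists X. int p ^ (a - 1 - length v) dvd f (x # v)"
      proof
        fix v assume "v \<in> lists X"
        then have "int p ^ (a - length (x # v)) dvd f (x # v)"
          using Cons.prems by (intro Cons.prems(2)[rule_format]) auto
        then show "int p ^ (a - 1 - length v) dvd f (x # v)" by simp
      qed
    qed (use Cons.prems in auto)
    finally show ?case using 1 by simp
  qed
  then show ?thesis using assms by (simp add: nc_filt_def ncoeff_mult)
qed

lemma nc_filt_mult_left: "f \<in> nc_filt p X a \<Longrightarrow> g * f \<in> nc_filt p X a"
  using nc_filt_mult[of g p X 0 f a] by simp

lemma nc_filt_mult_right: "f \<in> nc_filt p X a \<Longrightarrow> f * g \<in> nc_filt p X a"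
  using nc_filt_mult[of f p X a g 0] by simp

lemma nc_filt_of_nat: "of_nat p ^ k \<in> nc_filt p X k"
proof (induction k)
  case (Suc k)
  have "of_nat p \<in> nc_filt p X 1"
  proof -
    have "ncoeff (of_nat p :: 'a ncps) w = int p * (if w = [] then 1 else 0)" for w
      using ncoeff_of_nat_mult[of p 1 w] by simp
    then show ?thesis by (auto simp: nc_filt_def)
  qed
  then have "of_nat p * of_nat p ^ k \<in> nc_filt p X (1 + k)" using Suc by (rule nc_filt_mult)
  then show ?case by simp
qed simp

lemma nc_filt_power: "f \<in> nc_filt p X a \<Longrightarrow> f ^ k \<in> nc_filt p X (k * a)"
  by (induction k) (simp_all add: nc_filt_mult)

lemma nc_word_in_filt: "nc_word w \<in> nc_filt p X (length w)"
  by (simp add: nc_filt_def)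

text \<open>Canonical representatives modulo \<open>nc_filt p X k\<close>, so the quotient ring can
  live inside the same type. Words of length at least \<open>k\<close> are reduced modulo 1 and get
  coefficient 0, like the words outside \<open>X\<close>.\<close>

definition nc_red :: "nat \<Rightarrow> 'a set \<Rightarrow> nat \<Rightarrow> 'a ncps \<Rightarrow> 'a ncps" where
  "nc_red p X k f = Abs_ncps (\<lambda>w. if w \<in> lists X then ncoeff f w mod int p ^ (k - length w) else 0)"

lemma ncoeff_nc_red:
  "ncoeff (nc_red p X k f) w = (if w \<in> lists X then ncoeff f w mod int p ^ (k - length w) else 0)"
  by (simp add: nc_red_def Abs_ncps_inverse)

lemma nc_red_eq_iff: "nc_red p X k f = nc_red p X k g \<longleftrightarrow> f - g \<in> nc_filt p X k"
proof
  assume eq: "nc_red p X k f = nc_red p X k g"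
  have "ncoeff f w mod int p ^ (k - length w) = ncoeff g w mod int p ^ (k - length w)" if "w \<in> lists X" for w
    using arg_cong[OF eq, of "\<lambda>h. ncoeff h w"] that unfolding ncoeff_nc_red by simp
  then show "f - g \<in> nc_filt p X k" by (auto simp: nc_filt_def mod_eq_dvd_iff)
next
  assume "f - g \<in> nc_filt p X k"
  then show "nc_red p X k f = nc_red p X k g"
    by (intro ncps_eqI) (auto simp: ncoeff_nc_red nc_filt_def mod_eq_dvd_iff)
qed

lemma nc_red_diff: "nc_red p X k f - f \<in> nc_filt p X k"
  by (auto simp: nc_filt_def ncoeff_nc_red simp flip: mod_eq_dvd_iff)

lemma nc_red_red [simp]: "nc_red p X k (nc_red p X k f) = nc_red p X k f"
  using nc_red_diff by (simp add: nc_red_eq_iff)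

lemma nc_red_mult_left [simp]: "nc_red p X k (nc_red p X k f * g) = nc_red p X k (f * g)"
  using nc_filt_mult_right[OF nc_red_diff, of p X k f g] by (simp add: nc_red_eq_iff left_diff_distrib)

lemma nc_red_mult_right [simp]: "nc_red p X k (f * nc_red p X k g) = nc_red p X k (f * g)"
  using nc_filt_mult_left[OF nc_red_diff, of f p X k g] by (simp add: nc_red_eq_iff right_diff_distrib)

lemma nc_red_one_plus: "f - 1 \<in> nc_filt p X j \<Longrightarrow> j \<le> k \<Longrightarrow> nc_red p X k f - 1 \<in> nc_filt p X j"
  using nc_filt_closed(2)[OF _ nc_filt_antimono[THEN subsetD, OF _ nc_red_diff[of p X k f]], of "f - 1" j]
  by simp

definition words :: "'a set \<Rightarrow> nat \<Rightarrow> 'a list set" where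
  "words X n = {w \<in> lists X. length w \<le> n}"

lemma finite_words: "finite X \<Longrightarrow> finite (words X n)"
  using finite_lists_length_le[of X n] by (simp add: words_def lists_eq_set conj_commute)

lemma bij_betw_range_nc_red:
  assumes "0 < p"
  shows "bij_betw (\<lambda>f. restrict (ncoeff f) (words X n)) (range (nc_red p X (Suc n)))
    (\<Pi>\<^sub>E w\<in>words X n. {0..<int p ^ (Suc n - length w)})"
proof (rule bij_betwI')
  fix f g :: "'a ncps" assume "f \<in> range (nc_red p X (Suc n))" "g \<in> range (nc_red p X (Suc n))"
  then obtain f' g' where fg: "f = nc_red p X (Suc n) f'" "g = nc_red p X (Suc n) g'" by blast
  show "restrict (ncoeff f) (words X n) = restrict (ncoeff g) (words X n) \<longleftrightarrow> f = g"
  proof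
    assume eq: "restrict (ncoeff f) (words X n) = restrict (ncoeff g) (words X n)"
    show "f = g"
    proof (rule ncps_eqI)
      fix w show "ncoeff f w = ncoeff g w"
      proof (cases "w \<in> words X n")
        case True
        then show ?thesis using fun_cong[OF eq, of w] by simp
      qed (auto simp: fg ncoeff_nc_red words_def)
    qed
  qed simp
next
  fix f :: "'a ncps" assume "f \<in> range (nc_red p X (Suc n))"
  then show "restrict (ncoeff f) (words X n) \<in> (\<Pi>\<^sub>E w\<in>words X n. {0..<int p ^ (Suc n - length w)})"
    using assms by (auto simp: words_def ncoeff_nc_red)
next
  fix c assume c: "c \<in> (\<Pi>\<^sub>E w\<in>words X n. {0..<int p ^ (Suc n - length w)})"
  let ?f = "nc_red p X (Suc n) (Abs_ncps c)"
  have "c = restrict (ncoeff ?f) (words X n)"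
  proof
    fix w show "c w = restrict (ncoeff ?f) (words X n) w"
    proof (cases "w \<in> words X n")
      case True
      then have "c w \<in> {0..<int p ^ (Suc n - length w)}" using c by blast
      then show ?thesis using True by (auto simp: words_def ncoeff_nc_red Abs_ncps_inverse)
    qed (simp add: PiE_arb[OF c])
  qed
  then show "\<exists>f\<in>range (nc_red p X (Suc n)). c = restrict (ncoeff f) (words X n)"
    by (rule bexI) (rule rangeI)
qed

section \<open>The lower p-central filtration of a profinite group\<close>

context profinite_group
begin

lemma continuous_map_mult:
  assumes "continuous_map U T f" "continuous_map U T g"
  shows "continuous_map U T (\<lambda>x. f x \<otimes> g x)"
  using continuous_map_compose[OF continuous_map_pairedI[OF assms] continuous_mult] by (simp add: o_def)

lemma continuous_map_inverse:
  "continuous_map U T f \<Longrightarrow> continuous_map U T (\<lambda>x. inv f x)"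
  using continuous_map_compose[OF _ continuous_inv] by (fastforce simp: o_def)

lemma continuous_map_constant: "g \<in> carrier G \<Longrightarrow> continuous_map U T (\<lambda>x. g)"
  by (simp add: topspace_eq)

lemma continuous_map_ident: "continuous_map T T (\<lambda>x. x)"
  by simp

lemma continuous_map_commutator:
  "g \<in> carrier G \<Longrightarrow> continuous_map T T (\<lambda>x. commutator G g x)"
  unfolding commutator_def
  by (intro continuous_map_mult continuous_map_inverse continuous_map_constant continuous_map_ident) auto

lemma closedin_preimage:
  "continuous_map T T f \<Longrightarrow> closedin T C \<Longrightarrow> closedin T {x \<in> carrier G. f x \<in> C}"
  using closedin_continuous_map_preimage[of T T f C] by (simp add: topspace_eq)

lemma closed_generate_subgroup:
  assumes "A \<subseteq> carrier G" shows "subgroup (closed_generate G T A) G"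
proof -
  let ?H = "generate G A"
  let ?C = "T closure_of ?H"
  have H: "subgroup ?H G" using assms by (rule generate_is_subgroup)
  have HG: "?H \<subseteq> carrier G" using H subgroup.subset by blast
  have sub: "?H \<subseteq> ?C" using closure_of_subset HG topspace_eq by metis
  have CG: "?C \<subseteq> carrier G" using closure_of_subset_topspace topspace_eq by metis
  have "subgroup ?C G"
  proof (rule subgroupI)
    show "?C \<noteq> {}" using sub H subgroup.one_closed by fastforce
    have "(\<lambda>x. inv x) ` ?H \<subseteq> ?H" using H by (auto intro: subgroup.m_inv_closed)
    then have "T closure_of ((\<lambda>x. inv x) ` ?H) \<subseteq> ?C" by (rule closure_of_mono)
    moreover have "(\<lambda>x. inv x) ` ?C \<subseteq> T closure_of ((\<lambda>x. inv x) ` ?H)"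
      by (rule continuous_map_image_closure_subset[OF continuous_inv])
    ultimately have inv: "(\<lambda>x. inv x) ` ?C \<subseteq> ?C" by (rule subset_trans[rotated])
    have "(\<lambda>(x, y). x \<otimes> y) ` (?H \<times> ?H) \<subseteq> ?H" using H by (auto intro: subgroup.m_closed)
    then have "T closure_of ((\<lambda>(x, y). x \<otimes> y) ` (?H \<times> ?H)) \<subseteq> ?C" by (rule closure_of_mono)
    moreover have "(\<lambda>(x, y). x \<otimes> y) ` (?C \<times> ?C) \<subseteq> T closure_of ((\<lambda>(x, y). x \<otimes> y) ` (?H \<times> ?H))"
      using continuous_map_image_closure_subset[OF continuous_mult, of "?H \<times> ?H"]
      by (simp add: closure_of_Times)
    ultimately have mult: "(\<lambda>(x, y). x \<otimes> y) ` (?C \<times> ?C) \<subseteq> ?C" by (rule subset_trans[rotated])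
    fix x assume x: "x \<in> ?C"
    show "inv x \<in> ?C" by (rule subsetD[OF inv imageI[OF x]])
    fix y assume y: "y \<in> ?C"
    have "(x, y) \<in> ?C \<times> ?C" using x y by simp
    from subsetD[OF mult imageI[OF this]] show "x \<otimes> y \<in> ?C" by simp
  qed (rule CG)
  then show ?thesis unfolding closed_generate_def .
qed

lemma closed_generate_incl: "A \<subseteq> carrier G \<Longrightarrow> A \<subseteq> closed_generate G T A"
  unfolding closed_generate_def
  using closure_of_subset[of "generate G A" T] generate_incl[of A] topspace_eq
  by (auto intro: generate.incl)

lemma closedin_closed_generate: "closedin T (closed_generate G T A)"
  by (simp add: closed_generate_def)

lemma closed_generate_minimal:
  assumes "subgroup C G" "closedin T C" "A \<subseteq> C"
  shows "closed_generate G T A \<subseteq> C"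
  unfolding closed_generate_def
  using assms by (intro closure_of_minimal generate_subgroup_incl)

abbreviation lpc :: "nat \<Rightarrow> nat \<Rightarrow> 'a set" where
  "lpc \<equiv> lower_p_central G T"

lemma lpc_one [simp]: "lpc p 1 = carrier G" "lpc p (Suc 0) = carrier G"
  by simp_all

lemma lpc_Suc:
  assumes "1 \<le> k"
  shows "lpc p (Suc k) = closed_generate G T ({h [^] p | h. h \<in> lpc p k} \<union>
     {commutator G g h | g h. g \<in> carrier G \<and> h \<in> lpc p k})"
  using assms by (cases k) auto

lemma closedin_lpc: "closedin T (lpc p k)"
proof -
  have "closedin T (carrier G)" using closedin_topspace[of T] topspace_eq by simp
  then show ?thesis
    by (cases "(G, T, p, k)" rule: lower_p_central.cases) (auto simp: closedin_closed_generate)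
qed

lemma lpc_subset: "lpc p k \<subseteq> carrier G"
  using closedin_subset[OF closedin_lpc] topspace_eq by metis

lemma lpc_closed: "x \<in> lpc p k \<Longrightarrow> x \<in> carrier G"
  using lpc_subset by blast

lemma lpc_gens_subset:
  "{h [^] p | h. h \<in> lpc p k} \<union> {commutator G g h | g h. g \<in> carrier G \<and> h \<in> lpc p k} \<subseteq> carrier G"
  using lpc_subset[of p k] by auto

lemma subgroup_lpc: "subgroup (lpc p k) G"
proof (cases "k \<le> 1")
  case True
  then have "lpc p k = carrier G" by (cases k) auto
  then show ?thesis using subgroup_self by simp
next
  case False
  then obtain j where "k = Suc j" "1 \<le> j" by (cases k) auto
  then show ?thesis using closed_generate_subgroup[OF lpc_gens_subset] by (simp only: lpc_Suc)
qed

lemma lpc_power: "1 \<le> k \<Longrightarrow> h \<in> lpc p k \<Longrightarrow> h [^] p \<in> lpc p (Suc k)"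
  using closed_generate_incl[OF lpc_gens_subset] unfolding lpc_Suc by blast

lemma lpc_commutator: "1 \<le> k \<Longrightarrow> g \<in> carrier G \<Longrightarrow> h \<in> lpc p k \<Longrightarrow> commutator G g h \<in> lpc p (Suc k)"
  using closed_generate_incl[OF lpc_gens_subset] unfolding lpc_Suc by blast

lemma lpc_minimal:
  assumes "1 \<le> k" "subgroup C G" "closedin T C"
    and "\<And>h. h \<in> lpc p k \<Longrightarrow> h [^] p \<in> C"
    and "\<And>g h. g \<in> carrier G \<Longrightarrow> h \<in> lpc p k \<Longrightarrow> commutator G g h \<in> C"
  shows "lpc p (Suc k) \<subseteq> C"
  unfolding lpc_Suc[OF assms(1)] using assms by (intro closed_generate_minimal) auto

end

section \<open>Commutator calculus with commuting error terms\<close>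

lemma (in group) commutator_swap:
  "g \<in> carrier G \<Longrightarrow> h \<in> carrier G \<Longrightarrow> commutator G h g = inv (commutator G g h)"
  by (simp add: commutator_def inv_mult_group m_assoc)

lemma (in group) mult_commutator:
  "g \<in> carrier G \<Longrightarrow> h \<in> carrier G \<Longrightarrow> g \<otimes> h = h \<otimes> g \<otimes> commutator G g h"
  using r_inv[of "h \<otimes> g"]
  by (simp add: commutator_def inv_mult_group m_assoc[symmetric] del: r_inv)

lemma (in group) commute_inv:
  assumes "x \<in> carrier G" "u \<in> carrier G" "x \<otimes> u = u \<otimes> x"
  shows "x \<otimes> inv u = inv u \<otimes> x"
proof -
  have "x \<otimes> inv u = inv u \<otimes> (u \<otimes> x) \<otimes> inv u" using assms(1,2) by (simp add: m_assoc[symmetric])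
  also have "\<dots> = inv u \<otimes> x" unfolding assms(3)[symmetric] using assms(1,2) by (simp add: m_assoc)
  finally show ?thesis .
qed

text \<open>Handles the generators \<open>h^p\<close>: moving \<open>x\<close> past \<open>h\<close>
  costs a factor \<open>c\<close> that commutes with \<open>h\<close>, so moving it past
  \<open>h^k\<close> costs \<open>c^k\<close>. In the application \<open>c^p\<close> is
  trivial.\<close>

lemma (in group) pow_commute_twisted:
  assumes "x \<in> carrier G" "h \<in> carrier G" "c \<in> carrier G"
    and "x \<otimes> h = h \<otimes> x \<otimes> c" "c \<otimes> h = h \<otimes> c"
  shows "x \<otimes> h [^] k = h [^] k \<otimes> x \<otimes> c [^] (k::nat)"
proof (induction k)
  case (Suc k)
  have ck: "c [^] k \<otimes> h = h \<otimes> c [^] k" using assms by (simp add: group_commutes_pow)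
  have "x \<otimes> h [^] Suc k = (x \<otimes> h [^] k) \<otimes> h" using assms by (simp add: m_assoc)
  also have "\<dots> = h [^] k \<otimes> x \<otimes> (c [^] k \<otimes> h)" unfolding Suc using assms by (simp add: m_assoc)
  also have "\<dots> = h [^] k \<otimes> (x \<otimes> h) \<otimes> c [^] k" unfolding ck using assms(1-3) by (simp add: m_assoc)
  also have "\<dots> = h [^] k \<otimes> h \<otimes> x \<otimes> (c \<otimes> c [^] k)" unfolding assms(4) using assms(1-3) by (simp add: m_assoc)
  also have "\<dots> = h [^] Suc k \<otimes> x \<otimes> c [^] Suc k" using assms by (simp add: nat_pow_Suc2[symmetric])
  finally show ?case .
qed (use assms in simp)

text \<open>Plays the part of the Hall-Witt identity: carrying \<open>x\<close> past
  \<open>a b\<close> and past \<open>b a\<close> costs the same factor \<open>e d\<close>, so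
  \<open>x\<close> commutes with the quotient of the two products.\<close>

lemma (in group) commute_twisted:
  assumes cl: "x \<in> carrier G" "a \<in> carrier G" "b \<in> carrier G" "d \<in> carrier G" "e \<in> carrier G"
    and xa: "x \<otimes> a = a \<otimes> x \<otimes> d" and xb: "x \<otimes> b = b \<otimes> x \<otimes> e"
    and db: "d \<otimes> b = b \<otimes> d" and ea: "e \<otimes> a = a \<otimes> e" and ed: "e \<otimes> d = d \<otimes> e"
  shows "x \<otimes> (a \<otimes> b \<otimes> inv (b \<otimes> a)) = a \<otimes> b \<otimes> inv (b \<otimes> a) \<otimes> x"
proof -
  have "x \<otimes> (a \<otimes> b) = a \<otimes> x \<otimes> (d \<otimes> b)" using cl xa by (simp add: m_assoc[symmetric])
  also have "\<dots> = a \<otimes> (x \<otimes> b) \<otimes> d" unfolding db using cl by (simp add: m_assoc)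
  also have "\<dots> = a \<otimes> b \<otimes> (x \<otimes> (e \<otimes> d))" unfolding xb using cl by (simp add: m_assoc)
  finally have 1: "x \<otimes> (a \<otimes> b) = a \<otimes> b \<otimes> (x \<otimes> (e \<otimes> d))" .
  have "x \<otimes> (b \<otimes> a) = b \<otimes> x \<otimes> (e \<otimes> a)" using cl xb by (simp add: m_assoc[symmetric])
  also have "\<dots> = b \<otimes> (x \<otimes> a) \<otimes> e" unfolding ea using cl by (simp add: m_assoc)
  also have "\<dots> = b \<otimes> a \<otimes> (x \<otimes> (e \<otimes> d))" unfolding xa ed using cl by (simp add: m_assoc)
  finally have "inv (b \<otimes> a) \<otimes> x \<otimes> (b \<otimes> a) = x \<otimes> (e \<otimes> d)"
    using cl by (simp add: m_assoc inv_solve_left')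
  then have "x \<otimes> (a \<otimes> b) \<otimes> inv (b \<otimes> a) = a \<otimes> b \<otimes> (inv (b \<otimes> a) \<otimes> x \<otimes> (b \<otimes> a)) \<otimes> inv (b \<otimes> a)"
    using 1 by simp
  then show ?thesis using cl by (simp add: m_assoc)
qed

context profinite_group
begin

lemma lpc_Suc_subset: "lpc p (Suc k) \<subseteq> lpc p k"
proof (induction k)
  case (Suc k)
  show ?case
  proof (cases "k = 0")
    case True
    then show ?thesis using lpc_subset[of p 2] by (simp add: numeral_2_eq_2)
  next
    case False
    show ?thesis
      using Suc lpc_power[of k _ p] lpc_commutator[of k _ _ p] False
      by (intro lpc_minimal subgroup_lpc closedin_lpc) auto
  qed
qed (use lpc_subset in auto)

lemma lpc_antimono: "j \<le> k \<Longrightarrow> lpc p k \<subseteq> lpc p j"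
  by (induction rule: dec_induct) (use lpc_Suc_subset in auto)

lemma lpc_conj:
  assumes "h \<in> lpc p k" "g \<in> carrier G" shows "inv g \<otimes> h \<otimes> g \<in> lpc p k"
proof (cases "k = 0")
  case True
  then show ?thesis using assms by auto
next
  case False
  have hG: "h \<in> carrier G" using assms lpc_subset by blast
  have "inv (commutator G g h) \<in> lpc p k"
    using False assms subsetD[OF lpc_Suc_subset lpc_commutator[of k g h p]]
    by (simp add: subgroup.m_inv_closed[OF subgroup_lpc])
  then show ?thesis
    using assms hG by (simp add: conj_eq_commutator commutator_swap[of g h] subgroup.m_closed[OF subgroup_lpc])
qed

lemma normal_lpc: "lpc p k \<lhd> G"
proof (rule normal_invI[OF subgroup_lpc])
  fix x h assume "x \<in> carrier G" "h \<in> lpc p k"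
  then show "x \<otimes> h \<otimes> inv x \<in> lpc p k" using lpc_conj[of h p k "inv x"] by simp
qed

text \<open>
  Induction on \<open>b\<close>: \<open>x\<close> commutes with the generators of the next term modulo \<open>lpc p (a + b + 1)\<close>,
  since conjugation by \<open>h\<close> moves it by something central there, and conjugation by \<open>g\<close> moves it by
  something that commutes with \<open>h\<close>.
\<close>

lemma lpc_commutator_lpc:
  assumes "1 \<le> a" "1 \<le> b" "x \<in> lpc p a" "y \<in> lpc p b"
  shows "commutator G x y \<in> lpc p (a + b)"
  using assms(2,1,3,4)
proof (induction b arbitrary: a x y rule: nat_induct_at_least)
  case base
  then have "inv (commutator G y x) \<in> lpc p (Suc a)"
    using lpc_commutator[of a y x p] subgroup.m_inv_closed[OF subgroup_lpc] by auto
  moreover have "x \<in> carrier G" using base lpc_subset by blast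
  ultimately show ?case using base by (simp add: commutator_swap[of y x])
next
  case (Suc b)
  let ?M = "lpc p (a + Suc b)"
  interpret N: normal ?M G by (rule normal_lpc)
  define Q where "Q = G Mod ?M"
  interpret Q: group Q unfolding Q_def by (rule N.factorgroup_is_group)
  define \<pi> where "\<pi> = (\<lambda>g. ?M #> g)"
  have hom: "\<pi> \<in> hom G Q" unfolding \<pi>_def Q_def by (rule N.r_coset_hom_Mod)
  interpret \<pi>: group_hom G Q \<pi> by (unfold_locales) (rule hom)
  have ker: "\<pi> u = \<one>\<^bsub>Q\<^esub> \<longleftrightarrow> u \<in> ?M" if "u \<in> carrier G" for u
    unfolding \<pi>_def Q_def using that N.rcos_const rcos_self[OF that N.subgroup_axioms]
    by (auto simp: FactGroup_def)
  have comm: "\<pi> u \<otimes>\<^bsub>Q\<^esub> \<pi> v = \<pi> v \<otimes>\<^bsub>Q\<^esub> \<pi> u \<otimes>\<^bsub>Q\<^esub> \<pi> (commutator G u v)"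
    if "u \<in> carrier G" "v \<in> carrier G" for u v
    using arg_cong[OF mult_commutator[OF that], of \<pi>] that by simp
  have comm_iff: "commutator G u v \<in> ?M \<longleftrightarrow> \<pi> u \<otimes>\<^bsub>Q\<^esub> \<pi> v = \<pi> v \<otimes>\<^bsub>Q\<^esub> \<pi> u"
    if "u \<in> carrier G" "v \<in> carrier G" for u v
    using comm[OF that] that
    unfolding ker[OF commutator_closed[OF that], symmetric] by simp
  have central: "\<pi> g \<otimes>\<^bsub>Q\<^esub> \<pi> c = \<pi> c \<otimes>\<^bsub>Q\<^esub> \<pi> g" if "c \<in> lpc p (a + b)" "g \<in> carrier G" for c g
  proof -
    have "commutator G g c \<in> ?M" using lpc_commutator[of "a + b" g c p] that Suc.hyps by simp
    then show ?thesis by (rule comm_iff[OF that(2) lpc_closed[OF that(1)], THEN iffD1])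
  qed
  \<comment> \<open>For fixed \<open>x\<close> the condition on \<open>y\<close> is the preimage of
    the closed set \<open>?M\<close>, and modulo \<open>?M\<close> it says that the images commute.
    So \<open>C\<close> is a closed subgroup and containment can be tested on generators.\<close>
  define C where "C = {y \<in> carrier G. \<forall>x\<in>lpc p a. commutator G x y \<in> ?M}"
  have C_iff: "y \<in> C \<longleftrightarrow> y \<in> carrier G \<and> (\<forall>x\<in>lpc p a. \<pi> x \<otimes>\<^bsub>Q\<^esub> \<pi> y = \<pi> y \<otimes>\<^bsub>Q\<^esub> \<pi> x)" for y
    unfolding C_def mem_Collect_eq
    by (rule conj_cong[OF refl], rule ball_cong[OF refl], rule comm_iff[OF lpc_closed])
  have "lpc p (Suc b) \<subseteq> C"
  proof (rule lpc_minimal)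
    show "1 \<le> b" by (rule Suc.hyps)
    show "subgroup C G"
    proof (rule subgroupI)
      show "C \<subseteq> carrier G" unfolding C_def by blast
      have "\<one> \<in> C" unfolding C_iff using lpc_closed by simp
      then show "C \<noteq> {}" by blast
    next
      fix u assume u: "u \<in> C"
      have "\<pi> x \<otimes>\<^bsub>Q\<^esub> inv\<^bsub>Q\<^esub> \<pi> u = inv\<^bsub>Q\<^esub> \<pi> u \<otimes>\<^bsub>Q\<^esub> \<pi> x" if "x \<in> lpc p a" for x
      proof -
        have cl: "\<pi> x \<in> carrier Q" "\<pi> u \<in> carrier Q"
          using that u lpc_subset[of p a] unfolding C_iff by auto
        have "\<pi> x \<otimes>\<^bsub>Q\<^esub> \<pi> u = \<pi> u \<otimes>\<^bsub>Q\<^esub> \<pi> x" using u that unfolding C_iff by blast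
        then show ?thesis by (rule Q.commute_inv[OF cl])
      qed
      then show "inv u \<in> C" using u unfolding C_iff by simp
    next
      fix u v assume u: "u \<in> C" and v: "v \<in> C"
      have "\<pi> x \<otimes>\<^bsub>Q\<^esub> (\<pi> u \<otimes>\<^bsub>Q\<^esub> \<pi> v) = \<pi> u \<otimes>\<^bsub>Q\<^esub> \<pi> v \<otimes>\<^bsub>Q\<^esub> \<pi> x" if "x \<in> lpc p a" for x
      proof -
        have cl: "\<pi> x \<in> carrier Q" "\<pi> u \<in> carrier Q" "\<pi> v \<in> carrier Q"
          using that u v lpc_subset[of p a] unfolding C_iff by auto
        then show ?thesis using u v that unfolding C_iff by (metis Q.m_assoc)
      qed
      then show "u \<otimes> v \<in> C" using u v unfolding C_iff by simp
    qed
    have "C = (\<Inter>x\<in>lpc p a. {y \<in> carrier G. commutator G x y \<in> ?M})"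
      unfolding C_def using subgroup.one_closed[OF subgroup_lpc] by blast
    also have "closedin T \<dots>"
    proof (rule closedin_Inter)
      fix K assume "K \<in> (\<lambda>x. {y \<in> carrier G. commutator G x y \<in> ?M}) ` lpc p a"
      then show "closedin T K"
        using closedin_preimage[OF continuous_map_commutator closedin_lpc] lpc_closed by blast
    qed (use subgroup.one_closed[OF subgroup_lpc] in blast)
    finally show "closedin T C" .
  next
    fix h assume h: "h \<in> lpc p b"
    have "\<pi> x \<otimes>\<^bsub>Q\<^esub> \<pi> (h [^] p) = \<pi> (h [^] p) \<otimes>\<^bsub>Q\<^esub> \<pi> x" if x: "x \<in> lpc p a" for x
    proof -
      let ?c = "commutator G x h"
      have xh: "x \<in> carrier G" "h \<in> carrier G" using x h lpc_closed by blast+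
      have c: "?c \<in> lpc p (a + b)" using Suc.IH[OF Suc.prems(1) x h] .
      have "\<pi> x \<otimes>\<^bsub>Q\<^esub> \<pi> h [^]\<^bsub>Q\<^esub> p = \<pi> h [^]\<^bsub>Q\<^esub> p \<otimes>\<^bsub>Q\<^esub> \<pi> x \<otimes>\<^bsub>Q\<^esub> \<pi> ?c [^]\<^bsub>Q\<^esub> p"
        using xh comm[OF xh] central[OF c xh(2)] by (intro Q.pow_commute_twisted) auto
      moreover have "\<pi> ?c [^]\<^bsub>Q\<^esub> p = \<one>\<^bsub>Q\<^esub>"
        using lpc_power[of "a + b" ?c p] c xh Suc.hyps ker[of "?c [^] p"] by (simp add: \<pi>.hom_nat_pow)
      ultimately show ?thesis using xh by (simp add: \<pi>.hom_nat_pow)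
    qed
    then show "h [^] p \<in> C" unfolding C_iff using h lpc_subset[of p b] by auto
  next
    fix g h assume g: "g \<in> carrier G" and h: "h \<in> lpc p b"
    have hG: "h \<in> carrier G" using h lpc_subset by blast
    \<comment> \<open>Inverses, because \<open>[g, h] = g^-1 h^-1 g h\<close> equals
      \<open>(a b) (b a)^-1\<close> for \<open>a = g^-1\<close> and \<open>b = h^-1\<close>.\<close>
    define A where "A = \<pi> (inv g)"
    define B where "B = \<pi> (inv h)"
    have AB: "A \<in> carrier Q" "B \<in> carrier Q" unfolding A_def B_def using g hG by auto
    have "\<pi> x \<otimes>\<^bsub>Q\<^esub> \<pi> (commutator G g h) = \<pi> (commutator G g h) \<otimes>\<^bsub>Q\<^esub> \<pi> x" if x: "x \<in> lpc p a" for x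
    proof -
      have xG: "x \<in> carrier G" using x lpc_subset by blast
      have h': "inv h \<in> lpc p b" using h subgroup.m_inv_closed[OF subgroup_lpc] by blast
      define c where "c = commutator G x (inv h)"
      define d where "d = commutator G x (inv g)"
      have c: "c \<in> lpc p (a + b)" unfolding c_def by (rule Suc.IH[OF Suc.prems(1) x h'])
      have "d = inv (commutator G (inv g) x)" unfolding d_def using g xG by (simp add: commutator_swap[of "inv g" x])
      then have d: "d \<in> lpc p (Suc a)"
        using lpc_commutator[of a "inv g" x p] Suc.prems(1) x g by (simp add: subgroup.m_inv_closed[OF subgroup_lpc])
      have dG: "d \<in> carrier G" "c \<in> carrier G" using c d lpc_closed by blast+
      define X where "X = \<pi> x"
      define D where "D = \<pi> d"
      define E where "E = \<pi> c"
      have cl: "X \<in> carrier Q" "D \<in> carrier Q" "E \<in> carrier Q" unfolding X_def D_def E_def using dG xG by auto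
      \<comment> \<open>The induction hypothesis is applied at \<open>Suc a\<close>, where
        \<open>d\<close> lives, with total weight \<open>Suc a + b\<close>; this is why
        \<open>a\<close> is generalized.\<close>
      have "commutator G d (inv h) \<in> ?M" using Suc.IH[of "Suc a" d "inv h"] d h' by simp
      then have DB: "D \<otimes>\<^bsub>Q\<^esub> B = B \<otimes>\<^bsub>Q\<^esub> D" using comm_iff dG hG unfolding D_def B_def by simp
      have XA: "X \<otimes>\<^bsub>Q\<^esub> A = A \<otimes>\<^bsub>Q\<^esub> X \<otimes>\<^bsub>Q\<^esub> D"
        unfolding X_def A_def D_def d_def by (rule comm) (use xG g in auto)
      have XB: "X \<otimes>\<^bsub>Q\<^esub> B = B \<otimes>\<^bsub>Q\<^esub> X \<otimes>\<^bsub>Q\<^esub> E"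
        unfolding X_def B_def E_def c_def by (rule comm) (use xG hG in auto)
      have EA: "E \<otimes>\<^bsub>Q\<^esub> A = A \<otimes>\<^bsub>Q\<^esub> E" and ED: "E \<otimes>\<^bsub>Q\<^esub> D = D \<otimes>\<^bsub>Q\<^esub> E"
        unfolding E_def A_def D_def
        by (rule central[OF c, symmetric]; use g dG in simp)+
      have "X \<otimes>\<^bsub>Q\<^esub> ((A \<otimes>\<^bsub>Q\<^esub> B) \<otimes>\<^bsub>Q\<^esub> inv\<^bsub>Q\<^esub> (B \<otimes>\<^bsub>Q\<^esub> A)) =
          (A \<otimes>\<^bsub>Q\<^esub> B) \<otimes>\<^bsub>Q\<^esub> inv\<^bsub>Q\<^esub> (B \<otimes>\<^bsub>Q\<^esub> A) \<otimes>\<^bsub>Q\<^esub> X"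
        by (rule Q.commute_twisted) (fact cl AB XA XB DB EA ED)+
      moreover have "\<pi> (commutator G g h) = (A \<otimes>\<^bsub>Q\<^esub> B) \<otimes>\<^bsub>Q\<^esub> inv\<^bsub>Q\<^esub> (B \<otimes>\<^bsub>Q\<^esub> A)"
        unfolding A_def B_def commutator_def using g hG by (simp add: Q.inv_mult_group Q.m_assoc)
      ultimately show ?thesis unfolding X_def by simp
    qed
    then show "commutator G g h \<in> C" unfolding C_iff using g hG by simp
  qed
  then show ?case using Suc.prems unfolding C_def by blast
qed

lemma central_filtration_lpc: "0 < p \<Longrightarrow> central_filtration G (lpc p) p"
  by (intro central_filtration.intro central_filtration_axioms.intro is_group)
    (auto intro: subgroup_lpc lpc_commutator_lpc lpc_power subsetD[OF lpc_antimono])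

end

section \<open>Coordinates in the Magnus ring\<close>

fun ncprod :: "'r::monoid_mult list \<Rightarrow> nat list \<Rightarrow> 'r" where
  "ncprod (y # ys) (a # as) = y ^ a * ncprod ys as"
| "ncprod _ _ = 1"

definition binprod :: "nat list \<Rightarrow> nat list \<Rightarrow> nat" where
  "binprod as ks = prod_list (map2 (choose) as ks)"

lemma one_plus_power:
  fixes u :: "'r::ring_1"
  shows "(1 + u) ^ a = (\<Sum>j\<le>a. of_nat (a choose j) * u ^ j)"
proof (induction a)
  case (Suc a)
  have "(1 + u) ^ Suc a = (\<Sum>j\<le>a. of_nat (a choose j) * u ^ j) * (1 + u)"
    by (simp only: Suc power_Suc2)
  also have "\<dots> = (\<Sum>j\<le>a. of_nat (a choose j) * u ^ j) + (\<Sum>j\<le>a. of_nat (a choose j) * u ^ Suc j)"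
    by (simp add: distrib_left sum_distrib_right mult.assoc power_Suc2 del: power_Suc)
  also have "(\<Sum>j\<le>a. of_nat (a choose j) * u ^ j) = 1 + (\<Sum>j\<le>a. of_nat (a choose Suc j) * u ^ Suc j)"
    by (subst sum.atMost_shift) (simp add: lessThan_Suc_atMost[symmetric] binomial_eq_0 del: power_Suc)
  finally show ?case
    by (subst sum.atMost_Suc_shift) (simp add: sum.distrib distrib_right algebra_simps del: power_Suc)
qed simp

lemma of_nat_mult_mult:
  fixes u :: "'r::ring_1"
  shows "(of_nat k * u) * (of_nat l * v) = of_nat (k * l) * (u * v)"
proof -
  have "u * (of_nat l * v) = of_nat l * (u * v)"
    by (simp only: mult.assoc[symmetric] mult_of_nat_commute[of l u])
  then show ?thesis by (simp only: mult.assoc of_nat_mult)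
qed

text \<open>Each factor is expanded as \<open>(1 + (y - 1))^a\<close> without changing the order of
  the factors. The coefficient of a single \<open>y - 1\<close> is its exponent in
  \<open>as\<close>, which is how exponents will be recovered.\<close>

lemma expand_ncprod:
  fixes ys :: "'r::ring_1 list"
  assumes "length as = length ys"
  shows "ncprod ys as = (\<Sum>ks | list_all2 (\<le>) ks as. of_nat (binprod as ks) * ncprod (map (\<lambda>y. y - 1) ys) ks)"
  using assms
proof (induction ys arbitrary: as)
  case Nil
  then show ?case by (simp add: binprod_def)
next
  case (Cons y ys)
  then obtain a as' where as: "as = a # as'" "length as' = length ys" by (auto simp: length_Suc_conv)
  let ?B = "{ks. list_all2 (\<le>) ks as'}"
  let ?us = "map (\<lambda>y. y - 1) ys"
  have B: "{ks. list_all2 (\<le>) ks as} = (\<lambda>(k, ks). k # ks) ` ({..a} \<times> ?B)"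
    by (auto simp: as list_all2_Cons2)
  have "ncprod (y # ys) as = (\<Sum>k\<le>a. of_nat (a choose k) * (y - 1) ^ k) *
      (\<Sum>ks\<in>?B. of_nat (binprod as' ks) * ncprod ?us ks)"
    using Cons.IH[OF as(2)] one_plus_power[of "y - 1" a] by (simp add: as)
  also have "\<dots> = (\<Sum>(k, ks)\<in>{..a} \<times> ?B. (of_nat (a choose k) * (y - 1) ^ k) * (of_nat (binprod as' ks) * ncprod ?us ks))"
    by (simp add: sum_product sum.cartesian_product)
  also have "\<dots> = (\<Sum>(k, ks)\<in>{..a} \<times> ?B. of_nat (binprod as (k # ks)) * ncprod ((y - 1) # ?us) (k # ks))"
    by (intro sum.cong refl) (simp add: case_prod_beta as binprod_def of_nat_mult_mult del: of_nat_mult)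
  also have "\<dots> = (\<Sum>ks | list_all2 (\<le>) ks as. of_nat (binprod as ks) * ncprod ((y - 1) # ?us) ks)"
    unfolding B by (subst sum.reindex) (auto simp: inj_on_def case_prod_beta intro!: sum.cong)
  finally show ?case by simp
qed

text \<open>Applied once to words graded by length and once to exponent vectors graded by weight.
  Both have \<open>m^s\<close> elements in degree \<open>s\<close>, so the ring and the set of
  reduced coefficient families have the same size.\<close>

lemma prod_by_weight:
  assumes "finite A" "\<And>x. x \<in> A \<Longrightarrow> wt x \<le> (n::nat)" "\<And>s. s \<le> n \<Longrightarrow> card {x \<in> A. wt x = s} = m ^ s"
  shows "(\<Prod>x\<in>A. f (wt x)) = (\<Prod>s\<le>n. f s ^ (m ^ s) :: nat)"
proof -
  have "(\<Prod>x\<in>A. f (wt x)) = (\<Prod>s\<le>n. \<Prod>x | x \<in> A \<and> wt x = s. f (wt x))"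
    by (rule prod.group[symmetric]) (use assms in auto)
  also have "\<dots> = (\<Prod>s\<le>n. f s ^ (m ^ s))"
    using assms(3) by (intro prod.cong) auto
  finally show ?thesis .
qed

lemma card_range_nc_red:
  assumes "0 < p" "finite X"
  shows "card (range (nc_red p X (Suc n))) = (\<Prod>s\<le>n. (p ^ (Suc n - s)) ^ (card X ^ s))"
    and "finite (range (nc_red p X (Suc n)))"
proof -
  let ?P = "\<Pi>\<^sub>E w\<in>words X n. {0..<int p ^ (Suc n - length w)}"
  have fin: "finite (words X n)" using assms by (simp add: finite_words)
  have "finite ?P" using fin by (intro finite_PiE) auto
  then show "finite (range (nc_red p X (Suc n)))"
    using bij_betw_finite[OF bij_betw_range_nc_red[OF assms(1), of X n]] by simp
  have "card (range (nc_red p X (Suc n))) = card ?P"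
    by (rule bij_betw_same_card[OF bij_betw_range_nc_red[OF assms(1)]])
  also have "\<dots> = (\<Prod>w\<in>words X n. p ^ (Suc n - length w))"
    using fin by (simp add: card_PiE nat_power_eq)
  also have "\<dots> = (\<Prod>s\<le>n. (p ^ (Suc n - s)) ^ (card X ^ s))"
  proof (rule prod_by_weight[OF fin])
    fix s assume "s \<le> n"
    then have "{w \<in> words X n. length w = s} = {w. set w \<subseteq> X \<and> length w = s}"
      by (auto simp: words_def)
    then show "card {w \<in> words X n. length w = s} = card X ^ s"
      using card_lists_length_eq[OF assms(2)] by simp
  qed (simp add: words_def)
  finally show "card (range (nc_red p X (Suc n))) = (\<Prod>s\<le>n. (p ^ (Suc n - s)) ^ (card X ^ s))" .
qed

lemma nc_filt_of_int_mult:
  assumes "int p ^ e dvd c" "f \<in> nc_filt p X j"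
  shows "of_int c * f \<in> nc_filt p X (e + j)"
proof -
  obtain d where c: "c = d * int p ^ e" using assms(1) by (metis dvdE mult.commute)
  have "of_nat p ^ e * f \<in> nc_filt p X (e + j)" by (rule nc_filt_mult[OF nc_filt_of_nat assms(2)])
  then have "of_int d * (of_nat p ^ e * f) \<in> nc_filt p X (e + j)" by (rule nc_filt_mult_left)
  moreover have "of_int c * f = of_int d * (of_nat p ^ e * f)"
    by (simp add: c mult.assoc)
  ultimately show ?thesis by simp
qed

lemma binprod_unit:
  assumes "i < length as"
  shows "binprod as ((replicate (length as) 0)[i := 1]) = as ! i"
  using assms
proof (induction as arbitrary: i)
  case (Cons a as)
  have z: "binprod as (replicate (length as) 0) = 1" by (induction as) (simp_all add: binprod_def)
  show ?case using Cons z by (cases i) (simp_all add: binprod_def)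
qed simp

lemma vec_weight_unit:
  assumes "i < length ws"
  shows "vec_weight ws ((replicate (length ws) 0)[i := 1]) = ws ! i"
  using assms
proof (induction ws arbitrary: i)
  case (Cons w ws)
  have z: "vec_weight ws (replicate (length ws) 0) = 0" by (induction ws) simp_all
  show ?case using Cons z by (cases i) simp_all
qed simp

lemma ncprod_in_filt:
  assumes "list_all2 (\<lambda>u w. u \<in> nc_filt p X w) us ws" "length ks = length ws"
  shows "ncprod us ks \<in> nc_filt p X (vec_weight ws ks)"
  using assms
proof (induction arbitrary: ks rule: list_all2_induct)
  case (Cons u us w ws)
  then obtain k ks' where ks: "ks = k # ks'" "length ks' = length ws" by (auto simp: length_Suc_conv)
  have "u ^ k * ncprod us ks' \<in> nc_filt p X (k * w + vec_weight ws ks')"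
    by (intro nc_filt_mult nc_filt_power Cons ks)
  then show ?case using ks by (simp add: mult.commute)
qed simp

lemma binprod_eq_0:
  assumes "length ks = length as" "\<not> list_all2 (\<le>) ks as"
  shows "binprod as ks = 0"
  using assms by (induction ks as rule: list_induct2) (auto simp: binprod_def)

text \<open>
  The group elements \<open>\<Gamma>\<close> span the ring, hence so do the monomials in the \<open>y\<^sub>i - 1\<close>.  There are
  just enough of them for their coefficients (mod the obvious power of \<open>p\<close>) to be unique, and the
  coefficient of \<open>y\<^sub>i - 1\<close> in \<open>\<Prod> y\<^sub>i ^ a\<^sub>i\<close> is \<open>a\<^sub>i\<close>.
\<close>

lemma ncprod_inj_on:
  fixes ys :: "'a ncps list"
  assumes p: "0 < p" and X: "finite X"
    and ys: "list_all2 (\<lambda>y w. y - 1 \<in> nc_filt p X w) ys ws"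
    and ws: "\<forall>w\<in>set ws. 1 \<le> w \<and> w \<le> n"
    and agree: "fps_agree n (weight_fps ws) (1 - fps_const (int (card X)) * fps_X)"
    and \<Gamma>: "\<And>g. g \<in> \<Gamma> \<Longrightarrow> \<exists>as. length as = length ws \<and> g - ncprod ys as \<in> nc_filt p X (Suc n)"
    and \<Gamma>_one: "\<exists>g\<in>\<Gamma>. g - 1 \<in> nc_filt p X (Suc n)"
    and \<Gamma>_mult: "\<And>g x. g \<in> \<Gamma> \<Longrightarrow> x \<in> X \<Longrightarrow> \<exists>h\<in>\<Gamma>. h - g * (1 + nc_word [x]) \<in> nc_filt p X (Suc n)"
    and as: "as \<in> exponents p n ws" and bs: "bs \<in> exponents p n ws"
    and eq: "ncprod ys as - ncprod ys bs \<in> nc_filt p X (Suc n)"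
  shows "as = bs"
proof -
  let ?F = "nc_filt p X (Suc n)"
  let ?red = "nc_red p X (Suc n)"
  let ?us = "map (\<lambda>y. y - 1) ys"
  have len: "length ys = length ws" using ys by (rule list_all2_lengthD)
  have ws1: "\<forall>w\<in>set ws. 1 \<le> w" using ws by blast
  have us: "list_all2 (\<lambda>u w. u \<in> nc_filt p X w) ?us ws" using ys by (simp add: list_all2_map1)
  \<comment> \<open>Monomials of weight above \<open>n\<close> lie in \<open>?F\<close>, so these
    finitely many exponent vectors suffice.\<close>
  define K where "K = {ks. length ks = length ws \<and> vec_weight ws ks \<le> n}"
  have finK: "finite K"
  proof -
    have "K = (\<Union>s\<le>n. vecs ws s)" by (auto simp: K_def vecs_def)
    then show ?thesis using finite_vecs[OF ws1] by simp
  qed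
  define comb where "comb = (\<lambda>c. \<Sum>ks\<in>K. of_int (c ks) * ncprod ?us ks)"
  have comb_diff: "comb c - comb d = comb (\<lambda>k. c k - d k)" for c d
    by (simp add: comb_def left_diff_distrib sum_subtractf)
  have comb_in: "comb c \<in> ?F" if "\<And>ks. ks \<in> K \<Longrightarrow> int p ^ (Suc n - vec_weight ws ks) dvd c ks" for c
    unfolding comb_def
  proof (rule nc_filt_sum)
    fix ks assume ks: "ks \<in> K"
    then have "of_int (c ks) * ncprod ?us ks \<in> nc_filt p X (Suc n - vec_weight ws ks + vec_weight ws ks)"
      by (intro nc_filt_of_int_mult that ncprod_in_filt[OF us]) (auto simp: K_def)
    then show "of_int (c ks) * ncprod ?us ks \<in> ?F" using ks by (simp add: K_def)
  qed
  have expand: "ncprod ys as - comb (\<lambda>ks. int (binprod as ks)) \<in> ?F" if "length as = length ws" for as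
  proof -
    let ?B = "{ks. list_all2 (\<le>) ks as}"
    let ?t = "\<lambda>ks. of_nat (binprod as ks) * ncprod ?us ks"
    have finB: "finite ?B"
    proof (rule finite_subset)
      show "?B \<subseteq> {ks. set ks \<subseteq> {..sum_list as} \<and> length ks = length as}"
      proof
        fix ks assume "ks \<in> ?B"
        then have ks: "list_all2 (\<le>) ks as" by simp
        have "ks ! i \<le> sum_list as" if "i < length as" for i
          using list_all2_nthD2[OF ks that] elem_le_sum_list[OF that] by linarith
        then show "ks \<in> {ks. set ks \<subseteq> {..sum_list as} \<and> length ks = length as}"
          using list_all2_lengthD[OF ks] by (auto simp: in_set_conv_nth)
      qed
    qed (simp add: finite_lists_length_eq)
    have "ncprod ys as = sum ?t ?B" using that len by (simp add: expand_ncprod)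
    moreover have "comb (\<lambda>ks. int (binprod as ks)) = sum ?t (K \<inter> ?B)"
      unfolding comb_def of_int_of_nat_eq
      by (rule sum.mono_neutral_right)
        (use that finK binprod_eq_0[of _ as] in \<open>auto simp: K_def simp flip: list_all2_conv_all_nth\<close>)
    moreover have "sum ?t ?B = sum ?t (K \<inter> ?B) + sum ?t (?B - K)"
      using sum.subset_diff[of "K \<inter> ?B" ?B ?t] finB by (simp add: Diff_Int_distrib2 Diff_Int add.commute)
    moreover have "sum ?t (?B - K) \<in> ?F"
    proof (rule nc_filt_sum)
      fix ks assume ks: "ks \<in> ?B - K"
      then have l: "length ks = length ws" using that by (auto dest: list_all2_lengthD)
      then have "Suc n \<le> vec_weight ws ks" using ks by (auto simp: K_def)
      then have "ncprod ?us ks \<in> ?F" using ncprod_in_filt[OF us l] nc_filt_antimono by blast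
      then show "?t ks \<in> ?F" by (rule nc_filt_mult_left)
    qed
    ultimately show ?thesis by simp
  qed
  \<comment> \<open>The integer span of the monomials modulo \<open>?F\<close>; it will turn out to
    be the whole ring.\<close>
  define Sp where "Sp = {f. \<exists>c. f - comb c \<in> ?F}"
  have Sp_diff: "f - g \<in> Sp" if "f \<in> Sp" "g \<in> Sp" for f g
  proof -
    obtain c d where "f - comb c \<in> ?F" "g - comb d \<in> ?F" using \<open>f \<in> Sp\<close> \<open>g \<in> Sp\<close> unfolding Sp_def by blast
    then have "(f - comb c) - (g - comb d) \<in> ?F" by (rule nc_filt_closed)
    moreover have "(f - comb c) - (g - comb d) = (f - g) - comb (\<lambda>k. c k - d k)"
      using comb_diff[of c d] by (simp add: algebra_simps)
    ultimately show ?thesis unfolding Sp_def by auto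
  qed
  have Sp_cong: "f \<in> Sp" if "g \<in> Sp" "f - g \<in> ?F" for f g
  proof -
    obtain c where "g - comb c \<in> ?F" using \<open>g \<in> Sp\<close> unfolding Sp_def by blast
    then have "(f - g) + (g - comb c) \<in> ?F" using that by blast
    then show ?thesis unfolding Sp_def by auto
  qed
  have Sp_0: "0 \<in> Sp" unfolding Sp_def by (auto intro!: exI[of _ "\<lambda>_. 0"] simp: comb_def)
  have Sp_add: "f + g \<in> Sp" if "f \<in> Sp" "g \<in> Sp" for f g
    using Sp_diff[OF that(1) Sp_diff[OF Sp_0 that(2)]] by simp
  have Sp_of_int: "of_int c * f \<in> Sp" if f: "f \<in> Sp" for c f
  proof -
    have nat: "of_nat k * f \<in> Sp" for k
      by (induction k) (use f Sp_0 Sp_add in \<open>auto simp: distrib_right\<close>)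
    show ?thesis
    proof (cases "0 \<le> c")
      case True
      then show ?thesis using nat[of "nat c"] by simp
    next
      case False
      then have "of_int c * f = 0 - of_nat (nat (- c)) * f" by simp
      then show ?thesis using Sp_diff[OF Sp_0 nat] by simp
    qed
  qed
  have Sp_sum: "(\<And>a. a \<in> A \<Longrightarrow> f a \<in> Sp) \<Longrightarrow> sum f A \<in> Sp" for f :: "'b \<Rightarrow> 'a ncps" and A
    by (induction A rule: infinite_finite_induct) (auto intro: Sp_0 Sp_add)
  have \<Gamma>_Sp: "\<Gamma> \<subseteq> Sp"
  proof
    fix g assume "g \<in> \<Gamma>"
    then obtain as where "length as = length ws" "g - ncprod ys as \<in> ?F" using \<Gamma> by blast
    moreover have "ncprod ys as \<in> Sp" using expand[OF \<open>length as = length ws\<close>] unfolding Sp_def by blast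
    ultimately show "g \<in> Sp" using Sp_cong by blast
  qed
  \<comment> \<open>Since \<open>g x = g (1 + x) - g\<close>, and \<open>g (1 + x)\<close> is again
    in \<Gamma> up to \<open>?F\<close>, the first letter of a word can be traded for a change of
    \<open>g\<close>.\<close>
  have word: "\<forall>g\<in>\<Gamma>. g * nc_word w \<in> Sp" if "w \<in> lists X" for w
    using that
  proof (induction w)
    case Nil
    then show ?case using \<Gamma>_Sp by auto
  next
    case (Cons x w)
    show ?case
    proof
      fix g assume g: "g \<in> \<Gamma>"
      obtain h where h: "h \<in> \<Gamma>" "h - g * (1 + nc_word [x]) \<in> ?F" using \<Gamma>_mult[OF g] Cons by blast
      have "g * nc_word (x # w) - (h * nc_word w - g * nc_word w) = - ((h - g * (1 + nc_word [x])) * nc_word w)"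
        unfolding nc_word_Cons[of x w] by (simp add: algebra_simps)
      moreover have "- ((h - g * (1 + nc_word [x])) * nc_word w) \<in> ?F"
        using nc_filt_mult_right[OF h(2)] by blast
      moreover have "h * nc_word w - g * nc_word w \<in> Sp" using Cons h g Sp_diff by blast
      ultimately show "g * nc_word (x # w) \<in> Sp" using Sp_cong by metis
    qed
  qed
  obtain g1 where g1: "g1 \<in> \<Gamma>" "g1 - 1 \<in> ?F" using \<Gamma>_one by blast
  have word1: "nc_word w \<in> Sp" if "w \<in> lists X" for w
  proof (rule Sp_cong)
    show "g1 * nc_word w \<in> Sp" using word[OF that] g1 by blast
    have "- ((g1 - 1) * nc_word w) \<in> ?F" using nc_filt_mult_right[OF g1(2)] by blast
    then show "nc_word w - g1 * nc_word w \<in> ?F" by (simp add: algebra_simps)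
  qed
  have Sp_UNIV: "f \<in> Sp" for f
  proof (rule Sp_cong)
    let ?W = "words X n"
    show "(\<Sum>w\<in>?W. of_int (ncoeff f w) * nc_word w) \<in> Sp"
      by (intro Sp_sum Sp_of_int word1) (auto simp: words_def)
    have "ncoeff (\<Sum>w\<in>?W. of_int (ncoeff f w) * nc_word w) v = (if v \<in> ?W then ncoeff f v else 0)" for v
      using finite_words[OF X, of n] by (simp add: if_distrib cong: if_cong)
    then show "f - (\<Sum>w\<in>?W. of_int (ncoeff f w) * nc_word w) \<in> ?F"
      by (auto simp: nc_filt_def words_def simp del: ncoeff_sum)
  qed
  \<comment> \<open>A monomial lies in the filtration step of its weight, so its coefficient matters
    only modulo the complementary power of \<open>p\<close>.\<close>
  define C where "C = (\<Pi>\<^sub>E ks\<in>K. {0..<int p ^ (Suc n - vec_weight ws ks)})"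
  define reduce where "reduce = (\<lambda>c. \<lambda>ks\<in>K. c ks mod int p ^ (Suc n - vec_weight ws ks))"
  have reduce_C: "reduce c \<in> C" for c using p by (auto simp: reduce_def C_def)
  have reduce_comb: "comb c - comb (reduce c) \<in> ?F" for c
    unfolding comb_diff by (rule comb_in) (simp add: reduce_def minus_mod_eq_mult_div)
  have surj: "(?red \<circ> comb) ` C = range ?red"
  proof (intro equalityI subsetI)
    fix r assume "r \<in> range ?red"
    then obtain f where r: "r = ?red f" by blast
    obtain c where "f - comb c \<in> ?F" using Sp_UNIV unfolding Sp_def by blast
    then have "(f - comb c) + (comb c - comb (reduce c)) \<in> ?F" using reduce_comb by blast
    then have "r = (?red \<circ> comb) (reduce c)" by (simp add: r nc_red_eq_iff)
    then show "r \<in> (?red \<circ> comb) ` C" using reduce_C by blast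
  qed auto
  have finC: "finite C" unfolding C_def using finK by (intro finite_PiE) auto
  have "card C = (\<Prod>ks\<in>K. p ^ (Suc n - vec_weight ws ks))"
    unfolding C_def using finK by (simp add: card_PiE nat_power_eq)
  also have "\<dots> = (\<Prod>s\<le>n. (p ^ (Suc n - s)) ^ (card X ^ s))"
  proof (rule prod_by_weight[OF finK])
    fix s assume s: "s \<le> n"
    then have "{ks \<in> K. vec_weight ws ks = s} = vecs ws s" by (auto simp: K_def vecs_def)
    then show "card {ks \<in> K. vec_weight ws ks = s} = card X ^ s" using card_vecs[OF ws1 agree s] by simp
  qed (simp add: K_def)
  also have "\<dots> = card ((?red \<circ> comb) ` C)" unfolding surj using card_range_nc_red(1)[OF p X] by simp
  \<comment> \<open>A surjection between finite sets of equal size is injective.\<close>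
  finally have inj: "inj_on (?red \<circ> comb) C" using inj_on_iff_eq_card[OF finC] by metis
  have lens: "length as = length ws" "length bs = length ws"
    using as bs by (auto simp: exponents_def dest: list_all2_lengthD)
  let ?ca = "\<lambda>ks. int (binprod as ks)" and ?cb = "\<lambda>ks. int (binprod bs ks)"
  have "comb ?ca - comb ?cb = (ncprod ys as - ncprod ys bs) - (ncprod ys as - comb ?ca) + (ncprod ys bs - comb ?cb)"
    by simp
  also have "\<dots> \<in> ?F" using eq expand[OF lens(1)] expand[OF lens(2)] by blast
  finally have 1: "comb ?ca - comb ?cb \<in> ?F" .
  have "comb (reduce ?ca) - comb (reduce ?cb) =
      (comb ?ca - comb ?cb) - (comb ?ca - comb (reduce ?ca)) + (comb ?cb - comb (reduce ?cb))" by simp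
  also have "\<dots> \<in> ?F" using 1 reduce_comb[of ?ca] reduce_comb[of ?cb] by blast
  finally have "(?red \<circ> comb) (reduce ?ca) = (?red \<circ> comb) (reduce ?cb)" by (simp add: nc_red_eq_iff)
  then have red_eq: "reduce ?ca = reduce ?cb" by (rule inj_onD[OF inj _ reduce_C reduce_C])
  show "as = bs"
  proof (rule nth_equalityI)
    fix i assume "i < length as"
    then have i: "i < length ws" using lens by simp
    \<comment> \<open>At the unit vector the coefficient is the exponent \<open>as ! i\<close>. It
      is known modulo \<open>p^(Suc n - ws ! i)\<close>, and the bound in \<open>exponents\<close>
      turns the residue into the exponent itself.\<close>
    let ?e = "(replicate (length ws) 0)[i := 1]"
    have w: "vec_weight ws ?e = ws ! i" by (rule vec_weight_unit[OF i])
    have "?e \<in> K" using w ws i by (simp add: K_def)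
    then have "int (as ! i) mod int p ^ (Suc n - ws ! i) = int (bs ! i) mod int p ^ (Suc n - ws ! i)"
      using fun_cong[OF red_eq, of ?e] binprod_unit[of i as] binprod_unit[of i bs] i lens w
      by (simp add: reduce_def)
    moreover have "as ! i < p ^ (Suc n - ws ! i)" "bs ! i < p ^ (Suc n - ws ! i)"
      using as bs i lens by (auto simp: exponents_def list_all2_conv_all_nth)
    ultimately show "as ! i = bs ! i" by (simp flip: of_nat_power add: mod_less zmod_int[symmetric])
  qed (use lens in simp)
qed

section \<open>Homomorphisms to finite groups\<close>

lemma profinite_group_discrete:
  assumes "group G" "finite (carrier G)"
  shows "profinite_group G (discrete_topology (carrier G))"
proof -
  interpret group G by fact
  show ?thesis
  proof
    show "continuous_map (prod_topology (discrete_topology (carrier G)) (discrete_topology (carrier G)))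
        (discrete_topology (carrier G)) (\<lambda>(x, y). x \<otimes>\<^bsub>G\<^esub> y)"
      by (auto simp: prod_topology_discrete_topology[symmetric])
    show "compact_space (discrete_topology (carrier G))"
      using assms by (simp add: compact_space_discrete_topology)
    show "totally_disconnected_space (discrete_topology (carrier G))"
      unfolding totally_disconnected_space_def
    proof (intro allI impI)
      fix C assume C: "connectedin (discrete_topology (carrier G)) C"
      show "\<exists>x. C \<subseteq> {x}"
      proof (cases "C = {}")
        case False
        then obtain x where x: "x \<in> C" by blast
        have sub: "C \<subseteq> carrier G" using connectedin_subset_topspace[OF C] by simp
        have "C \<subseteq> {x} \<or> disjnt C {x}"
          using C x sub by (intro connectedin_clopen_cases[of "discrete_topology (carrier G)"]) auto
        then show ?thesis using x by (auto simp: disjnt_def)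
      qed auto
    qed
  qed auto
qed

text \<open>The universal property speaks of groups carried by one fixed type, so finite targets
  must be copied to it. The size condition keeps the statement usable before that type is known to
  be infinite.\<close>

lemma finite_group_on_infinite_type:
  fixes H :: "('h, 'n) monoid_scheme"
  assumes "group H" "finite (carrier H)" "finite (UNIV :: 'b set) \<Longrightarrow> card (carrier H) \<le> card (UNIV :: 'b set)"
  shows "\<exists>(G :: 'b monoid) \<phi>. group G \<and> \<phi> \<in> hom H G \<and> bij_betw \<phi> (carrier H) (carrier G)"
proof -
  interpret H: group H by fact
  obtain B :: "'b set" where B: "finite B" "card B = card (carrier H)"
  proof (cases "finite (UNIV :: 'b set)")
    case True
    then show ?thesis using obtain_subset_with_card_n[OF assms(3)] that finite_subset[OF _ True] by blast
  next
    case False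
    then show ?thesis using infinite_arbitrarily_large that by blast
  qed
  then obtain \<phi> where \<phi>: "bij_betw \<phi> (carrier H) B"
    using finite_same_card_bij[OF assms(2)] by metis
  let ?\<psi> = "inv_into (carrier H) \<phi>"
  let ?G = "\<lparr>carrier = B, mult = (\<lambda>x y. \<phi> (?\<psi> x \<otimes>\<^bsub>H\<^esub> ?\<psi> y)), one = \<phi> \<one>\<^bsub>H\<^esub>\<rparr>"
  have \<psi>: "?\<psi> (\<phi> x) = x" if "x \<in> carrier H" for x
    using \<phi> that bij_betw_inv_into_left by metis
  have \<psi>': "?\<psi> y \<in> carrier H" "\<phi> (?\<psi> y) = y" if "y \<in> B" for y
    using \<phi> that by (auto simp: bij_betw_def inv_into_into f_inv_into_f)
  have \<phi>B: "\<phi> x \<in> B" if "x \<in> carrier H" for x using \<phi> that by (auto simp: bij_betw_def)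
  have "group ?G"
  proof (rule groupI)
    fix x assume "x \<in> carrier ?G"
    then show "\<exists>y\<in>carrier ?G. y \<otimes>\<^bsub>?G\<^esub> x = \<one>\<^bsub>?G\<^esub>"
      using \<psi>' \<psi> \<phi>B by (intro bexI[of _ "\<phi> (inv\<^bsub>H\<^esub> ?\<psi> x)"]) auto
  qed (use \<psi> \<psi>' \<phi>B in \<open>auto simp: H.m_assoc\<close>)
  moreover have "\<phi> \<in> hom H ?G" using \<psi> \<phi>B by (auto simp: hom_def)
  ultimately show ?thesis using \<phi> by (intro exI[of _ ?G] exI[of _ \<phi>]) simp
qed

context free_profinite_group
begin

text \<open>Continuity into the discrete group \<open>H\<close> is recorded as openness of all
  preimages. A map that is trivial off a finite set converges to 1, because every normal subgroup
  contains the unit.\<close>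

lemma lift_finite_aux:
  fixes H :: "('h, 'n) monoid_scheme"
  assumes "group H" "finite (carrier H)"
    and "finite (UNIV :: 'a set set) \<Longrightarrow> card (carrier H) \<le> card (UNIV :: 'a set set)"
    and "f \<in> X \<rightarrow> carrier H" "finite {x \<in> X. f x \<noteq> \<one>\<^bsub>H\<^esub>}"
  shows "\<exists>h\<in>hom S H. (\<forall>x\<in>X. h x = f x) \<and> (\<forall>C. openin T {s \<in> carrier S. h s \<in> C})"
proof -
  interpret H: group H by fact
  obtain G :: "'a set monoid" and \<phi> where G: "group G" "\<phi> \<in> hom H G" "bij_betw \<phi> (carrier H) (carrier G)"
    using finite_group_on_infinite_type[OF assms(1,2), where 'b = "'a set"] assms(3) by blast
  interpret G: group G by fact
  interpret \<phi>: group_hom H G \<phi> by unfold_locales (rule G)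
  have finG: "finite (carrier G)" using bij_betw_finite[OF G(3)] assms(2) by simp
  let ?U = "discrete_topology (carrier G)"
  have "converges_to_one G ?U X (\<phi> \<circ> f)"
    unfolding converges_to_one_def
  proof (intro allI impI)
    fix N assume "N \<lhd> G \<and> openin ?U N"
    then have "\<one>\<^bsub>G\<^esub> \<in> N" using subgroup.one_closed[of N G] normal_imp_subgroup by blast
    then have "{x \<in> X. (\<phi> \<circ> f) x \<notin> N} \<subseteq> {x \<in> X. f x \<noteq> \<one>\<^bsub>H\<^esub>}" by auto
    then show "finite {x \<in> X. (\<phi> \<circ> f) x \<notin> N}" using assms(5) finite_subset by blast
  qed
  moreover have "\<phi> \<circ> f \<in> X \<rightarrow> carrier G" using assms(4) \<phi>.hom_closed by (simp add: Pi_iff)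
  ultimately obtain k where k: "k \<in> hom S G" "continuous_map T ?U k" "\<forall>x\<in>X. k x = (\<phi> \<circ> f) x"
    using universal[OF profinite_group_discrete[OF G(1) finG]] by metis
  let ?\<psi> = "inv_into (carrier H) \<phi>"
  have "\<phi> \<in> iso H G" using G by (simp add: iso_def)
  then have "?\<psi> \<in> iso G H" by (rule H.iso_set_sym)
  then have "?\<psi> \<circ> k \<in> hom S H" by (auto simp: iso_def intro: Group.hom_compose[OF k(1)])
  moreover have "\<forall>x\<in>X. (?\<psi> \<circ> k) x = f x"
    using k(3) assms(4) bij_betw_inv_into_left[OF G(3)] by auto
  moreover have "openin T {s \<in> carrier S. (?\<psi> \<circ> k) s \<in> C}" for C
  proof -
    have "openin ?U {g \<in> carrier G. ?\<psi> g \<in> C}" by auto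
    then have "openin T {s \<in> topspace T. k s \<in> {g \<in> carrier G. ?\<psi> g \<in> C}}"
      using k(2) openin_continuous_map_preimage by blast
    moreover have "{s \<in> topspace T. k s \<in> {g \<in> carrier G. ?\<psi> g \<in> C}} = {s \<in> carrier S. (?\<psi> \<circ> k) s \<in> C}"
      using hom_in_carrier[OF k(1)] by (auto simp: topspace_eq)
    ultimately show ?thesis by simp
  qed
  ultimately show ?thesis by blast
qed

lemma infinite_carrier_type:
  assumes "X \<noteq> {}"
  shows "infinite (UNIV :: 'a set)"
proof
  assume fin: "finite (UNIV :: 'a set)"
  \<comment> \<open>The largest order that still fits on the type of sets; it exceeds the number of
    elements that \<open>S\<close> could have.\<close>
  define m where "m = card (UNIV :: 'a set set)"
  have m: "m = 2 ^ card (UNIV :: 'a set)" unfolding m_def using card_Pow[OF fin] by simp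
  let ?H = "integer_mod_group m"
  have mpos: "m > 0" using m by simp
  have carr: "carrier ?H = {0..<int m}" using mpos by (simp add: carrier_integer_mod_group)
  have m1: "m > 1" using m finite_UNIV_card_ge_0[OF fin] by (simp add: one_less_power del: One_nat_def)
  obtain x where x: "x \<in> X" using assms by blast
  let ?f = "\<lambda>z. if z = x then 1 else (0::int)"
  obtain h where h: "h \<in> hom S ?H" "\<forall>x\<in>X. h x = ?f x"
  proof -
    have "?f \<in> X \<rightarrow> carrier ?H" using carr m1 by auto
    moreover have "finite {z \<in> X. ?f z \<noteq> \<one>\<^bsub>?H\<^esub>}"
      by (rule finite_subset[of _ "{x}"]) auto
    moreover have "finite (carrier ?H)" "card (carrier ?H) \<le> card (UNIV :: 'a set set)"
      by (simp add: carr, simp only: carr, simp add: m_def)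
    ultimately show ?thesis using lift_finite_aux[OF group_integer_mod_group, of m ?f] that by blast
  qed
  interpret h: group_hom S ?H h
    by (intro group_hom.intro group_hom_axioms.intro is_group group_integer_mod_group h(1))
  have "carrier ?H \<subseteq> h ` carrier S"
  proof
    fix k assume k: "k \<in> carrier ?H"
    have hx: "h x = 1" using h(2) x by simp
    have xS: "x \<in> carrier S" using x basis_subset by blast
    have "h (x [^]\<^bsub>S\<^esub> nat k) = 1 [^]\<^bsub>?H\<^esub> nat k" using xS hx by (simp add: h.hom_nat_pow)
    also have "\<dots> = k" using k carr by (simp add: pow_integer_mod_group)
    finally show "k \<in> h ` carrier S" using xS by (metis imageI nat_pow_closed)
  qed
  then have "card (carrier ?H) \<le> card (h ` carrier S)"
    by (rule card_mono[rotated]) (meson fin finite_imageI finite_subset subset_UNIV)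
  also have "\<dots> \<le> card (carrier S)" by (meson card_image_le fin finite_subset subset_UNIV)
  also have "\<dots> \<le> card (UNIV :: 'a set)" by (rule card_mono[OF fin]) simp
  finally have "m \<le> card (UNIV :: 'a set)" using carr by simp
  then show False using m by (metis less_exp not_le)
qed

lemma lift_finite:
  fixes H :: "('h, 'n) monoid_scheme"
  assumes "X \<noteq> {}" "group H" "finite (carrier H)"
    and "f \<in> X \<rightarrow> carrier H" "finite {x \<in> X. f x \<noteq> \<one>\<^bsub>H\<^esub>}"
  shows "\<exists>h\<in>hom S H. (\<forall>x\<in>X. h x = f x) \<and> (\<forall>C. openin T {s \<in> carrier S. h s \<in> C})"
proof (rule lift_finite_aux)
  show "card (carrier H) \<le> card (UNIV :: 'a set set)" if "finite (UNIV :: 'a set set)"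
    using that infinite_carrier_type[OF assms(1)] by (simp add: Finite_Set.finite_set)
qed (use assms in auto)

end

section \<open>The index of the filtration\<close>

lemma geometric_sum_mult:
  fixes v :: "'r::ring_1"
  shows "(\<Sum>k<m. v ^ k) * (1 - v) = 1 - v ^ m"
proof (induction m)
  case (Suc m)
  have "(\<Sum>k<Suc m. v ^ k) * (1 - v) = (\<Sum>k<m. v ^ k) * (1 - v) + v ^ m * (1 - v)"
    by (simp add: distrib_right)
  then show ?case unfolding Suc by (simp add: right_diff_distrib power_Suc2 del: power_Suc)
qed simp

text \<open>For \<open>m = p\<close> and \<open>u\<close> of degree \<open>k >= 1\<close>, the
  linear term gains a degree from the factor \<open>p\<close>, and the remainder has degree at least
  \<open>2 k >= k + 1\<close>.\<close>

lemma one_plus_power_quadratic: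
  fixes u :: "'r::ring_1"
  shows "\<exists>r. (1 + u) ^ m = 1 + of_nat m * u + u * u * r"
proof (induction m)
  case (Suc m)
  then obtain r where r: "(1 + u) ^ m = 1 + of_nat m * u + u * u * r" by blast
  have "(1 + u) ^ Suc m = (1 + u) ^ m * (1 + u)" by (simp only: power_Suc2)
  also have "\<dots> = 1 + of_nat (Suc m) * u + (of_nat m * (u * u) + u * u * r * (1 + u))"
    unfolding r by (simp add: algebra_simps)
  also have "of_nat m * (u * u) = u * u * of_nat m" by (simp add: mult_of_nat_commute)
  finally show ?case by (auto simp: distrib_left mult.assoc intro!: exI[of _ "of_nat m + r * (1 + u)"])
qed (auto intro: exI[of _ 0])

text \<open>The geometric series in \<open>1 - f\<close>, cut off after \<open>n + 1\<close> terms;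
  the power left over has degree \<open>n + 1\<close>.\<close>

lemma nc_filt_inverse:
  assumes "f - 1 \<in> nc_filt p X 1"
  shows "\<exists>g. g - 1 \<in> nc_filt p X 1 \<and> g * f - 1 \<in> nc_filt p X (Suc n)"
proof -
  let ?v = "1 - f"
  let ?g = "\<Sum>k<Suc n. ?v ^ k"
  have v: "?v \<in> nc_filt p X 1" using nc_filt_closed(4)[OF assms] by simp
  have "?g - 1 = (\<Sum>k<n. ?v ^ Suc k)" by (subst sum.lessThan_Suc_shift) simp
  moreover have "?v ^ Suc k \<in> nc_filt p X 1" for k
    using nc_filt_mult_right[OF v] by simp
  ultimately have "?g - 1 \<in> nc_filt p X 1" by (simp only: nc_filt_sum)
  moreover have "?g * f - 1 \<in> nc_filt p X (Suc n)"
    using geometric_sum_mult[of ?v "Suc n"] nc_filt_closed(4)[OF nc_filt_power[OF v, of "Suc n"]]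
    by (simp del: power_Suc sum.lessThan_Suc)
  ultimately show ?thesis by blast
qed

text \<open>The units congruent to 1 modulo the ideal \<open>(p, X)\<close>, in the ring truncated
  at degree \<open>n + 1\<close>, carried by canonical representatives. The unit is written in
  reduced form because for \<open>p = 1\<close> it is not literally 1.\<close>

definition magnus_group :: "nat \<Rightarrow> 'a set \<Rightarrow> nat \<Rightarrow> 'a ncps monoid" where
  "magnus_group p X n = \<lparr>carrier = {f. nc_red p X (Suc n) f = f \<and> f - 1 \<in> nc_filt p X 1},
     mult = (\<lambda>f g. nc_red p X (Suc n) (f * g)), one = nc_red p X (Suc n) 1\<rparr>"

lemma nc_filt_mult_minus_one:
  assumes "f - 1 \<in> nc_filt p X k" "g - 1 \<in> nc_filt p X k"
  shows "f * g - 1 \<in> nc_filt p X k"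
proof -
  have "f * g - 1 = (f - 1) * g + (g - 1)" by (simp add: algebra_simps)
  then show ?thesis using nc_filt_mult_right[OF assms(1)] assms(2) nc_filt_closed by metis
qed

lemma nc_red_carrier:
  "f - 1 \<in> nc_filt p X 1 \<Longrightarrow> nc_red p X (Suc n) f \<in> carrier (magnus_group p X n)"
  by (simp add: magnus_group_def nc_red_one_plus)

lemma group_magnus_group: "group (magnus_group p X n)"
proof (rule groupI)
  fix f g assume "f \<in> carrier (magnus_group p X n)" "g \<in> carrier (magnus_group p X n)"
  then show "f \<otimes>\<^bsub>magnus_group p X n\<^esub> g \<in> carrier (magnus_group p X n)"
    using nc_red_carrier[OF nc_filt_mult_minus_one, of f p X g n] by (simp add: magnus_group_def)
next
  show "\<one>\<^bsub>magnus_group p X n\<^esub> \<in> carrier (magnus_group p X n)"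
    using nc_red_carrier[of 1 p X n] nc_filt_closed(1)[of p X 1] by (simp add: magnus_group_def)
next
  fix f assume f: "f \<in> carrier (magnus_group p X n)"
  then obtain g where g: "g - 1 \<in> nc_filt p X 1" "g * f - 1 \<in> nc_filt p X (Suc n)"
    using nc_filt_inverse by (fastforce simp: magnus_group_def)
  have "nc_red p X (Suc n) g \<otimes>\<^bsub>magnus_group p X n\<^esub> f = \<one>\<^bsub>magnus_group p X n\<^esub>"
    using g(2) by (simp add: magnus_group_def nc_red_eq_iff)
  then show "\<exists>g\<in>carrier (magnus_group p X n). g \<otimes>\<^bsub>magnus_group p X n\<^esub> f = \<one>\<^bsub>magnus_group p X n\<^esub>"
    using nc_red_carrier[OF g(1)] by blast
qed (auto simp: magnus_group_def mult.assoc)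

lemma finite_magnus_group:
  assumes "0 < p" "finite X" shows "finite (carrier (magnus_group p X n))"
proof (rule finite_subset[OF _ card_range_nc_red(2)[OF assms]])
  show "carrier (magnus_group p X n) \<subseteq> range (nc_red p X (Suc n))"
    by (auto simp: magnus_group_def) (metis rangeI)
qed

lemma magnus_group_pow:
  assumes "f \<in> carrier (magnus_group p X n)"
  shows "f [^]\<^bsub>magnus_group p X n\<^esub> k = nc_red p X (Suc n) (f ^ k)"
proof (induction k)
  case (Suc k)
  interpret group "magnus_group p X n" by (rule group_magnus_group)
  have "f [^]\<^bsub>magnus_group p X n\<^esub> Suc k = nc_red p X (Suc n) (f [^]\<^bsub>magnus_group p X n\<^esub> k * f)"
    by (simp add: magnus_group_def)
  then show ?case unfolding Suc by (simp add: power_Suc2 del: power_Suc nat_pow_Suc)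
qed (simp add: magnus_group_def)

lemma magnus_group_powprod:
  assumes "set ys \<subseteq> carrier (magnus_group p X n)"
  shows "powprod (magnus_group p X n) ys as = nc_red p X (Suc n) (ncprod ys as)"
  using assms
proof (induction ys arbitrary: as)
  case (Cons y ys)
  then show ?case
    using magnus_group_pow[of y p X n] by (cases as) (simp_all add: magnus_group_def)
qed (simp add: magnus_group_def)

definition magnus_filt :: "nat \<Rightarrow> 'a set \<Rightarrow> nat \<Rightarrow> nat \<Rightarrow> 'a ncps set" where
  "magnus_filt p X n k = {f \<in> carrier (magnus_group p X n). f - 1 \<in> nc_filt p X k}"

lemma subgroup_magnus_filt:
  assumes "k \<le> Suc n"
  shows "subgroup (magnus_filt p X n k) (magnus_group p X n)"
proof -
  interpret M: group "magnus_group p X n" by (rule group_magnus_group)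
  show ?thesis
  proof (rule M.subgroupI)
    have "\<one>\<^bsub>magnus_group p X n\<^esub> \<in> magnus_filt p X n k"
      using M.one_closed nc_filt_antimono[OF assms] nc_red_diff[of p X "Suc n" 1]
      by (auto simp: magnus_filt_def magnus_group_def)
    then show "magnus_filt p X n k \<noteq> {}" by blast
  next
    fix f assume f: "f \<in> magnus_filt p X n k"
    let ?g = "inv\<^bsub>magnus_group p X n\<^esub> f"
    have fM: "f \<in> carrier (magnus_group p X n)" using f by (simp add: magnus_filt_def)
    then have "nc_red p X (Suc n) (f * ?g) = nc_red p X (Suc n) 1"
      using M.r_inv[OF fM] by (simp add: magnus_group_def)
    then have "f * ?g - 1 \<in> nc_filt p X k"
      using nc_filt_antimono[OF assms] by (auto simp: nc_red_eq_iff)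
    moreover have "(f - 1) * ?g \<in> nc_filt p X k"
      using f nc_filt_mult_right by (auto simp: magnus_filt_def)
    ultimately have "(f * ?g - 1) - (f - 1) * ?g \<in> nc_filt p X k" by blast
    then have "?g - 1 \<in> nc_filt p X k" by (simp add: algebra_simps)
    then show "?g \<in> magnus_filt p X n k" using fM by (simp add: magnus_filt_def)
  next
    fix f g assume fg: "f \<in> magnus_filt p X n k" "g \<in> magnus_filt p X n k"
    then have "nc_red p X (Suc n) (f * g) - 1 \<in> nc_filt p X k"
      using assms by (intro nc_red_one_plus nc_filt_mult_minus_one) (auto simp: magnus_filt_def)
    moreover have "f \<otimes>\<^bsub>magnus_group p X n\<^esub> g \<in> carrier (magnus_group p X n)"
      using fg by (intro M.m_closed) (auto simp: magnus_filt_def)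
    ultimately show "f \<otimes>\<^bsub>magnus_group p X n\<^esub> g \<in> magnus_filt p X n k"
      by (simp add: magnus_filt_def magnus_group_def)
  qed (auto simp: magnus_filt_def)
qed

lemma magnus_filt_power:
  assumes "1 \<le> k" "k \<le> n" "f \<in> magnus_filt p X n k"
  shows "f [^]\<^bsub>magnus_group p X n\<^esub> p \<in> magnus_filt p X n (Suc k)"
proof -
  interpret M: group "magnus_group p X n" by (rule group_magnus_group)
  have f: "f \<in> carrier (magnus_group p X n)" "f - 1 \<in> nc_filt p X k"
    using assms(3) by (auto simp: magnus_filt_def)
  obtain r where r: "f ^ p = 1 + of_nat p * (f - 1) + (f - 1) * (f - 1) * r"
    using one_plus_power_quadratic[of "f - 1" p] by auto
  have "of_nat p * (f - 1) \<in> nc_filt p X (1 + k)"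
    using nc_filt_mult[OF nc_filt_of_nat[of p 1 X] f(2)] by simp
  moreover have "(f - 1) * (f - 1) * r \<in> nc_filt p X (1 + k)"
    using nc_filt_mult_right[OF nc_filt_mult[OF f(2) f(2)], of r] nc_filt_antimono[of "1 + k" "k + k" p X] assms(1)
    by auto
  ultimately have "f ^ p - 1 \<in> nc_filt p X (Suc k)"
    unfolding r using nc_filt_closed(2) by fastforce
  then have "nc_red p X (Suc n) (f ^ p) - 1 \<in> nc_filt p X (Suc k)"
    by (rule nc_red_one_plus) (use assms in simp)
  then show ?thesis
    using f M.nat_pow_closed[OF f(1), of p] by (simp add: magnus_filt_def magnus_group_pow[OF f(1)])
qed

text \<open>For the commutator \<open>c\<close>, up to degree \<open>n + 1\<close>,
  \<open>f g (c - 1) = g f - f g = (g - 1)(f - 1) - (f - 1)(g - 1)\<close>, which has degree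
  \<open>k + 1\<close>. The factor \<open>f g\<close> is then cancelled by an approximate
  inverse.\<close>

lemma magnus_filt_commutator:
  assumes "1 \<le> k" "k \<le> n" "g \<in> carrier (magnus_group p X n)" "f \<in> magnus_filt p X n k"
  shows "commutator (magnus_group p X n) g f \<in> magnus_filt p X n (Suc k)"
proof -
  interpret M: group "magnus_group p X n" by (rule group_magnus_group)
  let ?F = "nc_filt p X (Suc k)"
  let ?c = "commutator (magnus_group p X n) g f"
  have f: "f \<in> carrier (magnus_group p X n)" "f - 1 \<in> nc_filt p X k" "f - 1 \<in> nc_filt p X 1"
    and g: "g - 1 \<in> nc_filt p X 1"
    using assms by (auto simp: magnus_filt_def magnus_group_def)
  have F: "x \<in> ?F" if "x \<in> nc_filt p X (Suc n)" for x
    using that nc_filt_antimono[of "Suc k" "Suc n" p X] assms(2) by auto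
  have "nc_red p X (Suc n) (g * f) = nc_red p X (Suc n) (f * g * ?c)"
    using M.mult_commutator[OF assms(3) f(1)] by (simp add: magnus_group_def)
  then have "g * f - f * g * ?c \<in> ?F" using F by (simp add: nc_red_eq_iff)
  moreover have "(g - 1) * (f - 1) - (f - 1) * (g - 1) \<in> ?F"
    using nc_filt_mult[OF g f(2)] nc_filt_mult[OF f(2) g] by (intro nc_filt_closed) auto
  ultimately have "((g - 1) * (f - 1) - (f - 1) * (g - 1)) - (g * f - f * g * ?c) \<in> ?F" by blast
  then have 1: "f * g * (?c - 1) \<in> ?F" by (simp add: algebra_simps)
  obtain e where e: "e * (f * g) - 1 \<in> nc_filt p X (Suc n)"
    using nc_filt_inverse[OF nc_filt_mult_minus_one[OF f(3) g]] by blast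
  have "e * (f * g * (?c - 1)) - (e * (f * g) - 1) * (?c - 1) \<in> ?F"
    using nc_filt_mult_left[OF 1] nc_filt_mult_right[OF F[OF e]] by blast
  then have "?c - 1 \<in> ?F" by (simp add: algebra_simps)
  then show ?thesis using assms(3) f(1) by (simp add: magnus_filt_def)
qed

lemma (in group_hom) hom_commutator:
  "x \<in> carrier G \<Longrightarrow> y \<in> carrier G \<Longrightarrow> h (commutator G x y) = commutator H (h x) (h y)"
  by (simp add: commutator_def)

lemma (in profinite_group) closedin_hom_preimage:
  assumes "\<And>C. openin T {s \<in> carrier G. h s \<in> C}"
  shows "closedin T {s \<in> carrier G. h s \<in> C}"
proof -
  have "{s \<in> carrier G. h s \<in> C} = topspace T - {s \<in> carrier G. h s \<in> - C}"
    using topspace_eq by auto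
  moreover have "openin T {s \<in> carrier G. h s \<in> - C}" by (rule assms)
  ultimately show ?thesis by (simp only: closedin_diff closedin_topspace)
qed

text \<open>By induction the preimage of each \<open>F k\<close> is a closed subgroup containing the
  generators of the corresponding term. It serves for the Magnus group and for the cyclic groups of
  order \<open>p^m\<close>.\<close>

lemma (in profinite_group) lpc_hom_image:
  assumes H: "group H" and h: "h \<in> hom G H" and op: "\<And>C. openin T {s \<in> carrier G. h s \<in> C}"
    and F1: "F 1 = carrier H" and F: "\<And>k. 1 \<le> k \<Longrightarrow> k \<le> m \<Longrightarrow> subgroup (F k) H"
    and pow: "\<And>k x. 1 \<le> k \<Longrightarrow> k < m \<Longrightarrow> x \<in> F k \<Longrightarrow> x [^]\<^bsub>H\<^esub> p \<in> F (Suc k)"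
    and comm: "\<And>k g x. 1 \<le> k \<Longrightarrow> k < m \<Longrightarrow> g \<in> carrier H \<Longrightarrow> x \<in> F k \<Longrightarrow> commutator H g x \<in> F (Suc k)"
    and k: "1 \<le> k" "k \<le> m"
  shows "s \<in> lpc p k \<Longrightarrow> h s \<in> F k"
  using k
proof (induction k arbitrary: s rule: nat_induct_at_least)
  case base
  then show ?case using hom_in_carrier[OF h] by (simp add: F1[unfolded One_nat_def])
next
  case (Suc k)
  interpret h: group_hom G H h by (intro group_hom.intro group_hom_axioms.intro is_group H h)
  let ?C = "{s \<in> carrier G. h s \<in> F (Suc k)}"
  have "lpc p (Suc k) \<subseteq> ?C"
  proof (rule lpc_minimal)
    interpret F: subgroup "F (Suc k)" H by (rule F) (use Suc in auto)
    show "subgroup ?C G" by (rule subgroupI) auto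
    show "closedin T ?C" using op by (rule closedin_hom_preimage)
  next
    fix x assume x: "x \<in> lpc p k"
    then have "h x \<in> F k" using Suc by simp
    then show "x [^] p \<in> ?C"
      using x lpc_closed Suc pow[of k "h x"] by (simp add: h.hom_nat_pow)
    fix g assume "g \<in> carrier G"
    then show "commutator G g x \<in> ?C"
      using x lpc_closed[OF x] Suc comm[of k "h g" "h x"] \<open>h x \<in> F k\<close> by (simp add: h.hom_commutator)
  qed (use Suc in auto)
  then show ?case using Suc.prems by blast
qed

lemma card_exponents: "card (exponents p n ws) = (\<Prod>w\<leftarrow>ws. p ^ (Suc n - w))"
  and finite_exponents: "finite (exponents p n ws)"
proof (induction ws)
  case (Cons w ws)
  have eq: "exponents p n (w # ws) = (\<lambda>(a, as). a # as) ` ({..<p ^ (Suc n - w)} \<times> exponents p n ws)"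
    by (auto simp: exponents_Cons)
  have inj: "inj_on (\<lambda>(a, as). a # as) ({..<p ^ (Suc n - w)} \<times> exponents p n ws)"
    by (auto simp: inj_on_def)
  { case 1 show ?case unfolding eq card_image[OF inj] using Cons by simp }
  { case 2 show ?case unfolding eq using Cons by simp }
qed simp_all

lemma (in group_hom) hom_powprod:
  "set ys \<subseteq> carrier G \<Longrightarrow> h (powprod G ys as) = powprod H (map h ys) as"
proof (induction ys arbitrary: as)
  case (Cons y ys)
  then show ?case by (cases as) (simp_all add: hom_nat_pow)
qed simp

lemma (in free_profinite_group) lpc_index:
  assumes p: "0 < p" and X: "X \<noteq> {}" "finite X"
  shows "\<exists>ws. (\<forall>w\<in>set ws. 1 \<le> w \<and> w \<le> n) \<and>
    fps_agree n (weight_fps ws) (1 - fps_const (int (card X)) * fps_X) \<and>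
    finite (carrier (S Mod lpc p (Suc n))) \<and>
    card (carrier (S Mod lpc p (Suc n))) = (\<Prod>w\<leftarrow>ws. p ^ (Suc n - w))"
proof -
  let ?N = "lpc p (Suc n)"
  let ?M = "magnus_group p X n"
  interpret lpc: central_filtration S "lpc p" p using p by (rule central_filtration_lpc)
  interpret N: normal ?N S by (rule normal_lpc)
  obtain xs where xs: "distinct xs" "set xs = X" using finite_distinct_list[OF X(2)] by blast
  \<comment> \<open>All basis elements start with weight 1, which makes the initial series
    \<open>m z\<close>.\<close>
  let ?Z = "map (\<lambda>x. (x, 1)) xs"
  have "sum_fps ?Z = fps_const (int (length xs)) * fps_X"
    by (induction xs) (simp_all add: algebra_simps flip: fps_const_add)
  then have sum: "sum_fps ?Z = fps_const (int (card X)) * fps_X" using xs distinct_card by metis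
  have Z: "\<forall>(z, v)\<in>set ?Z. z \<in> lpc p v \<and> 1 \<le> v" using xs basis_subset by auto
  have fstZ: "fst ` set ?Z = X" using xs by force
  obtain ys ws where ys: "list_all2 (\<lambda>y w. y \<in> lpc p w) ys ws" and ws: "\<forall>w\<in>set ws. 1 \<le> w \<and> w \<le> n"
    and agree: "fps_agree n (weight_fps ws) (1 - fps_const (int (card X)) * fps_X)"
    and gen: "\<forall>g\<in>generate S (X \<union> ?N). \<exists>as\<in>exponents p n ws. \<exists>\<nu>\<in>?N. g = powprod S ys as \<otimes> \<nu>"
    using lpc.elimination[OF Z, of n] unfolding sum fstZ by blast
  have ysS: "set ys \<subseteq> carrier S"
    using ys by (induction rule: list_all2_induct) (auto intro: lpc_closed)
  let ?K = "generate S (X \<union> ?N)"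
  \<comment> \<open>The products are intersected with \<open>?K\<close>, since elimination does not
    say that the \<open>ys\<close> lie in the subgroup generated by \<open>X\<close> and
    \<open>?N\<close>.\<close>
  let ?R = "powprod S ys ` exponents p n ws \<inter> ?K"
  have sub: "X \<union> ?N \<subseteq> carrier S" using basis_subset lpc_subset by blast
  have K: "subgroup ?K S" by (rule generate_is_subgroup[OF sub])
  have NK: "?N \<subseteq> ?K" by (auto intro: generate.incl)
  have K_eq: "?K = (\<Union>r\<in>?R. {s \<in> carrier S. inv r \<otimes> s \<in> ?N})"
  proof (intro equalityI subsetI)
    fix g assume g: "g \<in> ?K"
    then obtain as \<nu> where as: "as \<in> exponents p n ws" "\<nu> \<in> ?N" "g = powprod S ys as \<otimes> \<nu>" using gen by blast
    let ?r = "powprod S ys as"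
    have cl: "?r \<in> carrier S" "\<nu> \<in> carrier S" using ysS lpc_closed[OF as(2)] by auto
    have "?r = g \<otimes> inv \<nu>" using as cl by (simp add: m_assoc)
    then have "?r \<in> ?K" using g as(2) NK subgroup.m_closed[OF K] subgroup.m_inv_closed[OF K] by auto
    moreover have "inv ?r \<otimes> g \<in> ?N" using as cl by (simp add: m_assoc[symmetric])
    ultimately show "g \<in> (\<Union>r\<in>?R. {s \<in> carrier S. inv r \<otimes> s \<in> ?N})"
      using as(1) cl as(3) by auto
  next
    fix g assume "g \<in> (\<Union>r\<in>?R. {s \<in> carrier S. inv r \<otimes> s \<in> ?N})"
    then obtain r where r: "r \<in> ?K" "g \<in> carrier S" "inv r \<otimes> g \<in> ?N" by blast
    have rS: "r \<in> carrier S" using r(1) subgroup.mem_carrier[OF K] by blast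
    have "r \<otimes> (inv r \<otimes> g) \<in> ?K" by (rule subgroup.m_closed[OF K r(1) subsetD[OF NK r(3)]])
    then show "g \<in> ?K" using rS r(2) by (simp add: m_assoc[symmetric])
  qed
  \<comment> \<open>A finite union of cosets of the closed subgroup \<open>?N\<close> is closed.
    Hence \<open>X\<close> generates \<open>S\<close> abstractly modulo \<open>?N\<close>, and the
    decomposition reaches every element of \<open>S\<close>.\<close>
  have "closedin T ?K"
  proof (subst K_eq, rule closedin_Union[OF finite_imageI])
    show "finite ?R" using finite_exponents by auto
    fix A assume "A \<in> (\<lambda>r. {s \<in> carrier S. inv r \<otimes> s \<in> ?N}) ` ?R"
    then obtain r where r: "r \<in> carrier S" "A = {s \<in> carrier S. inv r \<otimes> s \<in> ?N}"
      using subgroup.mem_carrier[OF K] by auto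
    show "closedin T A"
      unfolding r(2) by (intro closedin_preimage continuous_map_mult closedin_lpc continuous_map_constant
          continuous_map_ident) (use r in simp)
  qed
  then have "closed_generate S T X \<subseteq> ?K"
    by (intro closed_generate_minimal K) (auto intro: generate.incl)
  then have K_all: "carrier S \<subseteq> ?K" using basis_generates by simp
  have dec: "\<exists>as\<in>exponents p n ws. \<exists>\<nu>\<in>?N. s = powprod S ys as \<otimes> \<nu>" if "s \<in> carrier S" for s
    using gen K_all that by blast
  have cosets: "carrier (S Mod ?N) = (\<lambda>as. ?N #> powprod S ys as) ` exponents p n ws"
  proof (intro equalityI subsetI)
    fix c assume "c \<in> carrier (S Mod ?N)"
    then obtain s where s: "s \<in> carrier S" "c = ?N #> s" by (auto simp: FactGroup_def RCOSETS_def)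
    then obtain as \<nu> where as: "as \<in> exponents p n ws" "\<nu> \<in> ?N" "s = powprod S ys as \<otimes> \<nu>"
      using dec by blast
    let ?r = "powprod S ys as"
    have cl: "?r \<in> carrier S" "\<nu> \<in> carrier S" using ysS lpc_closed[OF as(2)] by auto
    have "?N #> s = (?N #> ?r) <#> (?N #> \<nu>)" using cl as by (simp add: N.rcos_sum)
    also have "?N #> \<nu> = ?N" by (rule coset_join2[OF cl(2) subgroup_lpc as(2)])
    also have "(?N #> ?r) <#> ?N = ?N #> ?r"
      using N.rcos_sum[OF cl(1) one_closed] cl lpc_subset by (simp add: coset_mult_one)
    finally show "c \<in> (\<lambda>as. ?N #> powprod S ys as) ` exponents p n ws" using as s by blast
  next
    fix c assume "c \<in> (\<lambda>as. ?N #> powprod S ys as) ` exponents p n ws"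
    then show "c \<in> carrier (S Mod ?N)" using ysS by (auto simp: FactGroup_def RCOSETS_def)
  qed
  \<comment> \<open>For finite \<open>X\<close> the target is a finite group and convergence to 1 is
    automatic, so the Magnus map extends to \<open>S\<close>.\<close>
  have "(\<lambda>x. nc_red p X (Suc n) (1 + nc_word [x])) \<in> X \<rightarrow> carrier ?M"
  proof
    fix x assume "x \<in> X"
    show "nc_red p X (Suc n) (1 + nc_word [x]) \<in> carrier ?M"
      using nc_word_in_filt[of "[x]" p X] by (intro nc_red_carrier) simp
  qed
  from lift_finite[OF X(1) group_magnus_group finite_magnus_group[OF p X(2)] this] X(2)
  obtain h where h: "h \<in> hom S ?M" "\<And>x. x \<in> X \<Longrightarrow> h x = nc_red p X (Suc n) (1 + nc_word [x])"
    "\<And>C. openin T {s \<in> carrier S. h s \<in> C}"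
    by auto
  interpret h: group_hom S ?M h by (intro group_hom.intro group_hom_axioms.intro is_group group_magnus_group h)
  have hP: "h s \<in> magnus_filt p X n k" if "1 \<le> k" "k \<le> Suc n" "s \<in> lpc p k" for s k
    by (rule lpc_hom_image[where m = "Suc n", OF group_magnus_group h(1,3) _ _ _ _ that(1,2,3)])
      (auto simp: subgroup_magnus_filt magnus_filt_power magnus_filt_commutator,
       auto simp: magnus_filt_def magnus_group_def)
  have hN: "h s = \<one>\<^bsub>?M\<^esub>" if "s \<in> ?N" for s
    using hP[OF _ _ that] by (auto simp: magnus_filt_def magnus_group_def nc_red_eq_iff[symmetric])
  have hys: "set (map h ys) \<subseteq> carrier ?M" using ysS by auto
  have hpow: "h (powprod S ys as) = nc_red p X (Suc n) (ncprod (map h ys) as)" for as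
    using h.hom_powprod[OF ysS] magnus_group_powprod[OF hys] by simp
  have inj: "inj_on (\<lambda>as. ?N #> powprod S ys as) (exponents p n ws)"
  proof (rule inj_onI)
    fix as bs assume as: "as \<in> exponents p n ws" and bs: "bs \<in> exponents p n ws"
      and eq: "?N #> powprod S ys as = ?N #> powprod S ys bs"
    have cl: "powprod S ys as \<in> carrier S" "powprod S ys bs \<in> carrier S" using ysS by auto
    have "powprod S ys as \<in> ?N #> powprod S ys bs"
      using rcos_self[OF cl(1) subgroup_lpc, of p "Suc n"] eq by simp
    then obtain \<nu> where "\<nu> \<in> ?N" "powprod S ys as = \<nu> \<otimes> powprod S ys bs" by (auto simp: r_coset_def)
    then have "h (powprod S ys as) = h (powprod S ys bs)" using cl hN lpc_closed by simp
    then have eq': "ncprod (map h ys) as - ncprod (map h ys) bs \<in> nc_filt p X (Suc n)"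
      by (simp add: hpow nc_red_eq_iff)
    show "as = bs"
    proof (rule ncprod_inj_on[OF p X(2) _ ws agree _ _ _ as bs eq', where \<Gamma> = "h ` carrier S"])
      have "list_all2 (\<lambda>y w. h y - 1 \<in> nc_filt p X w) ys ws"
        using ys ws
      proof (induction rule: list_all2_induct)
        case (Cons y ys w ws)
        then show ?case using hP[of w y] by (auto simp: magnus_filt_def)
      qed simp
      then show "list_all2 (\<lambda>y w. y - 1 \<in> nc_filt p X w) (map h ys) ws" by (simp add: list_all2_map1)
    next
      fix g assume "g \<in> h ` carrier S"
      then obtain s where s: "s \<in> carrier S" "g = h s" by blast
      then obtain as \<nu> where as: "as \<in> exponents p n ws" "\<nu> \<in> ?N" "s = powprod S ys as \<otimes> \<nu>" using dec by blast
      then have "g = h (powprod S ys as)" using s ysS hN lpc_closed[OF as(2)] by simp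
      then have "g - ncprod (map h ys) as \<in> nc_filt p X (Suc n)" by (simp add: hpow nc_red_diff)
      moreover have "length as = length ws" using as(1) by (auto simp: exponents_def dest: list_all2_lengthD)
      ultimately show "\<exists>as. length as = length ws \<and> g - ncprod (map h ys) as \<in> nc_filt p X (Suc n)" by blast
    next
      have "h \<one> - 1 \<in> nc_filt p X (Suc n)" using nc_red_diff[of p X "Suc n" 1] by (simp add: magnus_group_def)
      then show "\<exists>g\<in>h ` carrier S. g - 1 \<in> nc_filt p X (Suc n)" by blast
    next
      fix g x assume "g \<in> h ` carrier S" and x: "x \<in> X"
      then obtain s where s: "s \<in> carrier S" "g = h s" by blast
      have "x \<in> carrier S" using x basis_subset by blast
      then have "h (s \<otimes> x) = nc_red p X (Suc n) (g * (1 + nc_word [x]))"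
        using s h(2)[OF x] by (simp add: magnus_group_def)
      then have "h (s \<otimes> x) - g * (1 + nc_word [x]) \<in> nc_filt p X (Suc n)" by (simp only: nc_red_diff)
      then show "\<exists>h'\<in>h ` carrier S. h' - g * (1 + nc_word [x]) \<in> nc_filt p X (Suc n)"
        using s(1) \<open>x \<in> carrier S\<close> by blast
    qed
  qed
  have "card (carrier (S Mod ?N)) = (\<Prod>w\<leftarrow>ws. p ^ (Suc n - w))"
    unfolding cosets card_image[OF inj] by (rule card_exponents)
  moreover have "finite (carrier (S Mod ?N))" unfolding cosets using finite_exponents by blast
  ultimately show ?thesis using ws agree by blast
qed

section \<open>From the index of the terms to the order of a layer\<close>

lemma sum_list_weights:
  fixes f :: "nat \<Rightarrow> nat"
  assumes "\<forall>w\<in>set ws. 1 \<le> w \<and> w \<le> n"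
  shows "(\<Sum>w\<leftarrow>ws. f w) = (\<Sum>s = 1..n. count_list ws s * f s)"
proof -
  have "(\<Sum>w\<leftarrow>ws. f w) = (\<Sum>s\<in>set ws. count_list ws s * f s)"
    by (rule sum_list_map_eq_sum_count)
  also have "\<dots> = (\<Sum>s = 1..n. count_list ws s * f s)"
    using assms by (intro sum.mono_neutral_left) (auto simp: count_list_0_iff)
  finally show ?thesis .
qed

lemma prod_list_power: "(\<Prod>w\<leftarrow>ws. (b::nat) ^ f w) = b ^ (\<Sum>w\<leftarrow>ws. f w)"
  by (induction ws) (simp_all add: power_add)

lemma (in group) carrier_subgroup_Mod:
  "carrier (G\<lparr>carrier := M\<rparr> Mod N) = (\<lambda>x. N #> x) ` M"
  by (simp add: carrier_FactGroup r_coset_def)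

text \<open>Sending an \<open>N\<close>-coset to the \<open>M\<close>-coset that contains it has all
  fibres of the size of \<open>M / N\<close>, by right translation.\<close>

lemma (in group) card_Mod_Mod:
  assumes N: "N \<lhd> G" and M: "subgroup M G" and NM: "N \<subseteq> M" and fin: "finite (carrier (G Mod N))"
  shows "card (carrier (G Mod N)) = card (carrier (G Mod M)) * card (carrier (G\<lparr>carrier := M\<rparr> Mod N))"
    and "finite (carrier (G\<lparr>carrier := M\<rparr> Mod N))"
proof -
  interpret N: normal N G by fact
  have NG: "N \<subseteq> carrier G" and MG: "M \<subseteq> carrier G" using N.subset subgroup.subset[OF M] by auto
  have MN: "M <#> N = M"
  proof (intro equalityI subsetI)
    fix x assume "x \<in> M <#> N"
    then obtain m n where "m \<in> M" "n \<in> N" "x = m \<otimes> n" by (auto simp: set_mult_def)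
    then show "x \<in> M" using NM subgroup.m_closed[OF M] by auto
  next
    fix m assume m: "m \<in> M"
    then have "m = m \<otimes> \<one>" using MG by (simp add: subset_iff)
    then show "m \<in> M <#> N" unfolding set_mult_def using m N.one_closed by blast
  qed
  let ?A = "(\<lambda>x. N #> x) ` carrier G" and ?B = "(\<lambda>x. M #> x) ` carrier G"
  let ?f = "\<lambda>c. M <#> c"
  have f: "?f (N #> x) = M #> x" if "x \<in> carrier G" for x
    using setmult_rcos_assoc[OF MG NG that] MN by simp
  have finA: "finite ?A" using fin by (simp add: carrier_FactGroup)
  have fA: "?f ` ?A = ?B" using f by (auto simp: image_image cong: image_cong)
  have finB: "finite ?B" unfolding fA[symmetric] using finA by blast
  show finM: "finite (carrier (G\<lparr>carrier := M\<rparr> Mod N))"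
    unfolding carrier_subgroup_Mod by (rule finite_subset[OF image_mono[OF MG] finA])
  have fiber: "card {c \<in> ?A. ?f c = d} = card ((\<lambda>x. N #> x) ` M)" if "d \<in> ?B" for d
  proof -
    obtain g where g: "g \<in> carrier G" "d = M #> g" using \<open>d \<in> ?B\<close> by blast
    have inj: "inj_on (\<lambda>c. c #> g) ((\<lambda>x. N #> x) ` M)"
    proof (rule inj_on_inverseI[where g = "\<lambda>c. c #> inv g"])
      fix c assume "c \<in> (\<lambda>x. N #> x) ` M"
      then obtain x where x: "x \<in> carrier G" "c = N #> x" using MG by blast
      then show "c #> g #> inv g = c" using g NG by (simp add: coset_mult_assoc m_assoc)
    qed
    have "{c \<in> ?A. ?f c = d} = (\<lambda>c. c #> g) ` (\<lambda>x. N #> x) ` M"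
    proof (intro equalityI subsetI)
      fix c assume "c \<in> {c \<in> ?A. ?f c = d}"
      then obtain x where x: "x \<in> carrier G" "c = N #> x" "M #> x = M #> g" using f g by auto
      then have "x \<in> M #> g" using rcos_self[OF x(1) M] by simp
      then obtain m where m: "m \<in> M" "x = m \<otimes> g" by (auto simp: r_coset_def)
      then have "c = (N #> m) #> g" using x g NG MG by (simp add: coset_mult_assoc subset_iff)
      then show "c \<in> (\<lambda>c. c #> g) ` (\<lambda>x. N #> x) ` M" using m by blast
    next
      fix c assume "c \<in> (\<lambda>c. c #> g) ` (\<lambda>x. N #> x) ` M"
      then obtain m where m: "m \<in> M" "c = (N #> m) #> g" by blast
      have mG: "m \<in> carrier G" using m MG by blast
      have c: "c = N #> (m \<otimes> g)" using m mG g NG by (simp add: coset_mult_assoc)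
      have "M #> (m \<otimes> g) = M #> m #> g" using MG mG g by (simp add: coset_mult_assoc)
      also have "M #> m = M" by (rule coset_join2[OF mG M m(1)])
      finally show "c \<in> {c \<in> ?A. ?f c = d}" using c f[of "m \<otimes> g"] g mG by auto
    qed
    then show ?thesis using card_image[OF inj] by simp
  qed
  have "card ?A = (\<Sum>d\<in>?B. card {c \<in> ?A. ?f c = d})"
    using sum.group[OF finA finB, of ?f "\<lambda>_. 1 :: nat"] fA by simp
  also have "\<dots> = card ?B * card ((\<lambda>x. N #> x) ` M)" using fiber by simp
  finally show "card (carrier (G Mod N)) = card (carrier (G Mod M)) * card (carrier (G\<lparr>carrier := M\<rparr> Mod N))"
    by (simp add: carrier_FactGroup carrier_subgroup_Mod r_coset_def)
qed

lemma (in free_profinite_group) lpc_layer_card: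
  assumes p: "prime p" and X: "X \<noteq> {}" "finite X"
  shows "\<exists>d. finite (carrier (S Mod lpc p (n + 2))) \<and> finite (carrier (S\<lparr>carrier := lpc p (Suc n)\<rparr> Mod lpc p (n + 2))) \<and>
    card (carrier (S\<lparr>carrier := lpc p (Suc n)\<rparr> Mod lpc p (n + 2))) = p ^ d \<and>
    ereal (real d) = (\<Sum>s = 1..Suc n. necklace s (ecard X))"
proof -
  have p0: "0 < p" "1 < p" using p prime_gt_0_nat prime_gt_1_nat by auto
  obtain ws where ws: "\<forall>w\<in>set ws. 1 \<le> w \<and> w \<le> Suc n"
    "fps_agree (Suc n) (weight_fps ws) (1 - fps_const (int (card X)) * fps_X)"
    "finite (carrier (S Mod lpc p (Suc (Suc n))))"
    "card (carrier (S Mod lpc p (Suc (Suc n)))) = (\<Prod>w\<leftarrow>ws. p ^ (Suc (Suc n) - w))"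
    using lpc_index[OF p0(1) X] by blast
  obtain vs where vs: "\<forall>w\<in>set vs. 1 \<le> w \<and> w \<le> n"
    "fps_agree n (weight_fps vs) (1 - fps_const (int (card X)) * fps_X)"
    "card (carrier (S Mod lpc p (Suc n))) = (\<Prod>w\<leftarrow>vs. p ^ (Suc n - w))"
    using lpc_index[OF p0(1) X] by blast
  have ws_n: "ereal (real (count_list ws s)) = necklace s (ecard X)" if "1 \<le> s" "s \<le> Suc n" for s
    using count_list_eq_necklace[OF _ ws(2) that] ws(1) X(2) by (simp add: ecard_def)
  have "ereal (real (count_list vs s)) = necklace s (ecard X)" if "1 \<le> s" "s \<le> n" for s
    using count_list_eq_necklace[OF _ vs(2) that] vs(1) X(2) by (simp add: ecard_def)
  \<comment> \<open>The two lists come from unrelated eliminations, but their multiplicities agree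
    because both are necklace numbers.\<close>
  then have same: "count_list vs s = count_list ws s" if "1 \<le> s" "s \<le> n" for s
    using ws_n[of s] that by (metis ereal.inject le_SucI of_nat_eq_iff)
  define d where "d = (\<Sum>s = 1..Suc n. count_list ws s)"
  define e where "e = (\<Sum>w\<leftarrow>vs. Suc n - w)"
  have "e = (\<Sum>s = 1..n. count_list vs s * (Suc n - s))" unfolding e_def by (rule sum_list_weights[OF vs(1)])
  \<comment> \<open>Weight \<open>Suc n\<close> may be added to the range, as its factor
    \<open>Suc n - s\<close> is 0.\<close>
  also have "\<dots> = (\<Sum>s = 1..Suc n. count_list ws s * (Suc n - s))" using same by simp
  finally have e: "e = (\<Sum>s = 1..Suc n. count_list ws s * (Suc n - s))" .
  have "(\<Sum>w\<leftarrow>ws. Suc (Suc n) - w) = (\<Sum>s = 1..Suc n. count_list ws s * (Suc (Suc n) - s))"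
    by (rule sum_list_weights[OF ws(1)])
  also have "\<dots> = (\<Sum>s = 1..Suc n. count_list ws s * (Suc n - s) + count_list ws s)"
    by (intro sum.cong refl) (auto simp: Suc_diff_le)
  also have "\<dots> = e + d" unfolding e d_def by (simp only: sum.distrib)
  finally have "card (carrier (S Mod lpc p (n + 2))) = p ^ e * p ^ d"
    using ws(4) by (simp add: prod_list_power power_add)
  moreover have "card (carrier (S Mod lpc p (Suc n))) = p ^ e" using vs(3) by (simp add: prod_list_power e_def)
  moreover have fin: "finite (carrier (S Mod lpc p (n + 2)))" using ws(3) by simp
  moreover note card_Mod_Mod[OF normal_lpc subgroup_lpc lpc_antimono fin, of "Suc n"]
  ultimately have "card (carrier (S\<lparr>carrier := lpc p (Suc n)\<rparr> Mod lpc p (n + 2))) = p ^ d"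
    "finite (carrier (S\<lparr>carrier := lpc p (Suc n)\<rparr> Mod lpc p (n + 2)))"
    using p0 by auto
  moreover have "ereal (real d) = (\<Sum>s = 1..Suc n. necklace s (ecard X))"
  proof -
    have "ereal (real d) = (\<Sum>s = 1..Suc n. ereal (real (count_list ws s)))" by (simp add: d_def)
    also have "\<dots> = (\<Sum>s = 1..Suc n. necklace s (ecard X))" by (intro sum.cong refl ws_n) auto
    finally show ?thesis .
  qed
  ultimately show ?thesis using fin by blast
qed

section \<open>Elementary abelian groups\<close>

lemma carrier_residue_ring: "carrier (residue_ring (int p)) = {0..<int p}"
  by (auto simp: residue_ring_def)

locale elementary_abelian = comm_group A for A (structure) +
  fixes p :: nat
  assumes prime_p: "prime p"
    and exponent_p: "x \<in> carrier A \<Longrightarrow> x [^] p = \<one>"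
begin

sublocale V: vectorspace "residue_ring (int p)" "Fp_space A"
  by (rule vectorspace_Fp_space[OF prime_p comm_group_axioms exponent_p])

lemma p_gt_1: "1 < p"
  using prime_p by (rule prime_gt_1_nat)

lemma p_pos: "0 < int p" "1 < int p"
  using p_gt_1 by simp_all

lemma carrier_Fp_space [simp]: "carrier (Fp_space A) = carrier A"
  by (simp add: Fp_space_def)

lemma fin_dim_iff_finite: "V.fin_dim \<longleftrightarrow> finite (carrier A)"
proof
  assume "V.fin_dim"
  then obtain B where B: "finite B" "V.basis B" using V.finite_basis_exists by blast
  then have BA: "B \<subseteq> carrier A" by (simp add: V.basis_def)
  have "carrier A \<subseteq> (\<lambda>a. V.lincomb a B) ` (B \<rightarrow>\<^sub>E {0..<int p})"
  proof
    fix x assume "x \<in> carrier A"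
    then obtain a where "a \<in> B \<rightarrow>\<^sub>E carrier (residue_ring (int p))" "V.lincomb a B = x"
      using V.basis_criterion[of B] B BA by auto
    then show "x \<in> (\<lambda>a. V.lincomb a B) ` (B \<rightarrow>\<^sub>E {0..<int p})"
      by (auto simp: carrier_residue_ring)
  qed
  moreover have "finite (B \<rightarrow>\<^sub>E {0..<int p})" using B by (intro finite_PiE) auto
  ultimately show "finite (carrier A)" by (meson finite_imageI finite_subset)
next
  assume "finite (carrier A)"
  moreover have "V.span (carrier A) = carrier A"
    using V.in_own_span[of "carrier A"] V.span_is_subset2[of "carrier A"] by auto
  ultimately show "V.fin_dim" unfolding V.fin_dim_def by auto
qed

lemma hom_lincomb:
  assumes \<psi>: "\<psi> \<in> hom A (integer_mod_group p)" and "finite B" "B \<subseteq> carrier A" "a \<in> B \<rightarrow> {0..<int p}"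
  shows "\<psi> (V.lincomb a B) = (\<Sum>b\<in>B. a b * \<psi> b) mod int p"
  using assms(2-)
proof (induction B)
  case empty
  interpret \<psi>: group_hom A "integer_mod_group p" \<psi>
    by (intro group_hom.intro group_hom_axioms.intro is_group group_integer_mod_group \<psi>)
  have "V.lincomb a {} = \<one>" by (simp add: V.lincomb_def) (simp add: Fp_space_def)
  then show ?case using \<psi>.hom_one by simp
next
  case (insert b B)
  interpret \<psi>: group_hom A "integer_mod_group p" \<psi>
    by (intro group_hom.intro group_hom_axioms.intro is_group group_integer_mod_group \<psi>)
  have b: "b \<in> carrier A" using insert by simp
  have B: "B \<subseteq> carrier (Fp_space A)" "a \<in> B \<rightarrow> carrier (residue_ring (int p))"
    using insert by (auto simp: carrier_residue_ring)
  have "V.lincomb a (insert b B) = V.lincomb a (B \<union> {b})" by simp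
  also have "\<dots> = b [^] a b \<otimes> V.lincomb a B"
    using V.lincomb_insert[of B a b] insert B by (auto simp: Fp_space_def carrier_residue_ring insert_absorb)
  finally have "\<psi> (V.lincomb a (insert b B)) = (\<psi> (b [^] a b) + \<psi> (V.lincomb a B)) mod int p"
    using b V.lincomb_closed[OF B(1) B(2)] by simp
  also have "\<psi> (b [^] a b) = (a b * \<psi> b) mod int p"
    using b by (simp add: \<psi>.hom_int_pow int_pow_integer_mod_group)
  finally show ?case using insert by (simp add: mod_add_eq)
qed

text \<open>Coordinates in a basis count the elements, and values on a basis count the characters.
  Having the same power of \<open>p\<close> for both lets the layer and \<open>H^2\<close> be
  compared by cardinality.\<close>

lemma dim_card:
  assumes "finite (carrier A)"
  shows "card (carrier A) = p ^ V.dim"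
    and "card (hom A (integer_mod_group p) \<inter> extensional (carrier A)) = p ^ V.dim"
proof -
  obtain B where B: "finite B" "V.basis B"
    using V.finite_basis_exists fin_dim_iff_finite assms by blast
  have BA: "B \<subseteq> carrier A" using B(2) by (simp add: V.basis_def)
  have dim: "V.dim = card B" by (rule V.dim_basis[OF B])
  let ?R = "B \<rightarrow>\<^sub>E {0..<int p}"
  let ?H = "hom A (integer_mod_group p) \<inter> extensional (carrier A)"
  have cardR: "card ?R = p ^ V.dim" using B(1) by (simp add: card_PiE dim)
  have ex1: "\<exists>!a. a \<in> ?R \<and> V.lincomb a B = x" if "x \<in> carrier A" for x
    using V.basis_criterion[of B] B BA that by (simp add: carrier_residue_ring)
  have lc: "V.lincomb a B \<in> carrier A" if "a \<in> ?R" for a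
    using V.lincomb_closed[of B a] BA that by (auto simp: carrier_residue_ring)
  have "bij_betw (\<lambda>a. V.lincomb a B) ?R (carrier A)"
    unfolding bij_betw_def inj_on_def using ex1 lc by (auto, blast)
  then show "card (carrier A) = p ^ V.dim" using cardR bij_betw_same_card by metis
  \<comment> \<open>The coordinate vector in the basis \<open>B\<close>, from which characters with
    prescribed values on \<open>B\<close> are built as linear forms.\<close>
  define cf where "cf = (\<lambda>x. THE a. a \<in> ?R \<and> V.lincomb a B = x)"
  have cf: "cf x \<in> ?R" "V.lincomb (cf x) B = x" if "x \<in> carrier A" for x
    using theI'[OF ex1[OF that]] unfolding cf_def by auto
  have cf_lc: "cf (V.lincomb a B) = a" if "a \<in> ?R" for a
    unfolding cf_def using that ex1[OF lc[OF that]] by (intro the1_equality) auto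
  have cf_mult: "cf (x \<otimes> y) = (\<lambda>b\<in>B. (cf x b + cf y b) mod int p)" if "x \<in> carrier A" "y \<in> carrier A" for x y
  proof -
    let ?a = "\<lambda>b\<in>B. (cf x b + cf y b) mod int p"
    have "V.lincomb ?a B = V.lincomb (\<lambda>b. cf x b \<oplus>\<^bsub>residue_ring (int p)\<^esub> cf y b) B"
      using BA p_pos by (intro V.lincomb_cong) (auto simp: residue_ring_def intro!: zle_diff1_eq[THEN iffD2])
    also have "\<dots> = V.lincomb (cf x) B \<oplus>\<^bsub>Fp_space A\<^esub> V.lincomb (cf y) B"
      using cf(1)[OF that(1)] cf(1)[OF that(2)] BA B(1)
      by (intro V.lincomb_sum) (auto simp: carrier_residue_ring)
    also have "\<dots> = x \<otimes> y" using cf that by (simp add: Fp_space_def)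
    finally have "x \<otimes> y = V.lincomb ?a B" by simp
    moreover have "?a \<in> ?R" using p_pos by auto
    ultimately show ?thesis using cf_lc by simp
  qed
  have "bij_betw (\<lambda>\<psi>. restrict \<psi> B) ?H ?R"
  proof (rule bij_betwI')
    fix \<psi> \<psi>' assume \<psi>: "\<psi> \<in> ?H" and \<psi>': "\<psi>' \<in> ?H"
    show "restrict \<psi> B = restrict \<psi>' B \<longleftrightarrow> \<psi> = \<psi>'"
    proof
      assume eq: "restrict \<psi> B = restrict \<psi>' B"
      then have eqB: "\<psi> b = \<psi>' b" if "b \<in> B" for b using that by (metis restrict_apply')
      show "\<psi> = \<psi>'"
      proof (rule extensionalityI[where A = "carrier A"])
        fix x assume x: "x \<in> carrier A"
        have "cf x \<in> B \<rightarrow> {0..<int p}" using cf(1)[OF x] by auto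
        moreover have "(\<Sum>b\<in>B. cf x b * \<psi> b) = (\<Sum>b\<in>B. cf x b * \<psi>' b)"
          by (rule sum.cong[OF refl]) (simp add: eqB)
        ultimately have "\<psi> (V.lincomb (cf x) B) = \<psi>' (V.lincomb (cf x) B)"
          using hom_lincomb[of \<psi> B "cf x"] hom_lincomb[of \<psi>' B "cf x"] \<psi> \<psi>' B(1) BA by simp
        then show "\<psi> x = \<psi>' x" using cf(2)[OF x] by simp
      qed (use \<psi> \<psi>' in auto)
    qed simp
  next
    fix \<psi> assume "\<psi> \<in> ?H"
    then have "\<psi> b \<in> carrier (integer_mod_group p)" if "b \<in> B" for b
      using that BA by (auto simp: hom_def)
    then show "restrict \<psi> B \<in> ?R"
      using p_pos by (auto simp: carrier_integer_mod_group)
  next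
    fix v assume v: "v \<in> ?R"
    define \<psi> where "\<psi> = (\<lambda>x\<in>carrier A. (\<Sum>b\<in>B. cf x b * v b) mod int p)"
    have \<psi>_hom: "\<psi> \<in> hom A (integer_mod_group p)"
    proof (rule homI)
      fix x assume "x \<in> carrier A"
      then show "\<psi> x \<in> carrier (integer_mod_group p)"
        using p_pos by (simp add: \<psi>_def carrier_integer_mod_group)
    next
      fix x y assume xy: "x \<in> carrier A" "y \<in> carrier A"
      have "(\<Sum>b\<in>B. cf (x \<otimes> y) b * v b) mod int p = (\<Sum>b\<in>B. ((cf x b + cf y b) mod int p * v b) mod int p) mod int p"
        using xy by (simp add: cf_mult mod_sum_eq cong: sum.cong)
      also have "\<dots> = (\<Sum>b\<in>B. (cf x b * v b + cf y b * v b) mod int p) mod int p"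
        by (simp add: mod_mult_left_eq distrib_right)
      also have "\<dots> = ((\<Sum>b\<in>B. cf x b * v b) + (\<Sum>b\<in>B. cf y b * v b)) mod int p"
        by (simp add: mod_sum_eq sum.distrib)
      finally show "\<psi> (x \<otimes> y) = \<psi> x \<otimes>\<^bsub>integer_mod_group p\<^esub> \<psi> y"
        using xy by (simp add: \<psi>_def mod_add_eq)
    qed
    have "\<psi> b = v b" if b: "b \<in> B" for b
    proof -
      let ?i = "\<lambda>b'\<in>B. if b' = b then 1 else (0::int)"
      have i: "?i \<in> ?R" using p_pos by auto
      have "(\<Sum>b'\<in>B. ?i b' * f b') = f b" for f :: "_ \<Rightarrow> int"
      proof -
        have "(\<Sum>b'\<in>B. ?i b' * f b') = (\<Sum>b'\<in>B. if b' = b then f b' else 0)"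
          by (intro sum.cong refl) auto
        then show ?thesis using B(1) b by simp
      qed
      note delta = this
      have "?i \<in> B \<rightarrow> {0..<int p}" using p_pos by auto
      then have "\<psi> (V.lincomb ?i B) = \<psi> b mod int p"
        by (simp only: hom_lincomb[OF \<psi>_hom B(1) BA] delta)
      moreover have "\<psi> (V.lincomb ?i B) = (\<Sum>b'\<in>B. cf (V.lincomb ?i B) b' * v b') mod int p"
        unfolding \<psi>_def by (rule restrict_apply'[OF lc[OF i]])
      then have "\<psi> (V.lincomb ?i B) = v b mod int p" by (simp only: cf_lc[OF i] delta)
      moreover have "\<psi> b \<in> {0..<int p}" using b BA p_pos by (auto simp: \<psi>_def)
      moreover have "v b \<in> {0..<int p}" using v b by blast
      ultimately show ?thesis by simp
    qed
    then have "restrict v B = restrict \<psi> B" by (intro restrict_ext) simp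
    then have "v = restrict \<psi> B" using v by (simp add: PiE_def extensional_restrict)
    moreover have "\<psi> \<in> extensional (carrier A)" by (simp add: \<psi>_def)
    ultimately show "\<exists>\<psi>\<in>?H. v = restrict \<psi> B" using \<psi>_hom by blast
  qed
  then show "card ?H = p ^ V.dim" using cardR bij_betw_same_card by metis
qed

lemma Fp_dim_eq_enat:
  assumes "finite (carrier A)" "card (carrier A) = p ^ d"
  shows "Fp_dim p A = enat d"
proof -
  have "p ^ d = p ^ V.dim" using dim_card(1)[OF assms(1)] assms(2) by simp
  then have "d = V.dim" using p_gt_1 by simp
  then show ?thesis using assms(1) fin_dim_iff_finite by (simp add: Fp_dim_def)
qed

lemma Fp_dim_eq_infinity: "infinite (carrier A) \<Longrightarrow> Fp_dim p A = \<infinity>"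
  using fin_dim_iff_finite by (simp add: Fp_dim_def)

lemma card_characters:
  assumes "finite (carrier A)"
  shows "card (hom A (integer_mod_group p) \<inter> extensional (carrier A)) = card (carrier A)"
  using dim_card[OF assms] by simp

end

section \<open>Second cohomology\<close>

lemma continuous_map_discrete_binop:
  assumes "continuous_map U (discrete_topology A) f" "continuous_map U (discrete_topology A) g"
    and "\<And>a b. a \<in> A \<Longrightarrow> b \<in> A \<Longrightarrow> k a b \<in> B"
  shows "continuous_map U (discrete_topology B) (\<lambda>x. k (f x) (g x))"
proof -
  have "continuous_map U (discrete_topology (A \<times> A)) (\<lambda>x. (f x, g x))"
    using continuous_map_pairedI[OF assms(1,2)] by (simp add: prod_topology_discrete_topology)
  moreover have "continuous_map (discrete_topology (A \<times> A)) (discrete_topology B) (\<lambda>(a, b). k a b)"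
    using assms(3) by auto
  ultimately have "continuous_map U (discrete_topology B) ((\<lambda>(a, b). k a b) \<circ> (\<lambda>x. (f x, g x)))"
    by (rule continuous_map_compose)
  then show ?thesis by (simp add: o_def)
qed

lemma dvd_mod_cong: "a mod m = b mod m \<Longrightarrow> m dvd a \<longleftrightarrow> m dvd (b::int)"
  by (simp only: dvd_eq_mod_eq_0)

lemma mod_alternating4: "(a mod m - b mod m + c mod m - d mod m) mod m = (a - b + c - d) mod (m::int)"
  and mod_alternating3: "(a mod m - b mod m + c mod m) mod m = (a - b + c) mod (m::int)"
  and mod_linear2: "(e * (a mod m) + f * (b mod m)) mod m = (e * a + f * b) mod (m::int)"
  by (intro mod_diff_cong mod_add_cong mod_mult_cong; simp)+

lemma continuous_map_restrict:
  "continuous_map U V f \<Longrightarrow> topspace U \<subseteq> A \<Longrightarrow> continuous_map U V (restrict f A)"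
  by (erule continuous_map_eq) auto

text \<open>Continuity of the multiplication is what makes coboundaries continuous. Asking for just
  this of the topology lets the quotient be used without proving it profinite.\<close>

locale cohomology_group = group G for G (structure) +
  fixes U :: "'a topology" and p :: nat
  assumes prime_p: "prime p"
    and topspace_U: "topspace U = carrier G"
    and continuous_mult_U: "continuous_map (prod_topology U U) U (\<lambda>(x, y). x \<otimes> y)"
begin

sublocale Rp: residues_prime p "residue_ring (int p)"
  by unfold_locales (use prime_p in auto)

lemma p_pos: "0 < int p" "1 < int p"
  using prime_gt_1_nat[OF prime_p] by auto

lemma res_diff_eq: "a \<ominus>\<^bsub>residue_ring (int p)\<^esub> b = (a - b) mod int p"
  by (simp add: a_minus_def Rp.res_add_eq Rp.res_neg_eq mod_simps)

lemma carrier_Rp: "carrier (residue_ring (int p)) = {0..<int p}"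
  by (rule carrier_residue_ring)

abbreviation GG :: "('a \<times> 'a) set" where "GG \<equiv> carrier G \<times> carrier G"

lemma cochains2_iff: "f \<in> cochains2 G U p \<longleftrightarrow> f \<in> extensional GG \<and>
    continuous_map (prod_topology U U) (discrete_topology {0..<int p}) f"
  by (simp add: cochains2_def carrier_Rp)

lemma cochains1_iff: "c \<in> cochains1 G U p \<longleftrightarrow> c \<in> extensional (carrier G) \<and>
    continuous_map U (discrete_topology {0..<int p}) c"
  by (simp add: cochains1_def carrier_Rp)

lemma cochains2_range: "f \<in> cochains2 G U p \<Longrightarrow> x \<in> carrier G \<Longrightarrow> y \<in> carrier G \<Longrightarrow> f (x, y) \<in> {0..<int p}"
  using continuous_map_image_subset_topspace[of "prod_topology U U" "discrete_topology {0..<int p}" f]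
  by (auto simp: cochains2_iff topspace_U image_subset_iff)

text \<open>Stated as a divisibility of integers, to avoid computing with nested reductions in the
  residue ring.\<close>

definition cocycle :: "('a \<times> 'a \<Rightarrow> int) \<Rightarrow> bool" where
  "cocycle f \<longleftrightarrow> (\<forall>x\<in>carrier G. \<forall>y\<in>carrier G. \<forall>z\<in>carrier G.
     int p dvd f (y, z) - f (x \<otimes> y, z) + f (x, y \<otimes> z) - f (x, y))"

lemma cocycles2_iff: "f \<in> cocycles2 G U p \<longleftrightarrow> f \<in> cochains2 G U p \<and> cocycle f"
proof -
  have "f (y, z) \<ominus>\<^bsub>residue_ring (int p)\<^esub> f (x \<otimes> y, z) \<oplus>\<^bsub>residue_ring (int p)\<^esub> f (x, y \<otimes> z)
      \<ominus>\<^bsub>residue_ring (int p)\<^esub> f (x, y) = \<zero>\<^bsub>residue_ring (int p)\<^esub> \<longleftrightarrow>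
      int p dvd f (y, z) - f (x \<otimes> y, z) + f (x, y \<otimes> z) - f (x, y)" for x y z
    unfolding res_diff_eq Rp.res_add_eq Rp.res_zero_eq dvd_eq_mod_eq_0 by (simp only: mod_simps)
  then show ?thesis by (auto simp: cocycles2_def cocycle_def Let_def)
qed

lemma coboundary_eq:
  "coboundary G p c = (\<lambda>(x, y)\<in>GG. (c y - c (x \<otimes> y) + c x) mod int p)"
  unfolding coboundary_def Let_def res_diff_eq Rp.res_add_eq by (simp only: mod_simps)

abbreviation Z2 :: "('a \<times> 'a \<Rightarrow> int) monoid" where "Z2 \<equiv> cocycle_group2 G U p"

lemma Z2_simps [simp]:
  "carrier Z2 = cocycles2 G U p"
  "f \<otimes>\<^bsub>Z2\<^esub> g = (\<lambda>u\<in>GG. (f u + g u) mod int p)"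
  "\<one>\<^bsub>Z2\<^esub> = (\<lambda>u\<in>GG. 0)"
  by (simp_all add: cocycle_group2_def Let_def Rp.res_add_eq Rp.res_zero_eq)

text \<open>Integer coefficients \<open>a\<close> and \<open>b\<close> let one closure statement
  serve for sums and, with \<open>-1\<close> and \<open>0\<close>, for inverses.\<close>

lemma cochains2_binop:
  assumes "f \<in> cochains2 G U p" "g \<in> cochains2 G U p"
  shows "(\<lambda>u\<in>GG. (a * f u + b * g u) mod int p) \<in> cochains2 G U p"
  unfolding cochains2_iff
proof (intro conjI continuous_map_restrict)
  show "continuous_map (prod_topology U U) (discrete_topology {0..<int p}) (\<lambda>u. (a * f u + b * g u) mod int p)"
    by (rule continuous_map_discrete_binop[where A = "{0..<int p}" and k = "\<lambda>x y. (a * x + b * y) mod int p"])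
      (use assms p_pos in \<open>simp_all add: cochains2_iff\<close>)
qed (simp_all add: topspace_U)

lemma cocycles2_binop:
  assumes "f \<in> cocycles2 G U p" "g \<in> cocycles2 G U p"
  shows "(\<lambda>u\<in>GG. (a * f u + b * g u) mod int p) \<in> cocycles2 G U p"
  unfolding cocycles2_iff
proof
  show "cocycle (\<lambda>u\<in>GG. (a * f u + b * g u) mod int p)"
    unfolding cocycle_def
  proof (intro ballI)
    fix x y z assume xyz: "x \<in> carrier G" "y \<in> carrier G" "z \<in> carrier G"
    let ?D = "\<lambda>f. f (y, z) - f (x \<otimes> y, z) + f (x, y \<otimes> z) - f (x, y)"
    have "int p dvd ?D f" "int p dvd ?D g"
      using assms xyz unfolding cocycles2_iff cocycle_def by blast+
    then have "int p dvd a * ?D f + b * ?D g" by (intro dvd_add dvd_mult)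
    also have "a * ?D f + b * ?D g = ?D (\<lambda>u. a * f u + b * g u)" by (simp add: algebra_simps)
    finally have "int p dvd ?D (\<lambda>u. a * f u + b * g u)" .
    then have "int p dvd ?D (\<lambda>u. (a * f u + b * g u) mod int p)"
      by (rule dvd_mod_cong[THEN iffD1, rotated]) (simp only: mod_alternating4)
    moreover have "?D (\<lambda>u\<in>GG. (a * f u + b * g u) mod int p) = ?D (\<lambda>u. (a * f u + b * g u) mod int p)"
      using xyz by simp
    ultimately show "int p dvd ?D (\<lambda>u\<in>GG. (a * f u + b * g u) mod int p)" by argo
  qed
qed (use assms cochains2_binop in \<open>auto simp: cocycles2_iff\<close>)

lemma cocycles2_zero: "(\<lambda>u\<in>GG. 0) \<in> cocycles2 G U p"
  unfolding cocycles2_iff cochains2_iff cocycle_def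
  using p_pos by (auto intro!: continuous_map_restrict simp: topspace_U)

lemma cocycles2_mod:
  assumes "f \<in> cocycles2 G U p" "u \<in> GG" shows "f u mod int p = f u"
  using assms cochains2_range[of f] by (auto simp: cocycles2_iff)

lemma comm_group_Z2: "comm_group Z2"
proof (rule comm_groupI)
  fix f assume f: "f \<in> carrier Z2"
  have "(\<lambda>u\<in>GG. ((-1) * f u + 0 * f u) mod int p) \<in> carrier Z2"
    using cocycles2_binop[of f f "-1" 0] f by simp
  moreover have "(\<lambda>u\<in>GG. ((-1) * f u + 0 * f u) mod int p) \<otimes>\<^bsub>Z2\<^esub> f = \<one>\<^bsub>Z2\<^esub>"
    by (auto simp: mod_simps)
  ultimately show "\<exists>g\<in>carrier Z2. g \<otimes>\<^bsub>Z2\<^esub> f = \<one>\<^bsub>Z2\<^esub>" by blast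
next
  fix f assume f: "f \<in> carrier Z2"
  have "f \<in> extensional GG" using f by (simp add: cocycles2_iff cochains2_iff)
  then show "\<one>\<^bsub>Z2\<^esub> \<otimes>\<^bsub>Z2\<^esub> f = f"
    using f cocycles2_mod[of f] by (intro extensionalityI[where A = GG]) auto
next
  fix f g assume "f \<in> carrier Z2" "g \<in> carrier Z2"
  then show "f \<otimes>\<^bsub>Z2\<^esub> g \<in> carrier Z2" using cocycles2_binop[of f g 1 1] by simp
qed (auto simp: mod_simps add_ac cocycles2_zero)

sublocale Z2: comm_group Z2 by (rule comm_group_Z2)

abbreviation B2 :: "('a \<times> 'a \<Rightarrow> int) set" where "B2 \<equiv> coboundary G p ` cochains1 G U p"

lemma cochains1_binop:
  assumes "c \<in> cochains1 G U p" "d \<in> cochains1 G U p"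
  shows "(\<lambda>x\<in>carrier G. (a * c x + b * d x) mod int p) \<in> cochains1 G U p"
  unfolding cochains1_iff
proof (intro conjI continuous_map_restrict)
  show "continuous_map U (discrete_topology {0..<int p}) (\<lambda>u. (a * c u + b * d u) mod int p)"
    by (rule continuous_map_discrete_binop[where A = "{0..<int p}" and k = "\<lambda>x y. (a * x + b * y) mod int p"])
      (use assms p_pos in \<open>simp_all add: cochains1_iff\<close>)
qed (simp_all add: topspace_U)

lemma coboundary_cocycle:
  assumes c: "c \<in> cochains1 G U p" shows "coboundary G p c \<in> cocycles2 G U p"
  unfolding cocycles2_iff
proof
  have cont: "continuous_map U (discrete_topology {0..<int p}) c" using c by (simp add: cochains1_iff)
  have c1: "continuous_map (prod_topology U U) (discrete_topology {0..<int p}) (\<lambda>u. c (fst u))"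
    and c2: "continuous_map (prod_topology U U) (discrete_topology {0..<int p}) (\<lambda>u. c (snd u))"
    using continuous_map_compose[OF continuous_map_fst cont] continuous_map_compose[OF continuous_map_snd cont]
    by (simp_all add: o_def)
  have c3: "continuous_map (prod_topology U U) (discrete_topology {0..<int p}) (\<lambda>u. c (fst u \<otimes> snd u))"
    using continuous_map_compose[OF continuous_mult_U cont] by (simp add: o_def case_prod_beta)
  have c4: "continuous_map (prod_topology U U) (discrete_topology {0..<int p})
      (\<lambda>u. (c (snd u) - c (fst u \<otimes> snd u)) mod int p)"
    using p_pos by (intro continuous_map_discrete_binop[where A = "{0..<int p}" and k = "\<lambda>x y. (x - y) mod int p"] c2 c3) auto
  have "continuous_map (prod_topology U U) (discrete_topology {0..<int p})
      (\<lambda>u. ((c (snd u) - c (fst u \<otimes> snd u)) mod int p + c (fst u)) mod int p)"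
    using p_pos by (intro continuous_map_discrete_binop[where A = "{0..<int p}" and k = "\<lambda>x y. (x + y) mod int p"] c4 c1) auto
  then show "coboundary G p c \<in> cochains2 G U p"
    unfolding cochains2_iff coboundary_eq
    by (auto intro!: continuous_map_restrict simp: topspace_U mod_simps case_prod_unfold)
  show "cocycle (coboundary G p c)"
    unfolding cocycle_def
  proof (intro ballI)
    fix x y z assume xyz: "x \<in> carrier G" "y \<in> carrier G" "z \<in> carrier G"
    have "(c z - c (y \<otimes> z) + c y) - (c z - c (x \<otimes> y \<otimes> z) + c (x \<otimes> y))
        + (c (y \<otimes> z) - c (x \<otimes> (y \<otimes> z)) + c x) - (c y - c (x \<otimes> y) + c x) = 0"
      using xyz by (simp add: m_assoc)
    then show "int p dvd coboundary G p c (y, z) - coboundary G p c (x \<otimes> y, z) +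
        coboundary G p c (x, y \<otimes> z) - coboundary G p c (x, y)"
      using xyz by (simp add: coboundary_eq dvd_mod_cong[OF mod_alternating4])
  qed
qed

lemma coboundary_binop:
  "(\<lambda>u\<in>GG. (a * coboundary G p c u + b * coboundary G p d u) mod int p) =
   coboundary G p (\<lambda>x\<in>carrier G. (a * c x + b * d x) mod int p)"
  unfolding coboundary_eq
proof (rule restrict_ext)
  fix u assume "u \<in> GG"
  then obtain x y where u: "u = (x, y)" "x \<in> carrier G" "y \<in> carrier G" by blast
  have "(a * ((c y - c (x \<otimes> y) + c x) mod int p) + b * ((d y - d (x \<otimes> y) + d x) mod int p)) mod int p =
      ((a * c y + b * d y) - (a * c (x \<otimes> y) + b * d (x \<otimes> y)) + (a * c x + b * d x)) mod int p"
    unfolding mod_linear2 by (simp add: algebra_simps)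
  also have "\<dots> = ((a * c y + b * d y) mod int p - (a * c (x \<otimes> y) + b * d (x \<otimes> y)) mod int p +
      (a * c x + b * d x) mod int p) mod int p"
    by (simp only: mod_alternating3)
  finally show "(a * (\<lambda>(x, y)\<in>GG. (c y - c (x \<otimes> y) + c x) mod int p) u
      + b * (\<lambda>(x, y)\<in>GG. (d y - d (x \<otimes> y) + d x) mod int p) u) mod int p =
    (case u of (x, y) \<Rightarrow> ((\<lambda>x\<in>carrier G. (a * c x + b * d x) mod int p) y
      - (\<lambda>x\<in>carrier G. (a * c x + b * d x) mod int p) (x \<otimes> y)
      + (\<lambda>x\<in>carrier G. (a * c x + b * d x) mod int p) x) mod int p)"
    using u by simp
qed

lemma subgroup_B2: "subgroup B2 Z2"
proof (rule Z2.subgroupI)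
  show "B2 \<subseteq> carrier Z2" using coboundary_cocycle by auto
  have "(\<lambda>x\<in>carrier G. 0) \<in> cochains1 G U p"
    using p_pos by (auto simp: cochains1_iff topspace_U intro!: continuous_map_restrict)
  then show "B2 \<noteq> {}" by blast
next
  fix f assume "f \<in> B2"
  then obtain c where c: "c \<in> cochains1 G U p" "f = coboundary G p c" by blast
  let ?d = "\<lambda>x\<in>carrier G. ((-1) * c x + 0 * c x) mod int p"
  have d: "?d \<in> cochains1 G U p" by (rule cochains1_binop[OF c(1) c(1)])
  have "coboundary G p ?d \<otimes>\<^bsub>Z2\<^esub> f = \<one>\<^bsub>Z2\<^esub>"
    unfolding coboundary_binop[symmetric] c(2) by (auto simp: mod_simps)
  then have "inv\<^bsub>Z2\<^esub> f = coboundary G p ?d"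
    using Z2.inv_equality coboundary_cocycle c d by auto
  then show "inv\<^bsub>Z2\<^esub> f \<in> B2" using d by blast
next
  fix f g assume "f \<in> B2" "g \<in> B2"
  then obtain c d where c: "c \<in> cochains1 G U p" "f = coboundary G p c"
    and d: "d \<in> cochains1 G U p" "g = coboundary G p d" by blast
  have "f \<otimes>\<^bsub>Z2\<^esub> g = coboundary G p (\<lambda>x\<in>carrier G. (1 * c x + 1 * d x) mod int p)"
    unfolding coboundary_binop[symmetric] c(2) d(2) by simp
  then show "f \<otimes>\<^bsub>Z2\<^esub> g \<in> B2" using cochains1_binop[OF c(1) d(1)] by blast
qed

lemma Z2_pow: "f \<in> cocycles2 G U p \<Longrightarrow> f [^]\<^bsub>Z2\<^esub> (k::nat) = (\<lambda>u\<in>GG. (int k * f u) mod int p)"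
  by (induction k) (auto simp: mod_simps algebra_simps)

sublocale H2: elementary_abelian "cohomology2 G U p" p
proof -
  interpret B2: normal B2 Z2 using subgroup_B2 by (rule Z2.subgroup_imp_normal)
  have H2: "cohomology2 G U p = Z2 Mod B2" by (simp add: cohomology2_def)
  interpret Q: comm_group "Z2 Mod B2" by (rule Z2.abelian_FactGroup[OF subgroup_B2])
  show "elementary_abelian (cohomology2 G U p) p"
    unfolding H2
  proof (intro elementary_abelian.intro elementary_abelian_axioms.intro Q.comm_group_axioms prime_p)
    fix c assume "c \<in> carrier (Z2 Mod B2)"
    then obtain f where f: "f \<in> cocycles2 G U p" "c = B2 #>\<^bsub>Z2\<^esub> f" by (auto simp: carrier_FactGroup)
    have "c [^]\<^bsub>Z2 Mod B2\<^esub> p = B2 #>\<^bsub>Z2\<^esub> (f [^]\<^bsub>Z2\<^esub> p)"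
      using B2.FactGroup_pow[of f p] f by simp
    also have "f [^]\<^bsub>Z2\<^esub> p = \<one>\<^bsub>Z2\<^esub>" using Z2_pow[OF f(1), of p] by simp
    also have "B2 #>\<^bsub>Z2\<^esub> \<one>\<^bsub>Z2\<^esub> = \<one>\<^bsub>Z2 Mod B2\<^esub>"
      using Z2.coset_mult_one B2.subset by simp
    finally show "c [^]\<^bsub>Z2 Mod B2\<^esub> p = \<one>\<^bsub>Z2 Mod B2\<^esub>" .
  qed
qed

lemma carrier_H2: "carrier (cohomology2 G U p) = (\<lambda>f. B2 #>\<^bsub>Z2\<^esub> f) ` cocycles2 G U p"
  by (simp add: cohomology2_def carrier_FactGroup)

text \<open>The form in which classes are compared later: the residue ring has disappeared, and only
  an integer congruence with a bounding cochain remains.\<close>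

lemma H2_class_eq:
  assumes "f \<in> cocycles2 G U p" "g \<in> cocycles2 G U p"
  shows "B2 #>\<^bsub>Z2\<^esub> f = B2 #>\<^bsub>Z2\<^esub> g \<longleftrightarrow>
    (\<exists>c\<in>cochains1 G U p. \<forall>x\<in>carrier G. \<forall>y\<in>carrier G.
      int p dvd f (x, y) - g (x, y) - (c y - c (x \<otimes> y) + c x))" (is "?L \<longleftrightarrow> ?R")
proof
  assume ?L
  then have "f \<in> B2 #>\<^bsub>Z2\<^esub> g" using Z2.rcos_self[OF _ subgroup_B2, of f] assms by simp
  then obtain c where c: "c \<in> cochains1 G U p" "f = coboundary G p c \<otimes>\<^bsub>Z2\<^esub> g" by (auto simp: r_coset_def)
  have "int p dvd f (x, y) - g (x, y) - (c y - c (x \<otimes> y) + c x)" if "x \<in> carrier G" "y \<in> carrier G" for x y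
  proof -
    have "((c y - c (x \<otimes> y) + c x) mod int p + g (x, y)) mod int p = (c y - c (x \<otimes> y) + c x + g (x, y)) mod int p"
      by (simp only: mod_simps)
    then have "f (x, y) mod int p = (c y - c (x \<otimes> y) + c x + g (x, y)) mod int p"
      using that by (simp add: c(2) coboundary_eq)
    then show ?thesis by (simp add: mod_eq_dvd_iff algebra_simps)
  qed
  then show ?R using c(1) by blast
next
  assume ?R
  then obtain c where c: "c \<in> cochains1 G U p"
    "\<And>x y. x \<in> carrier G \<Longrightarrow> y \<in> carrier G \<Longrightarrow> int p dvd f (x, y) - g (x, y) - (c y - c (x \<otimes> y) + c x)"
    by blast
  have "f = coboundary G p c \<otimes>\<^bsub>Z2\<^esub> g"
  proof (rule extensionalityI[where A = GG])
    show "f \<in> extensional GG" using assms(1) by (simp add: cocycles2_iff cochains2_iff)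
    fix u assume u: "u \<in> GG"
    then obtain x y where xy: "u = (x, y)" "x \<in> carrier G" "y \<in> carrier G" by blast
    have "f (x, y) mod int p = (g (x, y) + (c y - c (x \<otimes> y) + c x)) mod int p"
      using c(2)[OF xy(2,3)] by (simp add: mod_eq_dvd_iff algebra_simps)
    then show "f u = (coboundary G p c \<otimes>\<^bsub>Z2\<^esub> g) u"
      using cocycles2_mod[OF assms(1) u] xy by (simp add: coboundary_eq mod_simps add.commute)
  qed simp
  then have "f \<in> B2 #>\<^bsub>Z2\<^esub> g" using c(1) by (auto simp: r_coset_def)
  then show ?L using Z2.repr_independence[OF _ _ subgroup_B2] assms by simp
qed

end

section \<open>Open subgroups and quotient topologies\<close>

context profinite_group
begin

lemma openin_preimage:
  "continuous_map T T f \<Longrightarrow> openin T C \<Longrightarrow> openin T {x \<in> carrier G. f x \<in> C}"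
  using openin_continuous_map_preimage[of T T f C] by (simp add: topspace_eq)

lemma rcos_eq_iff:
  assumes "subgroup N G" "x \<in> carrier G" "y \<in> carrier G"
  shows "N #> x = N #> y \<longleftrightarrow> x \<otimes> inv y \<in> N"
proof
  assume "N #> x = N #> y"
  then have "x \<in> N #> y" using rcos_self[OF assms(2,1)] by simp
  then obtain m where "m \<in> N" "x = m \<otimes> y" by (auto simp: r_coset_def)
  then show "x \<otimes> inv y \<in> N" using assms subgroup.mem_carrier[OF assms(1)] by (simp add: m_assoc)
next
  assume m: "x \<otimes> inv y \<in> N"
  have "x = (x \<otimes> inv y) \<otimes> y" using assms by (simp add: m_assoc)
  then have "x \<in> N #> y" using m by (auto simp: r_coset_def)
  then show "N #> x = N #> y" using repr_independence[OF _ assms(3,1)] by simp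
qed

lemma openin_coset_saturated:
  assumes "openin T N" "subgroup N G" "K \<subseteq> carrier G" "\<And>s \<nu>. s \<in> K \<Longrightarrow> \<nu> \<in> N \<Longrightarrow> s \<otimes> \<nu> \<in> K"
  shows "openin T K"
proof (subst openin_subopen, intro ballI)
  fix s assume s: "s \<in> K"
  then have sG: "s \<in> carrier G" using assms by blast
  let ?V = "{t \<in> carrier G. inv s \<otimes> t \<in> N}"
  have "openin T ?V"
    by (intro openin_preimage[OF _ assms(1)] continuous_map_mult continuous_map_constant continuous_map_ident)
      (use sG in simp)
  moreover have "s \<in> ?V" using sG assms(2) by (simp add: subgroup.one_closed)
  moreover have "t \<in> K" if "t \<in> ?V" for t
  proof -
    have "s \<otimes> (inv s \<otimes> t) \<in> K" using assms(4)[OF s] that by simp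
    then show ?thesis using sG that by (simp add: m_assoc[symmetric])
  qed
  ultimately show "\<exists>V. openin T V \<and> s \<in> V \<and> V \<subseteq> K" by blast
qed

lemma openin_normal_preimage:
  assumes "openin T N" "N \<lhd> G"
  shows "openin T {x \<in> carrier G. N #> x \<in> C}"
proof (rule openin_coset_saturated[OF assms(1)])
  interpret N: normal N G by fact
  show "subgroup N G" by (rule N.subgroup_axioms)
  fix s \<nu> assume s: "s \<in> {x \<in> carrier G. N #> x \<in> C}" and \<nu>: "\<nu> \<in> N"
  have \<nu>G: "\<nu> \<in> carrier G" using \<nu> N.mem_carrier by blast
  have "s \<otimes> \<nu> \<otimes> inv s \<in> N" using N.inv_op_closed2 s \<nu> by blast
  then have "N #> (s \<otimes> \<nu>) = N #> s" using s \<nu>G by (simp add: rcos_eq_iff[OF N.subgroup_axioms])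
  then show "s \<otimes> \<nu> \<in> {x \<in> carrier G. N #> x \<in> C}" using s \<nu>G by simp
qed auto

text \<open>The complement is a finite union of cosets, each closed as a translate of
  \<open>N\<close>.\<close>

lemma openin_finite_index:
  assumes "closedin T N" "subgroup N G" "finite (carrier (G Mod N))"
  shows "openin T N"
proof -
  have NG: "N \<subseteq> carrier G" using assms(2) by (rule subgroup.subset)
  let ?R = "carrier (G Mod N) - {N}"
  have cl: "closedin T c" if "c \<in> ?R" for c
  proof -
    obtain g where g: "g \<in> carrier G" "c = N #> g" using \<open>c \<in> ?R\<close> by (auto simp: carrier_FactGroup)
    have "c = {x \<in> carrier G. x \<otimes> inv g \<in> N}"
    proof (intro equalityI subsetI)
      fix x assume "x \<in> c"
      then obtain m where "m \<in> N" "x = m \<otimes> g" using g by (auto simp: r_coset_def)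
      then show "x \<in> {x \<in> carrier G. x \<otimes> inv g \<in> N}" using g NG by (auto simp: m_assoc)
    next
      fix x assume "x \<in> {x \<in> carrier G. x \<otimes> inv g \<in> N}"
      then have "x \<in> carrier G" "N #> x = c" using g rcos_eq_iff[OF assms(2)] by auto
      then show "x \<in> c" using rcos_self[OF _ assms(2)] by blast
    qed
    also have "closedin T \<dots>"
      by (intro closedin_preimage[OF _ assms(1)] continuous_map_mult continuous_map_constant continuous_map_ident)
        (use g in simp)
    finally show ?thesis .
  qed
  have cover: "x \<in> \<Union>?R" if x: "x \<in> carrier G" "x \<notin> N" for x
  proof -
    have "x \<in> N #> x" by (rule rcos_self[OF x(1) assms(2)])
    then show ?thesis using x by (auto simp: carrier_FactGroup)
  qed
  have disj: "x \<notin> N" if "c \<in> ?R" "x \<in> c" for x c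
  proof
    assume x: "x \<in> N"
    obtain g where g: "g \<in> carrier G" "c = N #> g" using \<open>c \<in> ?R\<close> by (auto simp: carrier_FactGroup)
    have "N #> x = c" using repr_independence[OF _ g(1) assms(2), of x] \<open>x \<in> c\<close> g by simp
    moreover have "N #> x = N" by (rule coset_join2[OF _ assms(2) x]) (use x NG in blast)
    ultimately show False using \<open>c \<in> ?R\<close> by simp
  qed
  have "\<Union>?R \<subseteq> carrier G" using cl closedin_subset topspace_eq by (metis Union_least)
  then have "N = topspace T - \<Union>?R"
    using NG cover disj unfolding topspace_eq by blast
  moreover have "closedin T (\<Union>?R)" using assms(3) cl by (intro closedin_Union) auto
  ultimately show ?thesis by (metis openin_diff openin_topspace)
qed

lemma topspace_quotient: "topspace (quotient_group_topology G T N) = carrier (G Mod N)"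
proof -
  have "{x \<in> carrier G. N #> x \<in> carrier (G Mod N)} = topspace T"
    by (auto simp: carrier_FactGroup topspace_eq)
  then have "openin (quotient_group_topology G T N) (carrier (G Mod N))"
    by (simp add: openin_quotient_group_topology)
  then show ?thesis
    using openin_subset openin_topspace[of "quotient_group_topology G T N"]
    unfolding openin_quotient_group_topology by (metis openin_quotient_group_topology subset_antisym)
qed

lemma quotient_topology_discrete:
  assumes "openin T N" "N \<lhd> G"
  shows "quotient_group_topology G T N = discrete_topology (carrier (G Mod N))"
  by (simp add: topology_eq openin_quotient_group_topology openin_normal_preimage[OF assms])

text \<open>The projection is open: the preimage of the image of \<open>V\<close> is the union of
  its translates by elements of \<open>N\<close>.\<close>

lemma openin_quotient_image:
  assumes N: "N \<lhd> G" and V: "openin T V"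
  shows "openin (quotient_group_topology G T N) ((\<lambda>x. N #> x) ` V)"
  unfolding openin_quotient_group_topology
proof
  interpret N: normal N G by fact
  have VG: "V \<subseteq> carrier G" using openin_subset[OF V] topspace_eq by simp
  show "(\<lambda>x. N #> x) ` V \<subseteq> carrier (G Mod N)" using VG by (auto simp: carrier_FactGroup)
  have "{x \<in> carrier G. N #> x \<in> (\<lambda>x. N #> x) ` V} = (\<Union>m\<in>N. {x \<in> carrier G. m \<otimes> x \<in> V})"
  proof (intro equalityI subsetI)
    fix x assume "x \<in> {x \<in> carrier G. N #> x \<in> (\<lambda>x. N #> x) ` V}"
    then obtain v where v: "x \<in> carrier G" "v \<in> V" "N #> v = N #> x" by auto
    then have "v \<otimes> inv x \<in> N" using rcos_eq_iff[OF N.subgroup_axioms, of v x] VG by blast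
    moreover have "v \<otimes> inv x \<otimes> x = v" using v VG by (simp add: m_assoc subset_iff)
    ultimately show "x \<in> (\<Union>m\<in>N. {x \<in> carrier G. m \<otimes> x \<in> V})" using v by (intro UN_I) auto
  next
    fix x assume "x \<in> (\<Union>m\<in>N. {x \<in> carrier G. m \<otimes> x \<in> V})"
    then obtain m where m: "m \<in> N" "x \<in> carrier G" "m \<otimes> x \<in> V" by blast
    then have "N #> (m \<otimes> x) = N #> x"
      using N.mem_carrier by (simp add: rcos_eq_iff[OF N.subgroup_axioms] m_assoc)
    then show "x \<in> {x \<in> carrier G. N #> x \<in> (\<lambda>x. N #> x) ` V}" using m by (auto simp: image_iff)
  qed
  also have "openin T \<dots>"
    using N.mem_carrier
    by (intro openin_Union ballI, elim imageE, hypsubst)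
      (intro openin_preimage[OF _ V] continuous_map_mult continuous_map_constant continuous_map_ident)
  finally show "openin T {x \<in> carrier G. N #> x \<in> (\<lambda>x. N #> x) ` V}" .
qed

text \<open>The point is continuity of the multiplication. Since the projection is open, a product
  neighbourhood found in \<open>G\<close> can be pushed down to the quotient.\<close>

lemma cohomology_group_quotient:
  assumes "prime p" and N: "N \<lhd> G"
  shows "cohomology_group (G Mod N) (quotient_group_topology G T N) p"
proof -
  interpret N: normal N G by fact
  let ?Q = "quotient_group_topology G T N"
  have "continuous_map (prod_topology ?Q ?Q) ?Q (\<lambda>(x, y). x \<otimes>\<^bsub>G Mod N\<^esub> y)"
    unfolding continuous_map_def
  proof (intro conjI allI impI)
    show "(\<lambda>(x, y). x \<otimes>\<^bsub>G Mod N\<^esub> y) \<in> topspace (prod_topology ?Q ?Q) \<rightarrow> topspace ?Q"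
      using monoid.m_closed[OF group.is_monoid[OF N.factorgroup_is_group]] by (auto simp: topspace_quotient)
  next
    fix W assume "openin ?Q W"
    then have W: "openin T {x \<in> carrier G. N #> x \<in> W}" by (simp add: openin_quotient_group_topology)
    let ?P = "{u \<in> topspace (prod_topology T T). (case u of (x, y) \<Rightarrow> x \<otimes> y) \<in> {x \<in> carrier G. N #> x \<in> W}}"
    have P: "openin (prod_topology T T) ?P"
      by (rule openin_continuous_map_preimage[OF continuous_mult W])
    show "openin (prod_topology ?Q ?Q) {u \<in> topspace (prod_topology ?Q ?Q). (case u of (x, y) \<Rightarrow> x \<otimes>\<^bsub>G Mod N\<^esub> y) \<in> W}"
      unfolding openin_prod_topology_alt
    proof (intro allI impI)
      fix A B assume AB: "(A, B) \<in> {u \<in> topspace (prod_topology ?Q ?Q). (case u of (x, y) \<Rightarrow> x \<otimes>\<^bsub>G Mod N\<^esub> y) \<in> W}"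
      then obtain x y where x: "x \<in> carrier G" "A = N #> x" and y: "y \<in> carrier G" "B = N #> y"
        and "A <#> B \<in> W"
        by (auto simp: topspace_quotient carrier_FactGroup)
      then have "(x, y) \<in> ?P" by (simp add: topspace_eq N.rcos_sum)
      then obtain V1 V2 where V: "openin T V1" "openin T V2" "x \<in> V1" "y \<in> V2" "V1 \<times> V2 \<subseteq> ?P"
        using P unfolding openin_prod_topology_alt by meson
      have V12: "V1 \<subseteq> carrier G" "V2 \<subseteq> carrier G"
        using openin_subset[OF V(1)] openin_subset[OF V(2)] topspace_eq by auto
      let ?\<pi> = "\<lambda>x. N #> x"
      have "?\<pi> ` V1 \<times> ?\<pi> ` V2 \<subseteq> {u \<in> topspace (prod_topology ?Q ?Q). (case u of (x, y) \<Rightarrow> x \<otimes>\<^bsub>G Mod N\<^esub> y) \<in> W}"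
      proof clarify
        fix v w assume v: "v \<in> V1" and w: "w \<in> V2"
        then have "(v, w) \<in> ?P" using V(5) by blast
        moreover have "v \<in> carrier G" "w \<in> carrier G" using v w V12 by auto
        ultimately show "(?\<pi> v, ?\<pi> w) \<in> topspace (prod_topology ?Q ?Q) \<and> ?\<pi> v \<otimes>\<^bsub>G Mod N\<^esub> ?\<pi> w \<in> W"
          by (simp add: topspace_quotient carrier_FactGroup N.rcos_sum)
      qed
      then show "\<exists>U V. openin ?Q U \<and> openin ?Q V \<and> A \<in> U \<and> B \<in> V \<and>
          U \<times> V \<subseteq> {u \<in> topspace (prod_topology ?Q ?Q). (case u of (x, y) \<Rightarrow> x \<otimes>\<^bsub>G Mod N\<^esub> y) \<in> W}"
        using openin_quotient_image[OF N V(1)] openin_quotient_image[OF N V(2)] V(3,4) x(2) y(2) by blast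
    qed
  qed
  then show ?thesis
    using assms(1) N.factorgroup_is_group topspace_quotient
    by (intro cohomology_group.intro cohomology_group_axioms.intro) auto
qed

end

section \<open>Transgression\<close>

lemma (in group) cancel_inv:
  "x \<in> carrier G \<Longrightarrow> z \<in> carrier G \<Longrightarrow> inv x \<otimes> (x \<otimes> z) = z"
  "x \<in> carrier G \<Longrightarrow> z \<in> carrier G \<Longrightarrow> x \<otimes> (inv x \<otimes> z) = z"
  by (simp_all add: m_assoc[symmetric])

lemma (in comm_group) commutator_eq_one:
  assumes "x \<in> carrier G" "y \<in> carrier G" shows "commutator G x y = \<one>"
proof -
  have "commutator G x y = inv (y \<otimes> x) \<otimes> (x \<otimes> y)"
    using assms by (simp add: commutator_def inv_mult_group m_assoc)
  also have "x \<otimes> y = y \<otimes> x" using assms by (rule m_comm)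
  finally show ?thesis using assms by simp
qed

lemma mod_add3:
  "(a mod m + b + c) mod m = (a + b + c) mod (m::int)" "(a + b mod m + c) mod m = (a + b + c) mod m"
  by (intro mod_add_cong; simp)+

lemma mod_glue:
  fixes m :: int
  assumes "x mod m = (a + (b + f)) mod m" "f mod m = (v - w + u) mod m"
  shows "(x + w) mod m = ((a + u) mod m + (b + v) mod m) mod m"
proof -
  have "m dvd (x - (a + (b + f))) + (f - (v - w + u))"
    using assms by (intro dvd_add) (simp_all only: mod_eq_dvd_iff)
  also have "(x - (a + (b + f))) + (f - (v - w + u)) = (x + w) - ((a + u) + (b + v))" by simp
  finally have "(x + w) mod m = ((a + u) + (b + v)) mod m" by (simp only: mod_eq_dvd_iff)
  then show ?thesis by (simp only: mod_simps)
qed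

locale lpc_layer = free_profinite_group S T X for S :: "('a, 'm) monoid_scheme" (structure) and T X +
  fixes p n :: nat
  assumes prime_p: "prime p" and n: "2 \<le> n" and X_nonempty: "X \<noteq> {}"
begin

abbreviation N :: "'a set" where "N \<equiv> lpc p n"
abbreviation N' :: "'a set" where "N' \<equiv> lpc p (Suc n)"
abbreviation Q :: "'a set monoid" where "Q \<equiv> S Mod N"
abbreviation A :: "'a set monoid" where "A \<equiv> S\<lparr>carrier := N\<rparr> Mod N'"

sublocale N: normal N S by (rule normal_lpc)
sublocale N': normal N' S by (rule normal_lpc)
sublocale Q: group Q by (rule N.factorgroup_is_group)
sublocale C: cohomology_group Q "quotient_group_topology S T N" p
  by (rule cohomology_group_quotient[OF prime_p normal_lpc])

lemma N'_N: "s \<in> N' \<Longrightarrow> s \<in> N"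
  using lpc_Suc_subset by blast

lemma carrier_A: "carrier A = (\<lambda>s. N' #> s) ` N"
  by (rule carrier_subgroup_Mod)

lemma A_mult: "s \<in> N \<Longrightarrow> t \<in> N \<Longrightarrow> (N' #> s) \<otimes>\<^bsub>A\<^esub> (N' #> t) = N' #> (s \<otimes> t)"
  using N'.rcos_sum[OF N.mem_carrier N.mem_carrier] by (simp add: set_mult_def)

sublocale A: elementary_abelian A p
proof -
  interpret SN: group "S\<lparr>carrier := N\<rparr>" by (rule N.subgroup_is_group) (rule is_group)
  interpret NN: normal N' "S\<lparr>carrier := N\<rparr>"
    using normal_restrict_supergroup[OF subgroup_lpc normal_lpc lpc_Suc_subset] .
  interpret A: group A by (rule NN.factorgroup_is_group)
  have eq: "N' #> s = N' #> t" if "s \<in> N" "t \<in> N" "s \<otimes> inv t \<in> N'" for s t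
    using that N.mem_carrier by (simp add: rcos_eq_iff[OF subgroup_lpc])
  have "comm_group A"
  proof (rule A.group_comm_groupI)
    fix c d assume "c \<in> carrier A" "d \<in> carrier A"
    then obtain s t where st: "s \<in> N" "t \<in> N" "c = N' #> s" "d = N' #> t" by (auto simp: carrier_A)
    have cl: "s \<in> carrier S" "t \<in> carrier S" using st N.mem_carrier by auto
    have "commutator S (inv s) (inv t) \<in> N'" using st(2) cl n by (intro lpc_commutator) auto
    moreover have "commutator S (inv s) (inv t) = (s \<otimes> t) \<otimes> inv (t \<otimes> s)"
      using cl by (simp add: commutator_def inv_mult_group m_assoc)
    ultimately have "N' #> (s \<otimes> t) = N' #> (t \<otimes> s)" using st by (intro eq) auto
    then show "c \<otimes>\<^bsub>A\<^esub> d = d \<otimes>\<^bsub>A\<^esub> c" using st by (simp only: A_mult)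
  qed
  moreover have "c [^]\<^bsub>A\<^esub> p = \<one>\<^bsub>A\<^esub>" if "c \<in> carrier A" for c
  proof -
    obtain s where s: "s \<in> N" "c = N' #> s" using \<open>c \<in> carrier A\<close> by (auto simp: carrier_A)
    have "c [^]\<^bsub>A\<^esub> k = N' #> (s [^] k)" for k :: nat
    proof (induction k)
      case 0
      then show ?case using coset_mult_one[OF N'.subset] by simp
    next
      case (Suc k)
      have "c [^]\<^bsub>A\<^esub> Suc k = (N' #> (s [^] k)) \<otimes>\<^bsub>A\<^esub> (N' #> s)" using Suc s(2) by simp
      also have "\<dots> = N' #> (s [^] k \<otimes> s)"
        using s(1) by (intro A_mult) (induction k; simp)+
      finally show ?case by simp
    qed
    then have "c [^]\<^bsub>A\<^esub> p = N' #> (s [^] p)" .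
    also have "\<dots> = N'"
      using lpc_power[of n s p] s(1) n N'.mem_carrier by (intro coset_join2[OF _ subgroup_lpc]) auto
    finally show ?thesis by simp
  qed
  ultimately show "elementary_abelian A p"
    using prime_p by (intro elementary_abelian.intro elementary_abelian_axioms.intro)
qed

abbreviation Chars :: "('a set \<Rightarrow> int) set" where
  "Chars \<equiv> hom A (integer_mod_group p) \<inter> extensional (carrier A)"

lemma char_range: "\<psi> \<in> Chars \<Longrightarrow> s \<in> N \<Longrightarrow> \<psi> (N' #> s) \<in> {0..<int p}"
  using C.p_pos by (auto simp: hom_def carrier_A carrier_integer_mod_group)

lemma char_mult:
  "\<psi> \<in> Chars \<Longrightarrow> s \<in> N \<Longrightarrow> t \<in> N \<Longrightarrow> \<psi> (N' #> (s \<otimes> t)) = (\<psi> (N' #> s) + \<psi> (N' #> t)) mod int p"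
  by (auto simp: hom_def carrier_A A_mult[symmetric])

lemma char_N':
  assumes "\<psi> \<in> Chars" "s \<in> N'" shows "\<psi> (N' #> s) = 0"
proof -
  interpret \<psi>: group_hom A "integer_mod_group p" \<psi>
    by (intro group_hom.intro group_hom_axioms.intro A.is_group group_integer_mod_group) (use assms in auto)
  have "N' #> s = N'" using assms(2) N'.mem_carrier by (intro coset_join2[OF _ subgroup_lpc]) auto
  then show ?thesis using \<psi>.hom_one by simp
qed

text \<open>Commutators of \<open>S\<close> with \<open>N\<close> lie in \<open>N'\<close>, so
  \<open>S\<close> acts trivially on the layer and every character of it is invariant under
  conjugation.\<close>

lemma char_conj:
  assumes "s \<in> N" "g \<in> carrier S"
  shows "N' #> (g \<otimes> s \<otimes> inv g) = N' #> s"
proof -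
  have sS: "s \<in> carrier S" using assms N.mem_carrier by blast
  have "commutator S (inv g) (inv s) \<in> N'" using assms sS n by (intro lpc_commutator) auto
  moreover have "commutator S (inv g) (inv s) = g \<otimes> s \<otimes> inv g \<otimes> inv s"
    using assms sS by (simp add: commutator_def m_assoc)
  ultimately show ?thesis using assms sS by (simp add: rcos_eq_iff[OF subgroup_lpc])
qed

definition sec :: "'a set \<Rightarrow> 'a" where "sec x = (SOME s. s \<in> x)"

lemma sec: assumes "x \<in> carrier Q" shows "sec x \<in> carrier S" "N #> sec x = x"
proof -
  obtain g where g: "g \<in> carrier S" "x = N #> g" using assms by (auto simp: carrier_FactGroup)
  then have "g \<in> x" using rcos_self[OF g(1) subgroup_lpc] by simp
  then have sx: "sec x \<in> x" unfolding sec_def by (rule someI)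
  then show "sec x \<in> carrier S" using g r_coset_subset_G[OF N.subset] by blast
  show "N #> sec x = x" using repr_independence[OF _ g(1) subgroup_lpc] sx g(2) by simp
qed

end

section \<open>Finite basis: transgression as a bijection\<close>

locale transgression = lpc_layer +
  assumes finite_X: "finite X"
begin

lemma finite_index: "finite (carrier (S Mod N'))" "finite (carrier Q)"
proof -
  have p0: "0 < p" using prime_p by (rule prime_gt_0_nat)
  show "finite (carrier (S Mod N'))" using lpc_index[OF p0 X_nonempty finite_X, of n] by blast
  obtain m where "n = Suc m" using n by (cases n) auto
  then show "finite (carrier Q)" using lpc_index[OF p0 X_nonempty finite_X, of m] by auto
qed

text \<open>This is where finiteness of \<open>X\<close> is spent. Openness of \<open>N\<close>
  makes the quotient discrete, so that every function into the residues is a cochain.\<close>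

lemma open_N: "openin T N" and open_N': "openin T N'"
  by (rule openin_finite_index[OF closedin_lpc subgroup_lpc] finite_index)+

definition factor_set :: "'a set \<Rightarrow> 'a set \<Rightarrow> 'a" where
  "factor_set x y = sec x \<otimes> sec y \<otimes> inv sec (x \<otimes>\<^bsub>Q\<^esub> y)"

lemma factor_set_N:
  assumes "x \<in> carrier Q" "y \<in> carrier Q" shows "factor_set x y \<in> N"
proof -
  have xy: "x \<otimes>\<^bsub>Q\<^esub> y \<in> carrier Q" using assms by (rule Q.m_closed)
  have "N #> (sec x \<otimes> sec y) = N #> sec (x \<otimes>\<^bsub>Q\<^esub> y)"
    using sec[OF assms(1)] sec[OF assms(2)] sec[OF xy] N.rcos_sum[of "sec x" "sec y"] by simp
  then show ?thesis
    unfolding factor_set_def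
    by (rule iffD1[OF rcos_eq_iff[OF subgroup_lpc m_closed[OF sec(1)[OF assms(1)] sec(1)[OF assms(2)]] sec(1)[OF xy]]])
qed

lemma sec_mult:
  assumes "x \<in> carrier Q" "y \<in> carrier Q" shows "sec x \<otimes> sec y = factor_set x y \<otimes> sec (x \<otimes>\<^bsub>Q\<^esub> y)"
  using sec(1)[OF assms(1)] sec(1)[OF assms(2)] sec(1)[OF Q.m_closed[OF assms]]
  by (simp add: factor_set_def m_assoc)

text \<open>The factor set of the extension of \<open>Q\<close> by the layer \<open>A\<close>,
  pushed forward along a character; up to sign this is the classical transgression.\<close>

definition transgress :: "('a set \<Rightarrow> int) \<Rightarrow> 'a set \<times> 'a set \<Rightarrow> int" where
  "transgress \<psi> = (\<lambda>(x, y)\<in>carrier Q \<times> carrier Q. \<psi> (N' #> factor_set x y))"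

lemma cochains_discrete:
  "f \<in> cochains2 Q (quotient_group_topology S T N) p \<longleftrightarrow>
     f \<in> extensional (carrier Q \<times> carrier Q) \<and> f \<in> carrier Q \<times> carrier Q \<rightarrow> {0..<int p}"
  "c \<in> cochains1 Q (quotient_group_topology S T N) p \<longleftrightarrow>
     c \<in> extensional (carrier Q) \<and> c \<in> carrier Q \<rightarrow> {0..<int p}"
  by (simp_all only: C.cochains1_iff C.cochains2_iff)
    (auto simp: quotient_topology_discrete[OF open_N normal_lpc] prod_topology_discrete_topology[symmetric])

text \<open>Associativity of \<open>sec x * sec y * sec z\<close> gives the cocycle identity for
  factor sets, twisted by conjugation with \<open>sec x\<close>; \<open>char_conj\<close> removes
  the twist.\<close>

lemma transgress_cocycle:
  assumes \<psi>: "\<psi> \<in> Chars"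
  shows "transgress \<psi> \<in> cocycles2 Q (quotient_group_topology S T N) p"
  unfolding C.cocycles2_iff cochains_discrete
proof (intro conjI)
  show "transgress \<psi> \<in> extensional (carrier Q \<times> carrier Q)" by (simp add: transgress_def)
  show "transgress \<psi> \<in> carrier Q \<times> carrier Q \<rightarrow> {0..<int p}"
    using char_range[OF \<psi> factor_set_N] by (auto simp: transgress_def)
  show "C.cocycle (transgress \<psi>)"
    unfolding C.cocycle_def
  proof (intro ballI)
    fix x y z assume xyz: "x \<in> carrier Q" "y \<in> carrier Q" "z \<in> carrier Q"
    have xy: "x \<otimes>\<^bsub>Q\<^esub> y \<in> carrier Q" and yz: "y \<otimes>\<^bsub>Q\<^esub> z \<in> carrier Q"
      by (rule Q.m_closed[OF xyz(1,2)], rule Q.m_closed[OF xyz(2,3)])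
    have ass: "x \<otimes>\<^bsub>Q\<^esub> (y \<otimes>\<^bsub>Q\<^esub> z) = x \<otimes>\<^bsub>Q\<^esub> y \<otimes>\<^bsub>Q\<^esub> z" by (rule Q.m_assoc[OF xyz, symmetric])
    have cl: "sec x \<in> carrier S" "sec y \<in> carrier S" "sec z \<in> carrier S"
      "sec (x \<otimes>\<^bsub>Q\<^esub> y) \<in> carrier S" "sec (y \<otimes>\<^bsub>Q\<^esub> z) \<in> carrier S" "sec (x \<otimes>\<^bsub>Q\<^esub> y \<otimes>\<^bsub>Q\<^esub> z) \<in> carrier S"
      by (rule sec(1), fact xyz xy yz Q.m_closed[OF xy xyz(3)])+
    let ?c = "sec x \<otimes> factor_set y z \<otimes> inv sec x"
    have "factor_set x y \<otimes> factor_set (x \<otimes>\<^bsub>Q\<^esub> y) z = sec x \<otimes> sec y \<otimes> sec z \<otimes> inv sec (x \<otimes>\<^bsub>Q\<^esub> y \<otimes>\<^bsub>Q\<^esub> z)"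
      unfolding factor_set_def using cl by (simp add: m_assoc inv_mult_group cancel_inv del: mult_FactGroup)
    also have "\<dots> = ?c \<otimes> factor_set x (y \<otimes>\<^bsub>Q\<^esub> z)"
      unfolding factor_set_def ass using cl by (simp add: m_assoc inv_mult_group cancel_inv del: mult_FactGroup)
    finally have eq: "factor_set x y \<otimes> factor_set (x \<otimes>\<^bsub>Q\<^esub> y) z = ?c \<otimes> factor_set x (y \<otimes>\<^bsub>Q\<^esub> z)" .
    have cN: "?c \<in> N" using N.inv_op_closed2[OF cl(1) factor_set_N[OF xyz(2,3)]] .
    have "(\<psi> (N' #> factor_set x y) + \<psi> (N' #> factor_set (x \<otimes>\<^bsub>Q\<^esub> y) z)) mod int p =
        (\<psi> (N' #> factor_set y z) + \<psi> (N' #> factor_set x (y \<otimes>\<^bsub>Q\<^esub> z))) mod int p"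
      using arg_cong[OF eq, of "\<lambda>s. \<psi> (N' #> s)"]
      unfolding char_mult[OF \<psi> factor_set_N[OF xyz(1,2)] factor_set_N[OF xy xyz(3)]]
        char_mult[OF \<psi> cN factor_set_N[OF xyz(1) yz]] char_conj[OF factor_set_N[OF xyz(2,3)] cl(1)] .
    then have "int p dvd (\<psi> (N' #> factor_set y z) + \<psi> (N' #> factor_set x (y \<otimes>\<^bsub>Q\<^esub> z)))
        - (\<psi> (N' #> factor_set x y) + \<psi> (N' #> factor_set (x \<otimes>\<^bsub>Q\<^esub> y) z))"
      by (metis mod_eq_dvd_iff)
    also have "(\<psi> (N' #> factor_set y z) + \<psi> (N' #> factor_set x (y \<otimes>\<^bsub>Q\<^esub> z)))
        - (\<psi> (N' #> factor_set x y) + \<psi> (N' #> factor_set (x \<otimes>\<^bsub>Q\<^esub> y) z)) =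
        transgress \<psi> (y, z) - transgress \<psi> (x \<otimes>\<^bsub>Q\<^esub> y, z) + transgress \<psi> (x, y \<otimes>\<^bsub>Q\<^esub> z) - transgress \<psi> (x, y)"
      using xyz xy yz by (simp add: transgress_def del: mult_FactGroup)
    finally show "int p dvd transgress \<psi> (y, z) - transgress \<psi> (x \<otimes>\<^bsub>Q\<^esub> y, z) + transgress \<psi> (x, y \<otimes>\<^bsub>Q\<^esub> z) - transgress \<psi> (x, y)" .
  qed
qed

text \<open>
  A cochain bounding the difference of two transgressed characters glues with it to a homomorphism
  \<open>S \<rightarrow> \<int>/p\<close>; such a homomorphism vanishes on \<open>N\<close> because \<open>n \<ge> 2\<close>.
\<close>

lemma transgress_inj:
  assumes \<psi>: "\<psi> \<in> Chars" and \<psi>': "\<psi>' \<in> Chars"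
    and c: "c \<in> cochains1 Q (quotient_group_topology S T N) p"
    and bound: "\<And>x y. x \<in> carrier Q \<Longrightarrow> y \<in> carrier Q \<Longrightarrow>
      int p dvd transgress \<psi> (x, y) - transgress \<psi>' (x, y) - (c y - c (x \<otimes>\<^bsub>Q\<^esub> y) + c x)"
  shows "\<psi> = \<psi>'"
proof -
  let ?Zp = "integer_mod_group p"
  let ?d = "\<lambda>s. \<psi> (N' #> s) - \<psi>' (N' #> s)"
  have d_mult: "?d (s \<otimes> t) mod int p = (?d s + ?d t) mod int p" if "s \<in> N" "t \<in> N" for s t
    unfolding char_mult[OF \<psi> that] char_mult[OF \<psi>' that] by (simp add: mod_simps algebra_simps)
  let ?\<pi> = "\<lambda>s. N #> s"
  let ?r = "\<lambda>s. s \<otimes> inv sec (?\<pi> s)"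
  have \<pi>Q: "?\<pi> s \<in> carrier Q" if "s \<in> carrier S" for s using that by (auto simp: carrier_FactGroup)
  have r: "?r s \<in> N" "s = ?r s \<otimes> sec (?\<pi> s)" if "s \<in> carrier S" for s
  proof -
    have "?\<pi> s = ?\<pi> (sec (?\<pi> s))" using sec(2)[OF \<pi>Q[OF that]] by simp
    then show "?r s \<in> N" using that sec(1)[OF \<pi>Q[OF that]] rcos_eq_iff[OF subgroup_lpc] by blast
    show "s = ?r s \<otimes> sec (?\<pi> s)" using that sec(1)[OF \<pi>Q[OF that]] by (simp add: m_assoc)
  qed
  \<comment> \<open>Writing \<open>s = ?r s * sec (?\<pi> s)\<close>, the difference
    \<open>?d\<close> is evaluated on the factor in \<open>N\<close> and \<open>c\<close> on the
    coset. The coboundary relation cancels the factor set that appears in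
    \<open>?r (s * t)\<close>.\<close>
  define e where "e = (\<lambda>s. (?d (?r s) + c (?\<pi> s)) mod int p)"
  have e_mult: "e (s \<otimes> t) = (e s + e t) mod int p" if s: "s \<in> carrier S" and t: "t \<in> carrier S" for s t
  proof -
    let ?x = "?\<pi> s" and ?y = "?\<pi> t"
    have xy: "?x \<in> carrier Q" "?y \<in> carrier Q" using \<pi>Q s t by auto
    have sx: "sec ?x \<in> carrier S" "sec ?y \<in> carrier S" using sec(1) xy by auto
    have \<pi>st: "?\<pi> (s \<otimes> t) = ?x \<otimes>\<^bsub>Q\<^esub> ?y" using N.rcos_sum[OF s t] by simp
    have sxy: "sec (?x \<otimes>\<^bsub>Q\<^esub> ?y) \<in> carrier S" using sec(1)[OF Q.m_closed[OF xy]] .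
    let ?b = "sec ?x \<otimes> ?r t \<otimes> inv sec ?x"
    have bN: "?b \<in> N" using N.inv_op_closed2[OF sx(1) r(1)[OF t]] .
    have "?r (s \<otimes> t) = ?r s \<otimes> (?b \<otimes> factor_set ?x ?y)"
      unfolding \<pi>st factor_set_def using s t sx sxy by (simp add: m_assoc inv_mult_group cancel_inv del: mult_FactGroup)
    then have "?d (?r (s \<otimes> t)) mod int p = (?d (?r s) + ?d (?b \<otimes> factor_set ?x ?y)) mod int p"
      using d_mult[OF r(1)[OF s] N.m_closed[OF bN factor_set_N[OF xy]]] by simp
    also have "\<dots> = (?d (?r s) + (?d ?b + ?d (factor_set ?x ?y))) mod int p"
      by (rule mod_add_cong[OF refl d_mult[OF bN factor_set_N[OF xy]]])
    also have "?d ?b = ?d (?r t)" unfolding char_conj[OF r(1)[OF t] sx(1)] ..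
    finally have 1: "?d (?r (s \<otimes> t)) mod int p = (?d (?r s) + (?d (?r t) + ?d (factor_set ?x ?y))) mod int p" .
    have "int p dvd ?d (factor_set ?x ?y) - (c ?y - c (?x \<otimes>\<^bsub>Q\<^esub> ?y) + c ?x)"
      using bound[OF xy] xy by (simp add: transgress_def del: mult_FactGroup)
    then have 2: "?d (factor_set ?x ?y) mod int p = (c ?y - c (?x \<otimes>\<^bsub>Q\<^esub> ?y) + c ?x) mod int p"
      by (simp add: mod_eq_dvd_iff)
    show ?thesis unfolding e_def \<pi>st by (rule mod_glue[OF 1[unfolded \<pi>st] 2])
  qed
  have e_range: "e s \<in> {0..<int p}" for s using C.p_pos by (simp add: e_def)
  have e_hom: "e \<in> hom S ?Zp"
    using e_mult e_range C.p_pos by (auto simp: hom_def carrier_integer_mod_group)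
  interpret e: group_hom S ?Zp e
    by (intro group_hom.intro group_hom_axioms.intro is_group group_integer_mod_group e_hom)
  have e_N: "e s = ?d s mod int p" if s: "s \<in> N" for s
  proof -
    have sS: "s \<in> carrier S" using s N.mem_carrier by blast
    have \<pi>1: "?\<pi> s = ?\<pi> \<one>"
      using coset_join2[OF sS subgroup_lpc s] coset_mult_one[OF N.subset] by simp
    \<comment> \<open>The section is not normalized at the unit coset; the resulting constant is
      absorbed by \<open>e \<one> = 0\<close>.\<close>
    let ?w = "inv sec (?\<pi> \<one>)"
    have w: "?w \<in> N" using r(1)[OF one_closed] sec(1)[OF \<pi>Q[OF one_closed]] by simp
    have "e s = (?d (s \<otimes> ?w) mod int p + c (?\<pi> \<one>)) mod int p" unfolding e_def \<pi>1 by (simp only: mod_simps)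
    also have "\<dots> = (?d s + (?d ?w + c (?\<pi> \<one>)) mod int p) mod int p"
      unfolding d_mult[OF s w] by (simp only: mod_simps add.assoc)
    also have "(?d ?w + c (?\<pi> \<one>)) mod int p = e \<one>"
      unfolding e_def using sec(1)[OF \<pi>Q[OF one_closed]] by simp
    also have "e \<one> = 0" using e.hom_one by simp
    finally show ?thesis by simp
  qed
  have "openin T {s \<in> carrier S. e s \<in> C}" for C
  proof (rule openin_coset_saturated[OF open_N' subgroup_lpc])
    fix s \<nu> assume s: "s \<in> {s \<in> carrier S. e s \<in> C}" and \<nu>: "\<nu> \<in> N'"
    have "e \<nu> = 0" using e_N[OF N'_N[OF \<nu>]] char_N'[OF \<psi> \<nu>] char_N'[OF \<psi>' \<nu>] by simp
    then have "e (s \<otimes> \<nu>) = e s"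
      using s N'.mem_carrier[OF \<nu>] e_mult[of s \<nu>] e_range[of s] by simp
    then show "s \<otimes> \<nu> \<in> {s \<in> carrier S. e s \<in> C}" using s N'.mem_carrier[OF \<nu>] by simp
  qed auto
  note op = this
  interpret Zp: comm_group ?Zp by simp
  let ?K = "{s \<in> carrier S. e s \<in> {0}}"
  have "lpc p (Suc 1) \<subseteq> ?K"
  proof (rule lpc_minimal)
    show "subgroup ?K S"
    proof (rule subgroupI)
      have "\<one> \<in> ?K" using e.hom_one by simp
      then show "?K \<noteq> {}" by blast
      fix s assume s: "s \<in> ?K"
      then show "inv s \<in> ?K"
        using e_mult[of "inv s" s] e_range[of "inv s"] e.hom_one by simp
      fix t assume "t \<in> ?K"
      then show "s \<otimes> t \<in> ?K" using s e_mult by simp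
    qed auto
    show "closedin T ?K" by (rule closedin_hom_preimage[OF op])
  next
    fix s assume s: "s \<in> lpc p 1"
    then have sS: "s \<in> carrier S" by simp
    then show "s [^] p \<in> ?K" by (simp add: e.hom_nat_pow)
    fix g assume "g \<in> carrier S"
    then show "commutator S g s \<in> ?K"
      using sS e.hom_commutator[of g s] Zp.commutator_eq_one[of "e g" "e s"] by simp
  qed simp
  moreover have "N \<subseteq> lpc p (Suc 1)" using n by (intro lpc_antimono) simp
  ultimately have e0: "e s = 0" if "s \<in> N" for s using that by auto
  have "\<psi> (N' #> s) = \<psi>' (N' #> s)" if s: "s \<in> N" for s
  proof -
    have "(\<psi> (N' #> s) - \<psi>' (N' #> s)) mod int p = 0" using e0[OF s] e_N[OF s] by simp
    then have "\<psi> (N' #> s) mod int p = \<psi>' (N' #> s) mod int p" by (simp add: mod_eq_dvd_iff dvd_eq_mod_eq_0)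
    then show ?thesis using char_range[OF \<psi> s] char_range[OF \<psi>' s] by simp
  qed
  then show ?thesis using \<psi> \<psi>' by (intro extensionalityI[where A = "carrier A"]) (auto simp: carrier_A)
qed

text \<open>
  The extension of \<^term>\<open>Q\<close> by \<open>\<int>/p\<close> given by a cocycle \<open>g\<close>; no normalization of \<open>g\<close> is assumed,
  so the unit has first component \<open>- g (1, 1)\<close>.
\<close>

definition ext_group :: "('a set \<times> 'a set \<Rightarrow> int) \<Rightarrow> (int \<times> 'a set) monoid" where
  "ext_group g = \<lparr>carrier = {0..<int p} \<times> carrier Q,
     mult = (\<lambda>(a, x) (b, y). ((a + b + g (x, y)) mod int p, x \<otimes>\<^bsub>Q\<^esub> y)),
     one = ((- g (\<one>\<^bsub>Q\<^esub>, \<one>\<^bsub>Q\<^esub>)) mod int p, \<one>\<^bsub>Q\<^esub>)\<rparr>"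

text \<open>The cocycle identity at \<open>(1, 1, x)\<close> and at
  \<open>(x, 1, 1)\<close>.\<close>

lemma cocycle_unit:
  assumes "C.cocycle g" "x \<in> carrier Q"
  shows "int p dvd g (\<one>\<^bsub>Q\<^esub>, x) - g (\<one>\<^bsub>Q\<^esub>, \<one>\<^bsub>Q\<^esub>)" "int p dvd g (x, \<one>\<^bsub>Q\<^esub>) - g (\<one>\<^bsub>Q\<^esub>, \<one>\<^bsub>Q\<^esub>)"
proof -
  have "int p dvd g (\<one>\<^bsub>Q\<^esub>, x) - g (\<one>\<^bsub>Q\<^esub> \<otimes>\<^bsub>Q\<^esub> \<one>\<^bsub>Q\<^esub>, x) + g (\<one>\<^bsub>Q\<^esub>, \<one>\<^bsub>Q\<^esub> \<otimes>\<^bsub>Q\<^esub> x) - g (\<one>\<^bsub>Q\<^esub>, \<one>\<^bsub>Q\<^esub>)"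
    "int p dvd g (\<one>\<^bsub>Q\<^esub>, \<one>\<^bsub>Q\<^esub>) - g (x \<otimes>\<^bsub>Q\<^esub> \<one>\<^bsub>Q\<^esub>, \<one>\<^bsub>Q\<^esub>) + g (x, \<one>\<^bsub>Q\<^esub> \<otimes>\<^bsub>Q\<^esub> \<one>\<^bsub>Q\<^esub>) - g (x, \<one>\<^bsub>Q\<^esub>)"
    using assms Q.one_closed unfolding C.cocycle_def by blast+
  then have "int p dvd g (\<one>\<^bsub>Q\<^esub>, x) - g (\<one>\<^bsub>Q\<^esub>, \<one>\<^bsub>Q\<^esub>)" "int p dvd g (\<one>\<^bsub>Q\<^esub>, \<one>\<^bsub>Q\<^esub>) - g (x, \<one>\<^bsub>Q\<^esub>)"
    using assms(2) by (simp_all only: Q.l_one Q.r_one Q.one_closed) (simp_all add: algebra_simps)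
  then show "int p dvd g (\<one>\<^bsub>Q\<^esub>, x) - g (\<one>\<^bsub>Q\<^esub>, \<one>\<^bsub>Q\<^esub>)" "int p dvd g (x, \<one>\<^bsub>Q\<^esub>) - g (\<one>\<^bsub>Q\<^esub>, \<one>\<^bsub>Q\<^esub>)"
    by (simp_all only: dvd_diff_commute)
qed

lemma group_ext_group:
  assumes g: "C.cocycle g"
  shows "group (ext_group g)"
proof (rule groupI)
  fix u v assume "u \<in> carrier (ext_group g)" "v \<in> carrier (ext_group g)"
  then show "u \<otimes>\<^bsub>ext_group g\<^esub> v \<in> carrier (ext_group g)"
    using C.p_pos Q.m_closed by (auto simp: ext_group_def simp del: mult_FactGroup)
next
  show "\<one>\<^bsub>ext_group g\<^esub> \<in> carrier (ext_group g)"
    using C.p_pos Q.one_closed by (auto simp: ext_group_def simp del: one_FactGroup)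
next
  fix u v w
  assume "u \<in> carrier (ext_group g)" "v \<in> carrier (ext_group g)" "w \<in> carrier (ext_group g)"
  then obtain a x b y c z where uvw: "u = (a, x)" "v = (b, y)" "w = (c, z)"
    and xyz: "x \<in> carrier Q" "y \<in> carrier Q" "z \<in> carrier Q"
    by (auto simp: ext_group_def)
  have "int p dvd g (y, z) - g (x \<otimes>\<^bsub>Q\<^esub> y, z) + g (x, y \<otimes>\<^bsub>Q\<^esub> z) - g (x, y)"
    using g xyz unfolding C.cocycle_def by blast
  also have "g (y, z) - g (x \<otimes>\<^bsub>Q\<^esub> y, z) + g (x, y \<otimes>\<^bsub>Q\<^esub> z) - g (x, y) =
      (a + (b + c + g (y, z)) + g (x, y \<otimes>\<^bsub>Q\<^esub> z)) - ((a + b + g (x, y)) + c + g (x \<otimes>\<^bsub>Q\<^esub> y, z))" by simp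
  finally have "((a + b + g (x, y)) + c + g (x \<otimes>\<^bsub>Q\<^esub> y, z)) mod int p =
      (a + (b + c + g (y, z)) + g (x, y \<otimes>\<^bsub>Q\<^esub> z)) mod int p"
    by (metis mod_eq_dvd_iff)
  then have "((a + b + g (x, y)) mod int p + c + g (x \<otimes>\<^bsub>Q\<^esub> y, z)) mod int p =
      (a + (b + c + g (y, z)) mod int p + g (x, y \<otimes>\<^bsub>Q\<^esub> z)) mod int p"
    by (simp only: mod_add3)
  then show "u \<otimes>\<^bsub>ext_group g\<^esub> v \<otimes>\<^bsub>ext_group g\<^esub> w = u \<otimes>\<^bsub>ext_group g\<^esub> (v \<otimes>\<^bsub>ext_group g\<^esub> w)"
    using Q.m_assoc[OF xyz] by (simp add: uvw ext_group_def del: mult_FactGroup)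
next
  fix u assume "u \<in> carrier (ext_group g)"
  then obtain a x where u: "u = (a, x)" "a \<in> {0..<int p}" "x \<in> carrier Q" by (auto simp: ext_group_def)
  have "((- g (\<one>\<^bsub>Q\<^esub>, \<one>\<^bsub>Q\<^esub>)) mod int p + a + g (\<one>\<^bsub>Q\<^esub>, x)) mod int p =
      (a + (g (\<one>\<^bsub>Q\<^esub>, x) - g (\<one>\<^bsub>Q\<^esub>, \<one>\<^bsub>Q\<^esub>))) mod int p"
    unfolding mod_add3 by (simp add: algebra_simps del: one_FactGroup)
  also have "\<dots> = a" using cocycle_unit(1)[OF g u(3)] u(2) by auto
  finally show "\<one>\<^bsub>ext_group g\<^esub> \<otimes>\<^bsub>ext_group g\<^esub> u = u"
    using Q.l_one[OF u(3)] by (simp add: u(1) ext_group_def del: one_FactGroup mult_FactGroup)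
  let ?b = "(- g (\<one>\<^bsub>Q\<^esub>, \<one>\<^bsub>Q\<^esub>) - a - g (inv\<^bsub>Q\<^esub> x, x)) mod int p"
  have "(?b + a + g (inv\<^bsub>Q\<^esub> x, x)) mod int p = (- g (\<one>\<^bsub>Q\<^esub>, \<one>\<^bsub>Q\<^esub>)) mod int p"
    unfolding mod_add3 by (simp del: one_FactGroup)
  then have "(?b, inv\<^bsub>Q\<^esub> x) \<otimes>\<^bsub>ext_group g\<^esub> u = \<one>\<^bsub>ext_group g\<^esub>"
    using Q.l_inv[OF u(3)] by (simp add: u(1) ext_group_def del: one_FactGroup mult_FactGroup)
  moreover have "(?b, inv\<^bsub>Q\<^esub> x) \<in> carrier (ext_group g)"
    using C.p_pos Q.inv_closed[OF u(3)] by (simp add: ext_group_def)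
  ultimately show "\<exists>v\<in>carrier (ext_group g). v \<otimes>\<^bsub>ext_group g\<^esub> u = \<one>\<^bsub>ext_group g\<^esub>" by blast
qed

text \<open>Freeness lifts the projection from \<open>S\<close> to \<open>Q\<close> to a
  homomorphism into the extension defined by \<open>g\<close>. Its restriction to \<open>N\<close>
  lands in the central copy of the residues and gives the character; its first component on the
  section gives the cochain.\<close>

lemma transgress_surj:
  assumes g: "g \<in> cocycles2 Q (quotient_group_topology S T N) p"
  shows "\<exists>\<psi>\<in>Chars. \<exists>c\<in>cochains1 Q (quotient_group_topology S T N) p. \<forall>x\<in>carrier Q. \<forall>y\<in>carrier Q.
    int p dvd g (x, y) - transgress \<psi> (x, y) - (c y - c (x \<otimes>\<^bsub>Q\<^esub> y) + c x)"
proof -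
  have gc: "C.cocycle g" using g by (simp add: C.cocycles2_iff)
  let ?E = "ext_group g"
  let ?\<pi> = "\<lambda>s. N #> s"
  let ?g1 = "g (\<one>\<^bsub>Q\<^esub>, \<one>\<^bsub>Q\<^esub>)"
  interpret E: group ?E using gc by (rule group_ext_group)
  have E_mult: "u \<otimes>\<^bsub>?E\<^esub> v = ((fst u + fst v + g (snd u, snd v)) mod int p, snd u \<otimes>\<^bsub>Q\<^esub> snd v)" for u v
    by (simp add: ext_group_def case_prod_unfold)
  have E_one: "\<one>\<^bsub>?E\<^esub> = ((- ?g1) mod int p, \<one>\<^bsub>Q\<^esub>)" by (simp add: ext_group_def)
  have \<pi>Q: "?\<pi> s \<in> carrier Q" if "s \<in> carrier S" for s using that by (auto simp: carrier_FactGroup)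
  have finE: "finite (carrier ?E)" using finite_index(2) by (simp add: ext_group_def)
  have "(\<lambda>x. (0, ?\<pi> x)) \<in> X \<rightarrow> carrier ?E"
    using \<pi>Q basis_subset C.p_pos by (auto simp: ext_group_def)
  from lift_finite[OF X_nonempty group_ext_group[OF gc] finE this] finite_X
  obtain h where h: "h \<in> hom S ?E" "\<And>x. x \<in> X \<Longrightarrow> h x = (0, ?\<pi> x)"
    and op: "\<And>C. openin T {s \<in> carrier S. h s \<in> C}"
    by auto
  interpret h: group_hom S ?E h by (intro group_hom.intro group_hom_axioms.intro is_group E.is_group h)
  interpret \<pi>: group_hom S Q ?\<pi>
    by (intro group_hom.intro group_hom_axioms.intro is_group Q.is_group N.r_coset_hom_Mod)
  have hE: "fst (h s) \<in> {0..<int p}" "snd (h s) \<in> carrier Q" if "s \<in> carrier S" for s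
    using h.hom_closed[OF that] by (auto simp: ext_group_def)
  let ?K = "{s \<in> carrier S. snd (h s) = ?\<pi> s}"
  have h_snd: "snd (h s) = ?\<pi> s" if "s \<in> carrier S" for s
  proof -
    have "closed_generate S T X \<subseteq> ?K"
    proof (rule closed_generate_minimal)
      show "subgroup ?K S"
      proof (rule subgroupI)
        have "snd (h \<one>) = ?\<pi> \<one>" using E_one h.hom_one coset_mult_one[OF N.subset] by simp
        then show "?K \<noteq> {}" by blast
        fix s assume s: "s \<in> ?K"
        have "snd (h (inv s)) \<otimes>\<^bsub>Q\<^esub> snd (h s) = snd (h (inv s \<otimes> s))"
          using s h.hom_mult[of "inv s" s] by (simp add: E_mult)
        also have "\<dots> = \<one>\<^bsub>Q\<^esub>" using s E_one h.hom_one by simp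
        finally have "inv\<^bsub>Q\<^esub> snd (h s) = snd (h (inv s))"
          using s hE(2)[of s] hE(2)[of "inv s"] by (intro Q.inv_equality) auto
        then show "inv s \<in> ?K" using s \<pi>.hom_inv[of s] by simp
        fix t assume "t \<in> ?K"
        then show "s \<otimes> t \<in> ?K" using s N.rcos_sum[of s t] by (simp add: E_mult)
      qed auto
      have "carrier S - ?K = (\<Union>y\<in>carrier Q. {s \<in> carrier S. ?\<pi> s \<in> {y}} \<inter> {s \<in> carrier S. h s \<in> {u. snd u \<noteq> y}})"
        using \<pi>Q by auto
      also have "openin T \<dots>"
        by (intro openin_Union ballI, elim imageE, hypsubst)
          (intro openin_Int op openin_normal_preimage[OF open_N normal_lpc])
      finally have "closedin T (topspace T - (carrier S - ?K))"
        by (rule closedin_diff[OF closedin_topspace])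
      also have "topspace T - (carrier S - ?K) = ?K" unfolding topspace_eq by blast
      finally show "closedin T ?K" .
      show "X \<subseteq> ?K" using h(2) basis_subset by auto
    qed
    then show ?thesis using that basis_generates by auto
  qed
  have snd_N: "snd (h s) = \<one>\<^bsub>Q\<^esub>" if "s \<in> N" for s
    using h_snd coset_join2[OF _ subgroup_lpc that] N.mem_carrier[OF that] by simp
  \<comment> \<open>The shift by \<open>?g1\<close> compensates for the unit of \<open>?E\<close>
    having first component \<open>- ?g1\<close>; it makes the function additive on
    \<open>N\<close>.\<close>
  define \<psi>0 where "\<psi>0 = (\<lambda>s. (fst (h s) + ?g1) mod int p)"
  have h_N: "h s = ((\<psi>0 s - ?g1) mod int p, \<one>\<^bsub>Q\<^esub>)" if s: "s \<in> N" for s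
  proof -
    have "(\<psi>0 s - ?g1) mod int p = fst (h s)"
      unfolding \<psi>0_def using hE(1)[OF N.mem_carrier[OF s]] by (simp add: mod_simps)
    then show ?thesis using snd_N[OF s] by (simp add: prod_eq_iff del: one_FactGroup)
  qed
  have \<psi>0_mult: "\<psi>0 (s \<otimes> t) = (\<psi>0 s + \<psi>0 t) mod int p" if "s \<in> N" "t \<in> N" for s t
  proof -
    have f: "fst (h (s \<otimes> t)) = (fst (h s) + fst (h t) + ?g1) mod int p"
      using that N.mem_carrier snd_N Q.one_closed by (simp add: E_mult del: one_FactGroup)
    show ?thesis unfolding \<psi>0_def f mod_add_left_eq mod_add_right_eq by (simp only: ac_simps)
  qed
  have h_one_iff: "h s = \<one>\<^bsub>?E\<^esub>" if "s \<in> N" "\<psi>0 s = 0" for s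
    using h_N[OF that(1)] that(2) E_one by simp
  have \<psi>0_one: "\<psi>0 \<one> = 0" unfolding \<psi>0_def h.hom_one E_one by (simp add: mod_simps)
  have \<psi>0_pow: "\<psi>0 (s [^] k) = (int k * \<psi>0 s) mod int p" if "s \<in> N" for s and k :: nat
  proof (induction k)
    case (Suc k)
    have "s [^] k \<in> N" using that by (induction k) simp_all
    then have "\<psi>0 (s [^] Suc k) = ((int k * \<psi>0 s) mod int p + \<psi>0 s) mod int p"
      using Suc \<psi>0_mult[of "s [^] k" s] that by simp
    then show ?case by (simp only: mod_add_left_eq) (simp add: algebra_simps)
  qed (simp add: \<psi>0_one)
  \<comment> \<open>Both \<open>g (x, 1)\<close> and \<open>g (1, x)\<close> are congruent to
    \<open>g (1, 1)\<close>, so elements over the unit of \<open>Q\<close> commute with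
    everything.\<close>
  have central: "u \<otimes>\<^bsub>?E\<^esub> h s = h s \<otimes>\<^bsub>?E\<^esub> u" if s: "s \<in> N" and u: "u \<in> carrier ?E" for s u
  proof -
    have x: "snd u \<in> carrier Q" using u by (auto simp: ext_group_def)
    have "int p dvd g (snd u, \<one>\<^bsub>Q\<^esub>) - g (\<one>\<^bsub>Q\<^esub>, snd u)"
      using dvd_diff[OF cocycle_unit(2)[OF gc x] cocycle_unit(1)[OF gc x]] by simp
    then have "int p dvd (fst u + fst (h s) + g (snd u, \<one>\<^bsub>Q\<^esub>)) - (fst (h s) + fst u + g (\<one>\<^bsub>Q\<^esub>, snd u))"
      by simp
    then show ?thesis
      unfolding E_mult snd_N[OF s] Q.l_one[OF x] Q.r_one[OF x] by (simp only: mod_eq_dvd_iff[symmetric])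
  qed
  have hN': "h s = \<one>\<^bsub>?E\<^esub>" if "s \<in> N'" for s
  proof -
    let ?L = "{s \<in> carrier S. h s \<in> {\<one>\<^bsub>?E\<^esub>}}"
    have "N' \<subseteq> ?L"
    proof (rule lpc_minimal)
      show "subgroup ?L S" using h.subgroup_kernel by (simp add: kernel_def)
      show "closedin T ?L" by (rule closedin_hom_preimage[OF op])
    next
      fix s assume s: "s \<in> N"
      have "s [^] p \<in> N" using lpc_power[of n s p] n s N'_N by simp
      moreover have "\<psi>0 (s [^] p) = 0" unfolding \<psi>0_pow[OF s] by simp
      ultimately have "h (s [^] p) = \<one>\<^bsub>?E\<^esub>" by (rule h_one_iff)
      then show "s [^] p \<in> ?L" using N.mem_carrier[OF s] by simp
      fix t assume t: "t \<in> carrier S"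
      have sS: "s \<in> carrier S" using N.mem_carrier[OF s] .
      have "h t \<otimes>\<^bsub>?E\<^esub> h s = h s \<otimes>\<^bsub>?E\<^esub> h t" by (rule central[OF s h.hom_closed[OF t]])
      then have "h s \<otimes>\<^bsub>?E\<^esub> h t = h s \<otimes>\<^bsub>?E\<^esub> h t \<otimes>\<^bsub>?E\<^esub> commutator ?E (h t) (h s)"
        using E.mult_commutator[OF h.hom_closed[OF t] h.hom_closed[OF sS]] by simp
      then have "commutator ?E (h t) (h s) = \<one>\<^bsub>?E\<^esub>" using t sS by simp
      then show "commutator S t s \<in> ?L" using t sS by (simp add: h.hom_commutator)
    qed (use n in simp)
    then show ?thesis using that by auto
  qed
  have \<psi>0_N': "\<psi>0 s = 0" if "s \<in> N'" for s
    using \<psi>0_one hN'[OF that] h.hom_one unfolding \<psi>0_def by simp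
  have \<psi>0_cong: "\<psi>0 s = \<psi>0 t" if "s \<in> N" "t \<in> N" "N' #> s = N' #> t" for s t
  proof -
    have "s \<in> N' #> t" using rcos_self[OF N.mem_carrier[OF that(1)] subgroup_lpc] that(3) by blast
    then obtain m where m: "m \<in> N'" "s = m \<otimes> t" by (auto simp: r_coset_def)
    have "\<psi>0 s = (\<psi>0 m + \<psi>0 t) mod int p" unfolding m(2) using \<psi>0_mult[OF N'_N[OF m(1)] that(2)] .
    also have "\<dots> = \<psi>0 t" using \<psi>0_N'[OF m(1)] by (simp add: \<psi>0_def mod_simps)
    finally show ?thesis .
  qed
  define \<psi> where "\<psi> = (\<lambda>c\<in>carrier A. \<psi>0 (SOME s. s \<in> N \<and> c = N' #> s))"
  have \<psi>: "\<psi> (N' #> s) = \<psi>0 s" if "s \<in> N" for s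
  proof -
    let ?t = "SOME t. t \<in> N \<and> N' #> s = N' #> t"
    have "?t \<in> N \<and> N' #> s = N' #> ?t" using that by (intro someI[of "\<lambda>t. t \<in> N \<and> N' #> s = N' #> t" s]) simp
    then have "\<psi>0 ?t = \<psi>0 s" using \<psi>0_cong[of ?t s] that by simp
    moreover have "N' #> s \<in> carrier A" using that by (simp add: carrier_A)
    ultimately show ?thesis by (simp add: \<psi>_def)
  qed
  have "\<psi> \<in> hom A (integer_mod_group p)"
  proof (rule homI)
    fix c assume "c \<in> carrier A"
    then obtain s where s: "s \<in> N" "c = N' #> s" by (auto simp: carrier_A)
    then show "\<psi> c \<in> carrier (integer_mod_group p)"
      using C.p_pos \<psi>[OF s(1)] by (simp add: \<psi>0_def carrier_integer_mod_group)
  next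
    fix c d assume "c \<in> carrier A" "d \<in> carrier A"
    then obtain s t where st: "s \<in> N" "c = N' #> s" "t \<in> N" "d = N' #> t" by (auto simp: carrier_A)
    have "c \<otimes>\<^bsub>A\<^esub> d = N' #> (s \<otimes> t)" unfolding st(2,4) by (rule A_mult[OF st(1,3)])
    then show "\<psi> (c \<otimes>\<^bsub>A\<^esub> d) = \<psi> c \<otimes>\<^bsub>integer_mod_group p\<^esub> \<psi> d"
      using \<psi>[OF N.m_closed[OF st(1,3)]] \<psi>[OF st(1)] \<psi>[OF st(3)] \<psi>0_mult[OF st(1,3)] st(2,4) by simp
  qed
  then have \<psi>C: "\<psi> \<in> Chars" by (simp add: \<psi>_def)
  \<comment> \<open>The value of \<open>h\<close> at \<open>sec x * sec y\<close> is computed twice,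
    by homomorphy and through the factor set. The discrepancy is the coboundary of the negated first
    component, whence the sign.\<close>
  define c where "c = (\<lambda>x\<in>carrier Q. (- fst (h (sec x))) mod int p)"
  have c: "c \<in> cochains1 Q (quotient_group_topology S T N) p"
    unfolding cochains_discrete using C.p_pos by (auto simp: c_def)
  have "int p dvd g (x, y) - transgress \<psi> (x, y) - (c y - c (x \<otimes>\<^bsub>Q\<^esub> y) + c x)"
    if x: "x \<in> carrier Q" and y: "y \<in> carrier Q" for x y
  proof -
    have xy: "x \<otimes>\<^bsub>Q\<^esub> y \<in> carrier Q" using x y by (rule Q.m_closed)
    let ?c = "\<lambda>x. fst (h (sec x))"
    have hsec: "snd (h (sec z)) = z" if "z \<in> carrier Q" for z
      using h_snd[OF sec(1)[OF that]] sec(2)[OF that] by simp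
    have fN: "factor_set x y \<in> N" by (rule factor_set_N[OF x y])
    have 1: "fst (h (sec x \<otimes> sec y)) = (?c x + ?c y + g (x, y)) mod int p"
      using h.hom_mult[OF sec(1)[OF x] sec(1)[OF y]] hsec[OF x] hsec[OF y] by (simp add: E_mult)
    have "fst (h (sec x \<otimes> sec y)) = fst (h (factor_set x y) \<otimes>\<^bsub>?E\<^esub> h (sec (x \<otimes>\<^bsub>Q\<^esub> y)))"
      unfolding sec_mult[OF x y] using h.hom_mult[OF N.mem_carrier[OF fN] sec(1)[OF xy]] by simp
    also have "\<dots> = ((\<psi>0 (factor_set x y) - ?g1) mod int p + ?c (x \<otimes>\<^bsub>Q\<^esub> y) + g (\<one>\<^bsub>Q\<^esub>, x \<otimes>\<^bsub>Q\<^esub> y)) mod int p"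
      unfolding E_mult h_N[OF fN] fst_conv snd_conv hsec[OF xy] ..
    also have "\<dots> = (\<psi>0 (factor_set x y) + ?c (x \<otimes>\<^bsub>Q\<^esub> y) + (g (\<one>\<^bsub>Q\<^esub>, x \<otimes>\<^bsub>Q\<^esub> y) - ?g1)) mod int p"
      unfolding mod_add3 by (simp only: algebra_simps)
    finally have "int p dvd (?c x + ?c y + g (x, y)) -
        (\<psi>0 (factor_set x y) + ?c (x \<otimes>\<^bsub>Q\<^esub> y) + (g (\<one>\<^bsub>Q\<^esub>, x \<otimes>\<^bsub>Q\<^esub> y) - ?g1))"
      unfolding 1 by (simp only: mod_eq_dvd_iff)
    from dvd_add[OF this cocycle_unit(1)[OF gc xy]]
    have "int p dvd g (x, y) - \<psi>0 (factor_set x y) - (- ?c y - - ?c (x \<otimes>\<^bsub>Q\<^esub> y) + - ?c x)"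
      by (simp add: algebra_simps del: mult_FactGroup one_FactGroup)
    moreover have "(g (x, y) - \<psi>0 (factor_set x y) - (c y - c (x \<otimes>\<^bsub>Q\<^esub> y) + c x)) mod int p =
        (g (x, y) - \<psi>0 (factor_set x y) - (- ?c y - - ?c (x \<otimes>\<^bsub>Q\<^esub> y) + - ?c x)) mod int p"
      unfolding c_def restrict_apply'[OF x] restrict_apply'[OF y] restrict_apply'[OF xy]
      by (intro mod_diff_cong[OF refl] mod_add_cong mod_diff_cong mod_mod_trivial)
    ultimately have "int p dvd g (x, y) - \<psi>0 (factor_set x y) - (c y - c (x \<otimes>\<^bsub>Q\<^esub> y) + c x)"
      by (simp only: dvd_eq_mod_eq_0)
    then show ?thesis using x y \<psi>[OF fN] by (simp add: transgress_def del: mult_FactGroup)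
  qed
  then show ?thesis using \<psi>C c by blast
qed

text \<open>The layer has as many characters as elements, so bijectivity of the class map on
  characters determines the order.\<close>

lemma card_H2:
  "finite (carrier (cohomology2 Q (quotient_group_topology S T N) p))"
  "card (carrier (cohomology2 Q (quotient_group_topology S T N) p)) = card (carrier A)"
proof -
  let ?cl = "\<lambda>f. C.B2 #>\<^bsub>C.Z2\<^esub> f"
  have finA: "finite (carrier A)"
    unfolding carrier_A using finite_index(1) N.subset by (auto simp: carrier_FactGroup elim: finite_subset[rotated])
  have bij: "bij_betw (\<lambda>\<psi>. ?cl (transgress \<psi>)) Chars (carrier (cohomology2 Q (quotient_group_topology S T N) p))"
  proof (rule bij_betwI')
    fix \<psi> \<psi>' assume \<psi>: "\<psi> \<in> Chars" "\<psi>' \<in> Chars"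
    show "?cl (transgress \<psi>) = ?cl (transgress \<psi>') \<longleftrightarrow> \<psi> = \<psi>'"
      using C.H2_class_eq[OF transgress_cocycle[OF \<psi>(1)] transgress_cocycle[OF \<psi>(2)]]
        transgress_inj[OF \<psi>] by blast
  next
    fix \<psi> assume "\<psi> \<in> Chars"
    then show "?cl (transgress \<psi>) \<in> carrier (cohomology2 Q (quotient_group_topology S T N) p)"
      unfolding C.carrier_H2 by (intro imageI transgress_cocycle)
  next
    fix d assume "d \<in> carrier (cohomology2 Q (quotient_group_topology S T N) p)"
    then obtain g where g: "g \<in> cocycles2 Q (quotient_group_topology S T N) p" "d = ?cl g"
      unfolding C.carrier_H2 by blast
    then obtain \<psi> where \<psi>: "\<psi> \<in> Chars" "\<exists>c\<in>cochains1 Q (quotient_group_topology S T N) p. \<forall>x\<in>carrier Q. \<forall>y\<in>carrier Q.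
        int p dvd g (x, y) - transgress \<psi> (x, y) - (c y - c (x \<otimes>\<^bsub>Q\<^esub> y) + c x)"
      using transgress_surj by blast
    then have "?cl g = ?cl (transgress \<psi>)"
      using C.H2_class_eq[OF g(1) transgress_cocycle[OF \<psi>(1)]] by blast
    then show "\<exists>\<psi>\<in>Chars. d = ?cl (transgress \<psi>)" using \<psi>(1) g(2) by blast
  qed
  have "card Chars = card (carrier A)" by (rule A.card_characters[OF finA])
  moreover have "finite Chars"
  proof (rule finite_subset)
    show "Chars \<subseteq> carrier A \<rightarrow>\<^sub>E {0..<int p}"
      using C.p_pos by (auto simp: hom_def carrier_integer_mod_group PiE_def)
  qed (intro finite_PiE finA; simp)
  ultimately show "finite (carrier (cohomology2 Q (quotient_group_topology S T N) p))"
    "card (carrier (cohomology2 Q (quotient_group_topology S T N) p)) = card (carrier A)"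
    using bij_betw_finite[OF bij] bij_betw_same_card[OF bij] by simp_all
qed

end

section \<open>Infinite bases\<close>

text \<open>Both ways of adding three residues produce the same total carry
  \<open>(a + b + c) div M\<close>. With \<open>M = p^(n-1)\<close> and values modulo
  \<open>p\<close>, this is the cocycle of the cyclic group of order \<open>p^n\<close> over its
  quotient of order \<open>p^(n-1)\<close>.\<close>

lemma carry_cocycle:
  fixes a b c M :: int
  shows "(b + c) div M - ((a + b) mod M + c) div M + (a + (b + c) mod M) div M - (a + b) div M = 0"
proof (cases "M = 0")
  case False
  have "(a + b) + c = M * ((a + b) div M) + ((a + b) mod M + c)"
    using mult_div_mod_eq[of M "a + b"] by linarith
  then have 1: "(a + b + c) div M = (a + b) div M + ((a + b) mod M + c) div M"
    using False by (metis add.commute div_mult_self4)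
  have "a + (b + c) = M * ((b + c) div M) + (a + (b + c) mod M)"
    using mult_div_mod_eq[of M "b + c"] by linarith
  then have 2: "(a + (b + c)) div M = (b + c) div M + (a + (b + c) mod M) div M"
    using False by (metis add.commute div_mult_self4)
  show ?thesis using 1 2 by (simp add: add.assoc)
qed simp

lemma subgroup_multiples:
  assumes "d dvd int M" "0 < M"
  shows "subgroup {a \<in> carrier (integer_mod_group M). d dvd a} (integer_mod_group M)"
proof -
  interpret comm_group "integer_mod_group M" by simp
  show ?thesis
  proof (rule subgroupI)
    have "0 \<in> {a \<in> carrier (integer_mod_group M). d dvd a}" by simp
    then show "{a \<in> carrier (integer_mod_group M). d dvd a} \<noteq> {}" by blast
  next
    fix a assume a: "a \<in> {a \<in> carrier (integer_mod_group M). d dvd a}"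
    then have "inv\<^bsub>integer_mod_group M\<^esub> a = (- a) mod int M" by simp
    then show "inv\<^bsub>integer_mod_group M\<^esub> a \<in> {a \<in> carrier (integer_mod_group M). d dvd a}"
      using a assms by (simp add: carrier_integer_mod_group dvd_mod)
  next
    fix a b assume "a \<in> {a \<in> carrier (integer_mod_group M). d dvd a}" "b \<in> {a \<in> carrier (integer_mod_group M). d dvd a}"
    then show "a \<otimes>\<^bsub>integer_mod_group M\<^esub> b \<in> {a \<in> carrier (integer_mod_group M). d dvd a}"
      using assms by (simp add: carrier_integer_mod_group dvd_mod)
  qed auto
qed

context free_profinite_group
begin

text \<open>With only one nontrivial value on the basis, convergence to 1 is automatic even for
  infinite \<open>X\<close>. The multiples of \<open>p^(k-1)\<close> form a filtration of the target
  that reaches 0 at position \<open>m + 1\<close>.\<close>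

lemma coordinate_hom:
  assumes p: "prime p" and x: "x \<in> X" and m: "1 \<le> m"
  shows "\<exists>h\<in>hom S (integer_mod_group (p ^ m)). h x = 1 \<and> (\<forall>x'\<in>X. x' \<noteq> x \<longrightarrow> h x' = 0) \<and>
    (\<forall>C. openin T {s \<in> carrier S. h s \<in> C}) \<and> (\<forall>s\<in>lpc p (Suc m). h s = 0)"
proof -
  let ?M = "p ^ m"
  let ?H = "integer_mod_group ?M"
  interpret H: comm_group ?H by simp
  have "1 < ?M" using prime_gt_1_nat[OF p] m by (intro one_less_power) simp_all
  have M0: "0 < ?M" using prime_gt_0_nat[OF p] by simp
  have "int 1 < int ?M" using \<open>1 < ?M\<close> by (simp only: of_nat_less_iff)
  then have "1 < int ?M" unfolding of_nat_1 .
  note M = M0 this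
  have carr: "carrier ?H = {0..<int ?M}" using prime_gt_0_nat[OF p] by (simp add: carrier_integer_mod_group)
  let ?f = "\<lambda>z. if z = x then 1 else (0::int)"
  have "?f \<in> X \<rightarrow> carrier ?H" unfolding carr using M by auto
  moreover have "finite {z \<in> X. ?f z \<noteq> \<one>\<^bsub>?H\<^esub>}" by (rule finite_subset[of _ "{x}"]) auto
  moreover have "X \<noteq> {}" using x by blast
  moreover have "finite (carrier ?H)" unfolding carr by simp
  ultimately obtain h where h: "h \<in> hom S ?H" "\<forall>z\<in>X. h z = ?f z"
    and op: "\<And>C. openin T {s \<in> carrier S. h s \<in> C}"
    using lift_finite[OF _ H.is_group, of ?f] by blast
  define F where "F = (\<lambda>k. {a \<in> carrier ?H. int p ^ (k - 1) dvd a})"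
  have "h s \<in> F (Suc m)" if "s \<in> lpc p (Suc m)" for s
  proof (rule lpc_hom_image[where F = F and m = "Suc m", OF H.is_group h(1) op _ _ _ _ _ _ that])
    show "F 1 = carrier ?H" by (simp add: F_def)
    show "subgroup (F k) ?H" if "1 \<le> k" "k \<le> Suc m" for k
      unfolding F_def using that M by (intro subgroup_multiples) (auto intro: le_imp_power_dvd)
  next
    fix k a assume k: "1 \<le> k" "k < Suc m" and a: "a \<in> F k"
    then obtain j where j: "k = Suc j" by (cases k) auto
    have "int p * int p ^ j dvd int p * a" using a by (intro mult_dvd_mono) (auto simp: F_def j)
    moreover have "int p * int p ^ j dvd int ?M"
      using k(2) le_imp_power_dvd[of "Suc j" m "int p"] j by simp
    ultimately have "int p ^ k dvd (int p * a) mod int ?M" unfolding j power_Suc by (rule dvd_mod)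
    then show "a [^]\<^bsub>?H\<^esub> p \<in> F (Suc k)" using M by (simp add: F_def carr)
  next
    fix k g a assume k: "1 \<le> k" "k < Suc m" and g: "g \<in> carrier ?H" and a: "a \<in> F k"
    then have "commutator ?H g a = 0" using H.commutator_eq_one[OF g, of a] by (simp add: F_def)
    then show "commutator ?H g a \<in> F (Suc k)" by (simp add: F_def)
  qed auto
  then have "h s = 0" if "s \<in> lpc p (Suc m)" for s
    using that zdvd_imp_le[of "int ?M" "h s"] by (force simp: F_def carr)
  moreover have "h x = 1" "\<forall>x'\<in>X. x' \<noteq> x \<longrightarrow> h x' = 0" using h(2) x by simp_all
  ultimately show ?thesis using op by (intro bexI[OF _ h(1)]) blast
qed

end

context lpc_layer
begin

lemma pow_in_N: "x \<in> carrier S \<Longrightarrow> x [^] (p ^ (n - 1)) \<in> N"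
  using central_filtration.P_power_iter[OF central_filtration_lpc[of p], of 1 x "n - 1"] n
    prime_gt_0_nat[OF prime_p] by simp

text \<open>The powers \<open>x^(p^(n-1))\<close> of basis elements are distinct modulo
  \<open>N'\<close>: the coordinate map of \<open>x\<close> into the integers modulo
  \<open>p^n\<close> kills \<open>N'\<close>, sends this power of \<open>x\<close> to
  \<open>p^(n-1)\<close>, which is nonzero, and the power of any other basis element to 0.\<close>

lemma infinite_A:
  assumes "infinite X" shows "infinite (carrier A)"
proof
  assume fin: "finite (carrier A)"
  let ?q = "p ^ (n - 1)"
  let ?\<phi> = "\<lambda>x. N' #> (x [^] ?q)"
  have "?\<phi> ` X \<subseteq> carrier A" using pow_in_N basis_subset by (auto simp: carrier_A)
  then have "finite (?\<phi> ` X)" using fin finite_subset by blast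
  moreover have "inj_on ?\<phi> X"
  proof (rule inj_onI, rule ccontr)
    fix x y assume xy: "x \<in> X" "y \<in> X" and eq: "?\<phi> x = ?\<phi> y" and ne: "x \<noteq> y"
    obtain h where h: "h \<in> hom S (integer_mod_group (p ^ n))" "h x = 1" "h y = 0" "\<And>s. s \<in> N' \<Longrightarrow> h s = 0"
      using coordinate_hom[OF prime_p xy(1), of n] n xy ne by auto
    interpret h: group_hom S "integer_mod_group (p ^ n)" h
      by (intro group_hom.intro group_hom_axioms.intro is_group group_integer_mod_group h(1))
    have cl: "x \<in> carrier S" "y \<in> carrier S" using xy basis_subset by auto
    have "x [^] ?q \<in> N' #> (y [^] ?q)" using rcos_self[OF _ subgroup_lpc, of "x [^] ?q" p "Suc n"] cl eq by simp
    then obtain \<nu> where \<nu>: "\<nu> \<in> N'" "x [^] ?q = \<nu> \<otimes> y [^] ?q" by (auto simp: r_coset_def)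
    have "h (x [^] ?q) = h (y [^] ?q)"
      unfolding \<nu>(2) using \<nu>(1) h(4) N'.mem_carrier cl h.hom_closed[of "y [^] ?q"] prime_gt_0_nat[OF prime_p]
      by (simp add: carrier_integer_mod_group split: if_splits)
    moreover have "h (x [^] ?q) = int ?q mod int (p ^ n)" "h (y [^] ?q) = 0"
      using cl h(2,3) by (simp_all add: h.hom_nat_pow)
    moreover have "?q < p ^ n" using n prime_gt_1_nat[OF prime_p] by (intro power_strict_increasing) auto
    then have "int ?q mod int (p ^ n) = int ?q" by (simp only: of_nat_mod[symmetric] mod_less)
    ultimately have "?q = 0" by simp
    then show False using prime_gt_0_nat[OF prime_p] by simp
  qed
  ultimately show False using assms finite_imageD by blast
qed

text \<open>
  The inflations of the carry cocycle of \<open>\<int>/p\<^sup>n\<^sup>-\<^sup>1\<close> along the coordinate maps are separated by the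
  class functions \<open>f \<mapsto> \<Sum> f (u\<^sup>k, u)\<close>, the sum being over \<open>k < p\<^sup>n\<^sup>-\<^sup>1\<close>, for \<open>u\<close> a basis element.
\<close>

lemma infinite_H2:
  assumes "infinite X"
  shows "infinite (carrier (cohomology2 Q (quotient_group_topology S T N) p))"
proof
  assume fin: "finite (carrier (cohomology2 Q (quotient_group_topology S T N) p))"
  let ?U = "quotient_group_topology S T N"
  let ?M = "p ^ (n - 1)"
  let ?\<pi> = "\<lambda>s. N #> s"
  let ?cl = "\<lambda>f. C.B2 #>\<^bsub>C.Z2\<^esub> f"
  have p1: "1 < p" using prime_p by (rule prime_gt_1_nat)
  have M1: "1 < ?M" using p1 n by (intro one_less_power) simp_all
  interpret \<pi>: group_hom S Q ?\<pi>
    by (intro group_hom.intro group_hom_axioms.intro is_group Q.is_group N.r_coset_hom_Mod)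
  define good where "good = (\<lambda>x h. h \<in> hom S (integer_mod_group ?M) \<and> h x = 1 \<and>
    (\<forall>x'\<in>X. x' \<noteq> x \<longrightarrow> h x' = 0) \<and> (\<forall>C. openin T {s \<in> carrier S. h s \<in> C}) \<and> (\<forall>s\<in>N. h s = 0))"
  have "\<exists>h. good x h" if "x \<in> X" for x
  proof -
    have "1 \<le> n - 1" "Suc (n - 1) = n" using n by auto
    then show ?thesis using coordinate_hom[OF prime_p that, of "n - 1"] unfolding good_def by auto
  qed
  then obtain k where k: "\<And>x. x \<in> X \<Longrightarrow> good x (k x)" by metis
  \<comment> \<open>The coordinate maps kill \<open>N\<close>, so their values on representatives do
    not depend on the choice; this makes them continuous on the quotient although \<open>sec\<close>
    need not be.\<close>
  define \<theta> where "\<theta> = (\<lambda>x u. k x (sec u))"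
  have carr: "carrier (integer_mod_group ?M) = {0..<int ?M}" using p1 by (simp add: carrier_integer_mod_group)
  have kmult: "k x (s \<otimes> t) = (k x s + k x t) mod int ?M" if "x \<in> X" "s \<in> carrier S" "t \<in> carrier S" for x s t
    using k[OF that(1)] that(2,3) by (simp add: good_def hom_def)
  have krange: "k x s \<in> {0..<int ?M}" if "x \<in> X" "s \<in> carrier S" for x s
    using k[OF that(1)] that(2) carr by (auto simp: good_def hom_def)
  have \<theta>\<pi>: "\<theta> x (?\<pi> s) = k x s" if x: "x \<in> X" and s: "s \<in> carrier S" for x s
  proof -
    have \<pi>s: "?\<pi> s \<in> carrier Q" using s by (rule \<pi>.hom_closed)
    have "sec (?\<pi> s) \<in> ?\<pi> s" using rcos_self[OF sec(1)[OF \<pi>s] subgroup_lpc, of p n] sec(2)[OF \<pi>s] by simp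
    then obtain \<nu> where \<nu>: "\<nu> \<in> N" "sec (?\<pi> s) = \<nu> \<otimes> s" by (auto simp: r_coset_def)
    have "k x (\<nu> \<otimes> s) = (0 + k x s) mod int ?M"
      using kmult[OF x N.mem_carrier[OF \<nu>(1)] s] k[OF x] \<nu>(1) by (simp add: good_def)
    then show ?thesis unfolding \<theta>_def \<nu>(2) using krange[OF x s] by simp
  qed
  have \<theta>_range: "\<theta> x u \<in> {0..<int ?M}" if "x \<in> X" "u \<in> carrier Q" for x u
    unfolding \<theta>_def using krange[OF that(1) sec(1)[OF that(2)]] .
  have \<theta>_mult: "\<theta> x (u \<otimes>\<^bsub>Q\<^esub> v) = (\<theta> x u + \<theta> x v) mod int ?M"
    if x: "x \<in> X" and u: "u \<in> carrier Q" and v: "v \<in> carrier Q" for x u v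
  proof -
    obtain s t where st: "s \<in> carrier S" "u = ?\<pi> s" "t \<in> carrier S" "v = ?\<pi> t"
      using u v by (auto simp: carrier_FactGroup)
    have eq: "u \<otimes>\<^bsub>Q\<^esub> v = ?\<pi> (s \<otimes> t)" unfolding st(2,4) by (rule \<pi>.hom_mult[OF st(1,3), symmetric])
    have "\<theta> x (u \<otimes>\<^bsub>Q\<^esub> v) = k x (s \<otimes> t)" unfolding eq by (rule \<theta>\<pi>[OF x m_closed[OF st(1,3)]])
    then show ?thesis unfolding kmult[OF x st(1,3)] st(2,4) \<theta>\<pi>[OF x st(1)] \<theta>\<pi>[OF x st(3)] .
  qed
  define f where "f = (\<lambda>x. \<lambda>(u, v)\<in>carrier Q \<times> carrier Q. (\<theta> x u + \<theta> x v) div int ?M)"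
  have carry_range: "(a + b) div int ?M \<in> {0..<int p}" if "a \<in> {0..<int ?M}" "b \<in> {0..<int ?M}" for a b
  proof -
    have "(a + b) div int ?M = (if a + b < int ?M then 0 else 1)"
    proof (cases "a + b < int ?M")
      case False
      then have "(a + b) div int ?M = (a + b - int ?M) div int ?M + 1"
        using p1 that by (intro div_pos_geq) auto
      moreover have "(a + b - int ?M) div int ?M = 0"
        using False that by (intro div_pos_pos_trivial) auto
      ultimately show ?thesis using False by simp
    qed (use that in \<open>simp add: div_pos_pos_trivial\<close>)
    then show ?thesis using p1 by simp
  qed
  have f_cocycle: "f x \<in> cocycles2 Q ?U p" if x: "x \<in> X" for x
    unfolding C.cocycles2_iff C.cochains2_iff
  proof (intro conjI)
    show "f x \<in> extensional (carrier Q \<times> carrier Q)" by (simp add: f_def)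
    have \<theta>_cont: "continuous_map ?U (discrete_topology {0..<int ?M}) (\<theta> x)"
      unfolding continuous_map_def
    proof (intro conjI allI impI)
      show "\<theta> x \<in> topspace ?U \<rightarrow> topspace (discrete_topology {0..<int ?M})"
        using \<theta>_range[OF x] by (simp add: topspace_quotient)
      fix C :: "int set"
      have "{s \<in> carrier S. ?\<pi> s \<in> {u \<in> topspace ?U. \<theta> x u \<in> C}} = {s \<in> carrier S. k x s \<in> C}"
        using \<theta>\<pi>[OF x] \<pi>.hom_closed by (auto simp: topspace_quotient)
      then show "openin ?U {u \<in> topspace ?U. \<theta> x u \<in> C}"
        using k[OF x] unfolding openin_quotient_group_topology good_def by (auto simp: topspace_quotient)
    qed
    have "continuous_map (prod_topology ?U ?U) (discrete_topology {0..<int p})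
        (\<lambda>u. (\<theta> x (fst u) + \<theta> x (snd u)) div int ?M)"
    proof (rule continuous_map_discrete_binop[where k = "\<lambda>a b. (a + b) div int ?M"])
      show "continuous_map (prod_topology ?U ?U) (discrete_topology {0..<int ?M}) (\<lambda>u. \<theta> x (fst u))"
        "continuous_map (prod_topology ?U ?U) (discrete_topology {0..<int ?M}) (\<lambda>u. \<theta> x (snd u))"
        using continuous_map_compose[OF continuous_map_fst \<theta>_cont] continuous_map_compose[OF continuous_map_snd \<theta>_cont]
        by (simp_all add: o_def)
    qed (rule carry_range)
    then show "continuous_map (prod_topology ?U ?U) (discrete_topology {0..<int p}) (f x)"
      unfolding f_def by (intro continuous_map_restrict) (simp_all add: case_prod_unfold topspace_quotient)
    show "C.cocycle (f x)"
      unfolding C.cocycle_def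
    proof (intro ballI)
      fix u v w assume uvw: "u \<in> carrier Q" "v \<in> carrier Q" "w \<in> carrier Q"
      have uv: "u \<otimes>\<^bsub>Q\<^esub> v \<in> carrier Q" and vw: "v \<otimes>\<^bsub>Q\<^esub> w \<in> carrier Q"
        by (rule Q.m_closed[OF uvw(1,2)], rule Q.m_closed[OF uvw(2,3)])
      have "f x (v, w) - f x (u \<otimes>\<^bsub>Q\<^esub> v, w) + f x (u, v \<otimes>\<^bsub>Q\<^esub> w) - f x (u, v) = 0"
        using carry_cocycle[of "\<theta> x v" "\<theta> x w" "int ?M" "\<theta> x u"] uvw uv vw
        by (simp add: f_def \<theta>_mult[OF x uvw(1,2)] \<theta>_mult[OF x uvw(2,3)] del: mult_FactGroup)
      then show "int p dvd f x (v, w) - f x (u \<otimes>\<^bsub>Q\<^esub> v, w) + f x (u, v \<otimes>\<^bsub>Q\<^esub> w) - f x (u, v)" by simp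
    qed
  qed
  have "inj_on (\<lambda>x. ?cl (f x)) X"
  proof (rule inj_onI, rule ccontr)
    fix x y assume xy: "x \<in> X" "y \<in> X" and eq: "?cl (f x) = ?cl (f y)" and ne: "x \<noteq> y"
    obtain c where c: "\<And>u v. u \<in> carrier Q \<Longrightarrow> v \<in> carrier Q \<Longrightarrow>
        int p dvd f x (u, v) - f y (u, v) - (c v - c (u \<otimes>\<^bsub>Q\<^esub> v) + c u)"
      using eq C.H2_class_eq[OF f_cocycle[OF xy(1)] f_cocycle[OF xy(2)]] by blast
    have xS: "x \<in> carrier S" using xy basis_subset by blast
    let ?u = "\<lambda>j::nat. ?\<pi> (x [^] j)"
    have u: "?u j \<in> carrier Q" for j using xS by (intro \<pi>.hom_closed) simp
    have us: "?u j \<otimes>\<^bsub>Q\<^esub> ?u 1 = ?u (Suc j)" for j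
      using \<pi>.hom_mult[of "x [^] j" "x [^] (1::nat)"] xS by (simp del: mult_FactGroup)
    have \<theta>x: "\<theta> x (?u j) = int j mod int ?M" for j
    proof -
      have "\<theta> x (?u j) = k x (x [^] j)" using \<theta>\<pi>[OF xy(1)] xS by simp
      also have "\<dots> = int j mod int ?M"
      proof (induction j)
        case 0
        then show ?case using k[OF xy(1)] N.one_closed by (simp add: good_def)
      next
        case (Suc j)
        then show ?case
          using kmult[OF xy(1), of "x [^] j" x] xS k[OF xy(1)] by (simp add: good_def mod_simps add.commute)
      qed
      finally show ?thesis .
    qed
    have \<theta>y: "\<theta> y (?u j) = 0" for j
    proof -
      have "\<theta> y (?u j) = k y (x [^] j)" using \<theta>\<pi>[OF xy(2)] xS by simp
      also have "\<dots> = 0"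
      proof (induction j)
        case 0
        then show ?case using k[OF xy(2)] N.one_closed by (simp add: good_def)
      next
        case (Suc j)
        then show ?case
          using kmult[OF xy(2), of "x [^] j" x] xS k[OF xy(2)] xy ne by (simp add: good_def)
      qed
      finally show ?thesis .
    qed
    \<comment> \<open>Adding 1 to a residue \<open>j < ?M\<close> carries only at the last
      one.\<close>
    have fx: "f x (?u j, ?u 1) = (if j = ?M - 1 then 1 else 0)" if j: "j < ?M" for j
    proof -
      have "\<theta> x (?u j) = int j" "\<theta> x (?u 1) = int 1"
        unfolding \<theta>x of_nat_mod[symmetric] mod_less[OF j] mod_less[OF M1] by (rule refl)+
      then have "f x (?u j, ?u 1) = (int j + 1) div int ?M"
        using u[of j] u[of 1] by (simp add: f_def)
      also have "(int j + 1) div int ?M = int ((j + 1) div ?M)" by (simp only: of_nat_div of_nat_add of_nat_1)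
      also have "(j + 1) div ?M = (if j = ?M - 1 then 1 else 0)"
      proof (cases "j = ?M - 1")
        case True
        then have "j + 1 = ?M" using M1 by simp
        then show ?thesis using True M1 by (simp del: power_eq_0_iff)
      next
        case False
        then show ?thesis using j by (simp add: div_less)
      qed
      finally show ?thesis by simp
    qed
    have fy: "f y (?u j, ?u 1) = 0" for j
      using u[of j] u[of 1] \<theta>y[of j] \<theta>y[of 1] by (simp add: f_def)
    \<comment> \<open>Summed over the powers of \<open>x\<close>, the coboundary telescopes to 0
      because \<open>x^?M\<close> lies in \<open>N\<close>, except for \<open>?M * c (?u 1)\<close>,
      which \<open>p\<close> divides since \<open>n >= 2\<close>. The single carry 1 is left
      over.\<close>
    have "int p dvd (\<Sum>j<?M. f x (?u j, ?u 1) - f y (?u j, ?u 1) - (c (?u 1) - c (?u (Suc j)) + c (?u j)))"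
    proof (rule dvd_sum)
      fix j
      show "int p dvd f x (?u j, ?u 1) - f y (?u j, ?u 1) - (c (?u 1) - c (?u (Suc j)) + c (?u j))"
        using c[OF u[of j] u[of 1]] unfolding us .
    qed
    also have "(\<Sum>j<?M. f x (?u j, ?u 1) - f y (?u j, ?u 1) - (c (?u 1) - c (?u (Suc j)) + c (?u j))) =
        (\<Sum>j<?M. f x (?u j, ?u 1)) - int ?M * c (?u 1) + (\<Sum>j<?M. c (?u (Suc j)) - c (?u j))"
      unfolding fy by (simp add: sum.distrib sum_subtractf)
    also have "(\<Sum>j<?M. c (?u (Suc j)) - c (?u j)) = c (?u ?M) - c (?u 0)"
      by (rule sum_lessThan_telescope)
    also have "?u ?M = ?u 0"
      using coset_join2[OF _ subgroup_lpc pow_in_N[OF xS]] coset_mult_one[OF N.subset] xS by simp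
    also have "(\<Sum>j<?M. f x (?u j, ?u 1)) = (\<Sum>j<?M. if j = ?M - 1 then 1 else 0)"
      using fx by (intro sum.cong) auto
    also have "\<dots> = 1" using M1 by (subst sum.delta) auto
    finally have "int p dvd 1 - int ?M * c (?u 1)" by simp
    moreover have "int p dvd int ?M * c (?u 1)"
    proof -
      have "p dvd ?M" using n by (intro dvd_power) auto
      then show ?thesis by (intro dvd_mult2) (simp only: int_dvd_int_iff)
    qed
    ultimately have "int p dvd 1" using dvd_add[of "int p" "1 - int ?M * c (?u 1)" "int ?M * c (?u 1)"] by simp
    then show False using p1 by simp
  qed
  moreover have "(\<lambda>x. ?cl (f x)) ` X \<subseteq> carrier (cohomology2 Q ?U p)"
    unfolding C.carrier_H2 using f_cocycle by blast
  ultimately show False using assms fin finite_subset finite_imageD by metis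
qed

end

theorem corollary8p6:
  fixes S :: "('a, 'm) monoid_scheme" and T :: "'a topology" and X :: "'a set" and p n :: nat
  assumes "prime p"
    and "X \<noteq> {}"
    and "free_profinite_group S T X"
    and "n \<ge> 2"
  shows "Fp_dim p (cohomology2 (S Mod lower_p_central S T p n)
             (quotient_group_topology S T (lower_p_central S T p n)) p) =
           Fp_dim p (S\<lparr>carrier := lower_p_central S T p n\<rparr> Mod lower_p_central S T p (n + 1))
       \<and> ereal_of_enat
           (Fp_dim p (S\<lparr>carrier := lower_p_central S T p n\<rparr> Mod lower_p_central S T p (n + 1))) =
           (\<Sum>s = 1..n. necklace s (ecard X))"
proof -
  interpret lpc_layer S T X p n
    using assms by (intro lpc_layer.intro lpc_layer_axioms.intro)
  show ?thesis
  proof (cases "finite X")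
    case True
    interpret transgression S T X p n by unfold_locales (rule True)
    obtain m where m: "n = Suc m" using n by (cases n) auto
    obtain d where d: "finite (carrier A)" "card (carrier A) = p ^ d"
      "ereal (real d) = (\<Sum>s = 1..n. necklace s (ecard X))"
      using lpc_layer_card[OF prime_p X_nonempty True, of m] unfolding m by auto
    have "Fp_dim p A = enat d" by (rule A.Fp_dim_eq_enat[OF d(1,2)])
    moreover have "Fp_dim p (cohomology2 Q (quotient_group_topology S T N) p) = enat d"
      using card_H2 d(2) by (intro C.H2.Fp_dim_eq_enat) auto
    ultimately show ?thesis using d(3) by simp
  next
    case False
    have "(\<Sum>s = 1..n. necklace s (ecard X)) = \<infinity>"
      using False n by (auto simp: ecard_def sum_Pinfty intro: exI[of _ n])
    then show ?thesis
      using A.Fp_dim_eq_infinity[OF infinite_A[OF False]] C.H2.Fp_dim_eq_infinity[OF infinite_H2[OF False]]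
      by simp
  qed
qed

end
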